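(* Let $X$ be an oriented Riemannian four-manifold whose curvature satisfies $$\left|\left\langle\left(W^++\frac{s}{12}\right)v,v\right\rangle\right|>\left|\mathrm{Ric}_0(v)\right|$$ for every unit length $v\in\Lambda^+$. Then the induced symplectic form on the twistor space $Z$ of $X$ tames $J_+$ if $\det(W^++s/12)>0$, whilst it tames $J_-$ if $\det(W^++s/12)<0$.
   Context: $\Lambda^2=\Lambda^+\oplus\Lambda^-$ is the splitting into self-dual and anti-self-dual 2-forms; if $e_i$ is an orthonormal coframe then $\{e_i\wedge e_j\}_{i<j}$ is orthonormal in $\Lambda^2$. The curvature operator decomposes as $$\mathrm{Rm}=\begin{pmatrix}W^++\frac{s}{12}&\mathrm{Ric}_0^*\\ \mathrm{Ric}_0&W^-+\frac{s}{12}\end{pmatrix}\colon\Lambda^+\oplus\Lambda^-\to\Lambda^+\oplus\Lambda^-,$$ with $W^\pm$ the Weyl curvatures, $s$ the scalar curvature (positive on round spheres), and $\mathrm{Ric}_0\colon\Lambda^+\to\Lambda^-$ the trace-free Ricci operator, $\mathrm{Ric}_0(a\wedge b)=\frac12(\mathrm{ric}_0(a)\wedge b+a\wedge\mathrm{ric}_0(b))$, $\mathrm{ric}_0\colon T^*X\to T^*X$ being the trace-free Ricci curvature. The twistor space $\pi\colon Z\to X$ is the unit sphere bundle of $\Lambda^+$. The Levi-Civita connection splits $TZ=V\oplus H$ (vertical and horizontal). A point $p\in Z$ determines, via the metric and after scaling, an almost complex structure on $T_{\pi(p)}X\cong H_p$ compatible with metric and orientation; both $J_+$ and $J_-$ preserve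 the splitting and equal this structure on $H$. On $V$, $J_+$ is the standard complex structure of the sphere (so that $J_+$ is the Atiyah--Hitchin--Singer structure, integrable when $W^+=0$) and $J_-$ is its negative (the Eells--Salamon structure). The Levi-Civita connection on $\Lambda^+$ induces a metric connection on $V$ (Levi-Civita along the round fibres; parallel transport, which is isometric between fibres, in horizontal directions); its curvature is $2\pi i\,\omega$ for a closed real 2-form $\omega$ on $Z$, the induced 2-form. It depends on a choice of orientation of the fibres: reversing that orientation changes the sign of $\omega$; the orientation is taken to agree with the vertical part of the almost complex structure under consideration, so that $2\pi\omega$ restricts to the positive area form on each fibre so oriented. The curvature inequality implies that $\omega$ is symplectic. A 2-form tames an almost complex structure $J$ if it is positive on all $J$-complex lines (with their complex orientation). *)

theory Defs
  imports "HOL-Analysis.Analysis"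
begin

text \<open>
  A tensor at a point of a manifold is handled through its components in the charts around that
  point.  A metric is a matrix \<open>M\<close> with entries \<open>M\<^sub>i\<^sub>j = g(\<partial>\<^sub>i, \<partial>\<^sub>j)\<close>, and a 2-form is an
  antisymmetric matrix \<open>A\<close> with entries \<open>A\<^sub>i\<^sub>j = \<alpha>(\<partial>\<^sub>i, \<partial>\<^sub>j)\<close>.
\<close>

section \<open>Smooth maps and tangent spaces of subsets of normed spaces\<close>

text \<open>Meaningful for open \<open>S\<close> and finite-dimensional domains.\<close>

primrec Ck_on :: "nat \<Rightarrow> ('a::real_normed_vector \<Rightarrow> 'b::real_normed_vector) \<Rightarrow> 'a set \<Rightarrow> bool" where
  "Ck_on 0 f S \<longleftrightarrow> continuous_on S f"
| "Ck_on (Suc k) f S \<longleftrightarrow>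
     (\<forall>x\<in>S. f differentiable (at x)) \<and> (\<forall>v. Ck_on k (\<lambda>x. frechet_derivative f (at x) v) S)"

definition smooth_map_on :: "'a::real_normed_vector set \<Rightarrow> ('a \<Rightarrow> 'b::real_normed_vector) \<Rightarrow> bool" where
  "smooth_map_on S f \<longleftrightarrow> (\<forall>k. Ck_on k f S)"

definition velocities :: "'a::real_normed_vector set \<Rightarrow> 'a \<Rightarrow> 'a set" where
  "velocities S z = {\<xi>. \<exists>\<gamma>::real \<Rightarrow> 'a. \<gamma> 0 = z \<and> (\<forall>\<^sub>F t in nhds 0. \<gamma> t \<in> S) \<and>
                          (\<gamma> has_vector_derivative \<xi>) (at 0)}"

definition lie_bracket :: "('a::real_normed_vector \<Rightarrow> 'a) \<Rightarrow> ('a \<Rightarrow> 'a) \<Rightarrow> 'a \<Rightarrow> 'a" where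
  "lie_bracket X Y z = frechet_derivative Y (at z) (X z) - frechet_derivative X (at z) (Y z)"


section \<open>Two-forms on an oriented Euclidean four-space\<close>

definition inner_product_matrix :: "real^4^4 \<Rightarrow> bool" where
  "inner_product_matrix M \<longleftrightarrow> transpose M = M \<and> (\<forall>v. v \<noteq> 0 \<longrightarrow> v \<bullet> (M *v v) > 0)"

definition raise :: "real^4^4 \<Rightarrow> real^4^4 \<Rightarrow> real^4^4" where
  "raise M A = matrix_inv M ** A ** matrix_inv M"

text \<open>The factor one half makes \<open>e\<^sub>i \<and> e\<^sub>j\<close>, \<open>i < j\<close>, orthonormal for an orthonormal coframe.\<close>

definition form_inner :: "real^4^4 \<Rightarrow> real^4^4 \<Rightarrow> real^4^4 \<Rightarrow> real" where
  "form_inner M A B = (1/2) * (\<Sum>i\<in>UNIV. \<Sum>j\<in>UNIV. A$i$j * raise M B $i$j)"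

definition form_norm :: "real^4^4 \<Rightarrow> real^4^4 \<Rightarrow> real" where
  "form_norm M A = sqrt (form_inner M A A)"

definition levi_civita_symbol :: "4 \<Rightarrow> 4 \<Rightarrow> 4 \<Rightarrow> 4 \<Rightarrow> real" where
  "levi_civita_symbol i j k l =
     det (vector [axis i 1, axis j 1, axis k 1, axis l 1] :: real^4^4)"

definition hodge :: "real^4^4 \<Rightarrow> real^4^4 \<Rightarrow> real^4^4" where
  "hodge M A = (\<chi> i j. (1/2) * sqrt (det M) *
     (\<Sum>k\<in>UNIV. \<Sum>l\<in>UNIV. levi_civita_symbol i j k l * raise M A $k$l))"

definition two_forms :: "(real^4^4) set" where
  "two_forms = {A. transpose A = - A}"

definition Lambda_plus :: "real^4^4 \<Rightarrow> (real^4^4) set" where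
  "Lambda_plus M = {A \<in> two_forms. hodge M A = A}"

definition sd_part :: "real^4^4 \<Rightarrow> real^4^4 \<Rightarrow> real^4^4" where
  "sd_part M A = (1/2) *\<^sub>R (A + hodge M A)"

definition orthonormal_basis_plus :: "real^4^4 \<Rightarrow> (3 \<Rightarrow> real^4^4) \<Rightarrow> bool" where
  "orthonormal_basis_plus M f \<longleftrightarrow> (\<forall>i. f i \<in> Lambda_plus M) \<and>
     (\<forall>i j. form_inner M (f i) (f j) = (if i = j then 1 else 0))"

text \<open>Determinant of an endomorphism of \<open>\<Lambda>\<^sup>+\<close>; it does not depend on the basis.\<close>

definition det_plus :: "real^4^4 \<Rightarrow> (real^4^4 \<Rightarrow> real^4^4) \<Rightarrow> real" where
  "det_plus M T =
     (let f = (SOME f. orthonormal_basis_plus M f)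
      in det ((\<chi> i j. form_inner M (f i) (T (f j))) :: real^3^3))"


section \<open>Curvature of a metric on an open subset of four-space\<close>

definition christoffel :: "(real^4 \<Rightarrow> real^4^4) \<Rightarrow> real^4 \<Rightarrow> 4 \<Rightarrow> 4 \<Rightarrow> 4 \<Rightarrow> real" where
  "christoffel G u k i j =
     (let dG = (\<lambda>a. frechet_derivative G (at u) (axis a 1))
      in (1/2) * (\<Sum>l\<in>UNIV. matrix_inv (G u) $k$l * (dG i $j$l + dG j $i$l - dG l $i$j)))"

text \<open>\<open>R(\<partial>\<^sub>i, \<partial>\<^sub>j)\<partial>\<^sub>k = \<Sum>\<^sub>l riemann G u l k i j \<cdot> \<partial>\<^sub>l\<close>, where \<open>R(X,Y) = [\<nabla>\<^sub>X, \<nabla>\<^sub>Y] - \<nabla>\<^sub>[\<^sub>X\<^sub>,\<^sub>Y\<^sub>]\<close>.\<close>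

definition riemann :: "(real^4 \<Rightarrow> real^4^4) \<Rightarrow> real^4 \<Rightarrow> 4 \<Rightarrow> 4 \<Rightarrow> 4 \<Rightarrow> 4 \<Rightarrow> real" where
  "riemann G u l k i j =
     frechet_derivative (\<lambda>w. christoffel G w l j k) (at u) (axis i 1)
     - frechet_derivative (\<lambda>w. christoffel G w l i k) (at u) (axis j 1)
     + (\<Sum>m\<in>UNIV. christoffel G u l i m * christoffel G u m j k
                 - christoffel G u l j m * christoffel G u m i k)"

definition ricci :: "(real^4 \<Rightarrow> real^4^4) \<Rightarrow> real^4 \<Rightarrow> real^4^4" where
  "ricci G u = (\<chi> j k. \<Sum>i\<in>UNIV. riemann G u i k i j)"

definition scal :: "(real^4 \<Rightarrow> real^4^4) \<Rightarrow> real^4 \<Rightarrow> real" where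
  "scal G u = (\<Sum>j\<in>UNIV. \<Sum>k\<in>UNIV. matrix_inv (G u) $j$k * ricci G u $j$k)"

text \<open>The sign is such that the curvature operator of the unit sphere is the identity:
  \<open>\<langle>Rm(e\<^sub>k \<and> e\<^sub>l), e\<^sub>i \<and> e\<^sub>j\<rangle> = g(R(e\<^sub>i, e\<^sub>j)e\<^sub>l, e\<^sub>k)\<close>.\<close>

definition curvature_operator :: "(real^4 \<Rightarrow> real^4^4) \<Rightarrow> real^4 \<Rightarrow> real^4^4 \<Rightarrow> real^4^4" where
  "curvature_operator G u A = (\<chi> i j. (1/2) * (\<Sum>k\<in>UNIV. \<Sum>l\<in>UNIV.
     (\<Sum>m\<in>UNIV. G u $k$m * riemann G u m l i j) * raise (G u) A $k$l))"

text \<open>Matrix of the trace-free Ricci curvature as an endomorphism of covectors.\<close>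

definition ric0 :: "(real^4 \<Rightarrow> real^4^4) \<Rightarrow> real^4 \<Rightarrow> real^4^4" where
  "ric0 G u = (ricci G u - (scal G u / 4) *\<^sub>R G u) ** matrix_inv (G u)"

text \<open>The linear extension of
  \<open>a \<and> b \<mapsto> (ric\<^sub>0(a) \<and> b + a \<and> ric\<^sub>0(b))/2\<close>, where \<open>a \<and> b\<close> has matrix \<open>(a\<^sub>i b\<^sub>j - a\<^sub>j b\<^sub>i)\<^sub>i\<^sub>j\<close>.\<close>

definition Ric0 :: "(real^4 \<Rightarrow> real^4^4) \<Rightarrow> real^4 \<Rightarrow> real^4^4 \<Rightarrow> real^4^4" where
  "Ric0 G u A = (1/2) *\<^sub>R (ric0 G u ** A + A ** transpose (ric0 G u))"

definition weyl_operator :: "(real^4 \<Rightarrow> real^4^4) \<Rightarrow> real^4 \<Rightarrow> real^4^4 \<Rightarrow> real^4^4" where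
  "weyl_operator G u A = curvature_operator G u A - Ric0 G u A - (scal G u / 12) *\<^sub>R A"

definition weyl_plus :: "(real^4 \<Rightarrow> real^4^4) \<Rightarrow> real^4 \<Rightarrow> real^4^4 \<Rightarrow> real^4^4" where
  "weyl_plus G u A = sd_part (G u) (weyl_operator G u A)"

definition Wplus_s12 :: "(real^4 \<Rightarrow> real^4^4) \<Rightarrow> real^4 \<Rightarrow> real^4^4 \<Rightarrow> real^4^4" where
  "Wplus_s12 G u A = weyl_plus G u A + (scal G u / 12) *\<^sub>R A"


section \<open>The twistor space over the domain of a chart\<close>

text \<open>A point \<open>(u, A)\<close> of the bundle of 2-forms over the chart domain, or a tangent vector to it.\<close>

type_synonym tw = "(real^4) \<times> (real^4^4)"


definition local_twistor :: "(real^4) set \<Rightarrow> (real^4 \<Rightarrow> real^4^4) \<Rightarrow> tw set" where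
  "local_twistor U G = {(u, A). u \<in> U \<and> A \<in> Lambda_plus (G u) \<and> form_norm (G u) A = 1}"

text \<open>The Levi-Civita connection on 2-forms is \<open>\<nabla>\<^sub>x \<alpha> = d\<alpha>(x) - christoffel_action G u x \<alpha>\<close>.\<close>

definition christoffel_action ::
  "(real^4 \<Rightarrow> real^4^4) \<Rightarrow> real^4 \<Rightarrow> real^4 \<Rightarrow> real^4^4 \<Rightarrow> real^4^4" where
  "christoffel_action G u x A = (\<chi> i j. \<Sum>l\<in>UNIV. \<Sum>k\<in>UNIV.
     x$l * (christoffel G u k l i * A$k$j + christoffel G u k l j * A$i$k))"

text \<open>A tangent vector \<open>(x, b)\<close> is horizontal iff its vertical part vanishes, so the horizontal
  lift of \<open>x\<close> at \<open>(u, A)\<close> is \<open>(x, christoffel_action G u x A)\<close>.\<close>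

definition vertical_part ::
  "(real^4 \<Rightarrow> real^4^4) \<Rightarrow> tw \<Rightarrow> tw \<Rightarrow> real^4^4" where
  "vertical_part G z \<xi> = snd \<xi> - christoffel_action G (fst z) (fst \<xi>) (snd z)"

definition horizontal_lift ::
  "(real^4 \<Rightarrow> real^4^4) \<Rightarrow> tw \<Rightarrow> real^4 \<Rightarrow> tw" where
  "horizontal_lift G z x = (x, christoffel_action G (fst z) x (snd z))"

text \<open>The fibre of \<open>V\<close>: the tangent space of the unit sphere of \<open>\<Lambda>\<^sup>+\<close>.\<close>

definition vertical_space ::
  "(real^4 \<Rightarrow> real^4^4) \<Rightarrow> tw \<Rightarrow> (real^4^4) set" where
  "vertical_space G z = {B \<in> Lambda_plus (G (fst z)). form_inner (G (fst z)) B (snd z) = 0}"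

text \<open>The endomorphism \<open>J\<close> with \<open>g(J v, w) = \<surd>2 A(v, w)\<close>.  For \<open>A\<close> of unit length in
  \<open>\<Lambda>\<^sup>+\<close> it is a compatible almost complex structure; e.g. \<open>(e\<^sub>1 \<and> e\<^sub>2 + e\<^sub>3 \<and> e\<^sub>4)/\<surd>2\<close> gives
  \<open>J e\<^sub>1 = e\<^sub>2\<close>, \<open>J e\<^sub>3 = e\<^sub>4\<close>.\<close>

definition endo_of_form :: "real^4^4 \<Rightarrow> real^4^4 \<Rightarrow> real^4^4" where
  "endo_of_form M A = (- sqrt 2) *\<^sub>R (matrix_inv M ** A)"

definition form_of_endo :: "real^4^4 \<Rightarrow> real^4^4 \<Rightarrow> real^4^4" where
  "form_of_endo M K = (- (1 / sqrt 2)) *\<^sub>R (M ** K)"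

text \<open>The rotation of the tangent plane of the sphere at \<open>A\<close> that corresponds to \<open>K \<mapsto> J \<circ> K\<close> on
  endomorphisms anticommuting with \<open>J\<close>.  This is the orientation of the fibres for which, together
  with \<open>J\<close> on horizontal vectors, one gets the Atiyah--Hitchin--Singer structure: on flat space it
  makes the \<open>(0,1)\<close> distribution involutive.  (Using \<open>-J\<close> in place of \<open>J\<close> throughout would only
  apply the antipodal map of the fibres.)\<close>

definition fibre_rotation :: "real^4^4 \<Rightarrow> real^4^4 \<Rightarrow> real^4^4 \<Rightarrow> real^4^4" where
  "fibre_rotation M A B = form_of_endo M (endo_of_form M A ** endo_of_form M B)"

text \<open>\<open>J\<^sub>+\<close> for \<open>\<epsilon> = 1\<close> and \<open>J\<^sub>-\<close> for \<open>\<epsilon> = -1\<close>.\<close>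

definition twistor_J ::
  "real \<Rightarrow> (real^4 \<Rightarrow> real^4^4) \<Rightarrow> tw \<Rightarrow> tw \<Rightarrow> tw" where
  "twistor_J \<epsilon> G z \<xi> =
     horizontal_lift G z (endo_of_form (G (fst z)) (snd z) *v fst \<xi>)
     + (0, \<epsilon> *\<^sub>R fibre_rotation (G (fst z)) (snd z) (vertical_part G z \<xi>))"

text \<open>Vector fields on the twistor space and sections of \<open>V\<close> are given by smooth maps on an open
  set of the ambient vector space; only their values on the twistor space matter.  The connection on
  \<open>V\<close> pulls back the Levi-Civita connection of \<open>\<Lambda>\<^sup>+\<close> to the twistor space and projects orthogonally
  to \<open>V \<subseteq> \<pi>\<^sup>*\<Lambda>\<^sup>+\<close>.  Along the fibres this is the Levi-Civita connection of the round sphere; in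
  horizontal directions the projection has no effect and the parallel transport is that of
  \<open>\<Lambda>\<^sup>+\<close>.\<close>

definition V_connection ::
  "(real^4 \<Rightarrow> real^4^4) \<Rightarrow> (tw \<Rightarrow> tw) \<Rightarrow>
   (tw \<Rightarrow> real^4^4) \<Rightarrow> tw \<Rightarrow> real^4^4" where
  "V_connection G X s z =
     (let B = frechet_derivative s (at z) (X z) - christoffel_action G (fst z) (fst (X z)) (s z)
      in B - form_inner (G (fst z)) B (snd z) *\<^sub>R snd z)"

definition V_curvature ::
  "(real^4 \<Rightarrow> real^4^4) \<Rightarrow> (tw \<Rightarrow> tw) \<Rightarrow>
   (tw \<Rightarrow> tw) \<Rightarrow> (tw \<Rightarrow> real^4^4) \<Rightarrow>
   tw \<Rightarrow> real^4^4" where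
  "V_curvature G X Y s z =
     V_connection G X (V_connection G Y s) z - V_connection G Y (V_connection G X s) z
     - V_connection G (lie_bracket X Y) s z"

definition local_vector_field ::
  "(real^4) set \<Rightarrow> (real^4 \<Rightarrow> real^4^4) \<Rightarrow> tw set \<Rightarrow>
   (tw \<Rightarrow> tw) \<Rightarrow> bool" where
  "local_vector_field U G N X \<longleftrightarrow> smooth_map_on N X \<and>
     (\<forall>w \<in> N \<inter> local_twistor U G. X w \<in> velocities (local_twistor U G) w)"

definition local_V_section ::
  "(real^4) set \<Rightarrow> (real^4 \<Rightarrow> real^4^4) \<Rightarrow> tw set \<Rightarrow>
   (tw \<Rightarrow> real^4^4) \<Rightarrow> bool" where
  "local_V_section U G N s \<longleftrightarrow> smooth_map_on N s \<and>
     (\<forall>w \<in> N \<inter> local_twistor U G. s w \<in> vertical_space G w)"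

text \<open>The 2-form \<open>\<omega>\<close> representing the curvature \<open>F\<close> of \<open>V\<close>, where \<open>i\<close> acts on \<open>V\<close> by the vertical
  part of \<open>twistor_J \<epsilon>\<close>.  With the convention \<open>F(X,Y) = [\<nabla>\<^sub>X, \<nabla>\<^sub>Y] - \<nabla>\<^sub>[\<^sub>X\<^sub>,\<^sub>Y\<^sub>]\<close> of
  \<^const>\<open>V_curvature\<close> an oriented unit sphere has \<open>F = -i \<cdot> area\<close>; hence the requirement that
  \<open>2\<pi>\<omega>\<close> be the positive area form on the fibres makes the defining equation
  \<open>F(X,Y) = -2\<pi>i \<omega>(X,Y)\<close>, i.e. \<open>2\<pi>i \<omega>\<close> is the curvature in the opposite sign convention.\<close>

definition local_induced_form ::
  "real \<Rightarrow> (real^4) set \<Rightarrow> (real^4 \<Rightarrow> real^4^4) \<Rightarrow> tw \<Rightarrow>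
   tw \<Rightarrow> tw \<Rightarrow> real" where
  "local_induced_form \<epsilon> U G z \<xi> \<eta> =
     (THE c. \<forall>N X Y s. open N \<and> z \<in> N \<and> N \<subseteq> U \<times> UNIV \<and>
          local_vector_field U G N X \<and> local_vector_field U G N Y \<and> local_V_section U G N s \<and>
          X z = \<xi> \<and> Y z = \<eta> \<longrightarrow>
        V_curvature G X Y s z =
          (- 2 * pi * c) *\<^sub>R (\<epsilon> *\<^sub>R fibre_rotation (G (fst z)) (snd z) (s z)))"


section \<open>Oriented Riemannian four-manifolds and their twistor spaces\<close>

type_synonym 'a chart = "'a set \<times> ('a \<Rightarrow> real^4)"

definition transition :: "'a chart \<Rightarrow> 'a chart \<Rightarrow> real^4 \<Rightarrow> real^4" where
  "transition c c' = snd c' \<circ> inv_into (fst c) (snd c)"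

definition jac :: "'a chart \<Rightarrow> 'a chart \<Rightarrow> 'a \<Rightarrow> real^4^4" where
  "jac c c' x = matrix (frechet_derivative (transition c c') (at (snd c x)))"

text \<open>Components of a covariant 2-tensor at \<open>x\<close>: \<open>T\<close> in the chart \<open>c\<close> and \<open>T'\<close> in the chart
  \<open>c'\<close>.\<close>

definition same_2tensor :: "'a \<Rightarrow> 'a chart \<Rightarrow> real^4^4 \<Rightarrow> 'a chart \<Rightarrow> real^4^4 \<Rightarrow> bool" where
  "same_2tensor x c T c' T' \<longleftrightarrow> T = transpose (jac c c' x) ** T' ** jac c c' x"

locale oriented_riemannian_4manifold =
  fixes atlas :: "('a::{t2_space, second_countable_topology}) chart set"
    and g :: "'a chart \<Rightarrow> real^4 \<Rightarrow> real^4^4"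
  assumes chart_open: "c \<in> atlas \<Longrightarrow> open (fst c) \<and> open (snd c ` fst c)"
    and chart_homeomorphism:
      "c \<in> atlas \<Longrightarrow> homeomorphism (fst c) (snd c ` fst c) (snd c) (inv_into (fst c) (snd c))"
    and charts_cover: "(\<Union>c\<in>atlas. fst c) = UNIV"
    and transition_smooth:
      "c \<in> atlas \<Longrightarrow> c' \<in> atlas \<Longrightarrow>
         smooth_map_on (snd c ` (fst c \<inter> fst c')) (transition c c')"
    and oriented:
      "c \<in> atlas \<Longrightarrow> c' \<in> atlas \<Longrightarrow> x \<in> fst c \<inter> fst c' \<Longrightarrow> det (jac c c' x) > 0"
    and metric_smooth: "c \<in> atlas \<Longrightarrow> smooth_map_on (snd c ` fst c) (g c)"
    and metric_inner_product:
      "c \<in> atlas \<Longrightarrow> x \<in> fst c \<Longrightarrow> inner_product_matrix (g c (snd c x))"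
    and metric_compatible:
      "c \<in> atlas \<Longrightarrow> c' \<in> atlas \<Longrightarrow> x \<in> fst c \<inter> fst c' \<Longrightarrow>
         same_2tensor x c (g c (snd c x)) c' (g c' (snd c' x))"

definition charts_at :: "'a chart set \<Rightarrow> 'a \<Rightarrow> 'a chart set" where
  "charts_at atlas x = {c \<in> atlas. x \<in> fst c}"

text \<open>A point of the twistor space is a pair \<open>(x, \<alpha>)\<close>, where the 2-form \<open>\<alpha>\<close> at \<open>x\<close> is the family of
  its components in the charts around \<open>x\<close> (and zero for all other charts).\<close>

definition twistor_space ::
  "'a chart set \<Rightarrow> ('a chart \<Rightarrow> real^4 \<Rightarrow> real^4^4) \<Rightarrow> ('a \<times> ('a chart \<Rightarrow> real^4^4)) set" where
  "twistor_space atlas g = {(x, \<alpha>).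
     (\<forall>c. c \<notin> charts_at atlas x \<longrightarrow> \<alpha> c = 0) \<and>
     (\<forall>c \<in> charts_at atlas x. \<forall>c' \<in> charts_at atlas x. same_2tensor x c (\<alpha> c) c' (\<alpha> c')) \<and>
     (\<forall>c \<in> charts_at atlas x.
        \<alpha> c \<in> Lambda_plus (g c (snd c x)) \<and> form_norm (g c (snd c x)) (\<alpha> c) = 1)}"

definition twistor_coords ::
  "'a chart \<Rightarrow> 'a \<times> ('a chart \<Rightarrow> real^4^4) \<Rightarrow> tw" where
  "twistor_coords c z = (snd c (fst z), snd z c)"

text \<open>Tangent vectors of the twistor space are velocities of curves, again recorded by their
  components in the charts around the base point.\<close>

definition twistor_tangent_space ::
  "('a::topological_space) chart set \<Rightarrow> ('a chart \<Rightarrow> real^4 \<Rightarrow> real^4^4) \<Rightarrow>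
   'a \<times> ('a chart \<Rightarrow> real^4^4) \<Rightarrow> ('a chart \<Rightarrow> tw) set" where
  "twistor_tangent_space atlas g z = {\<xi>. \<exists>\<gamma>::real \<Rightarrow> 'a \<times> ('a chart \<Rightarrow> real^4^4).
     \<gamma> 0 = z \<and> (\<forall>\<^sub>F t in nhds 0. \<gamma> t \<in> twistor_space atlas g) \<and> isCont (\<lambda>t. fst (\<gamma> t)) 0 \<and>
     (\<forall>c. if c \<in> charts_at atlas (fst z)
          then ((\<lambda>t. twistor_coords c (\<gamma> t)) has_vector_derivative \<xi> c) (at 0)
          else \<xi> c = 0)}"

text \<open>A 2-form \<open>\<Omega>\<close> and an almost complex structure \<open>J\<close> on the twistor space are given by their
  coordinate expressions \<open>\<Omega> c\<close>, \<open>J c\<close> in the charts \<open>twistor_coords c\<close>.\<close>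

definition tames ::
  "('a::topological_space) chart set \<Rightarrow> ('a chart \<Rightarrow> real^4 \<Rightarrow> real^4^4) \<Rightarrow>
   ('a chart \<Rightarrow> tw \<Rightarrow> tw \<Rightarrow> tw \<Rightarrow> real) \<Rightarrow>
   ('a chart \<Rightarrow> tw \<Rightarrow> tw \<Rightarrow> tw) \<Rightarrow> bool" where
  "tames atlas g \<Omega> J \<longleftrightarrow>
     (\<forall>z \<in> twistor_space atlas g. \<forall>\<xi> \<in> twistor_tangent_space atlas g z.
        \<xi> \<noteq> (\<lambda>_. 0) \<longrightarrow>
        (\<forall>c \<in> charts_at atlas (fst z).
           \<Omega> c (twistor_coords c z) (\<xi> c) (J c (twistor_coords c z) (\<xi> c)) > 0))"

definition J_plus ::
  "('a chart \<Rightarrow> real^4 \<Rightarrow> real^4^4) \<Rightarrow> 'a chart \<Rightarrow> tw \<Rightarrow> tw \<Rightarrow>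
   tw" where
  "J_plus g c = twistor_J 1 (g c)"

definition J_minus ::
  "('a chart \<Rightarrow> real^4 \<Rightarrow> real^4^4) \<Rightarrow> 'a chart \<Rightarrow> tw \<Rightarrow> tw \<Rightarrow>
   tw" where
  "J_minus g c = twistor_J (- 1) (g c)"

text \<open>The induced 2-form for the orientation of the fibres given by \<open>J\<^sub>+\<close>, respectively \<open>J\<^sub>-\<close>.\<close>

definition omega_plus ::
  "('a chart \<Rightarrow> real^4 \<Rightarrow> real^4^4) \<Rightarrow> 'a chart \<Rightarrow> tw \<Rightarrow> tw \<Rightarrow>
   tw \<Rightarrow> real" where
  "omega_plus g c = local_induced_form 1 (snd c ` fst c) (g c)"

definition omega_minus ::
  "('a chart \<Rightarrow> real^4 \<Rightarrow> real^4^4) \<Rightarrow> 'a chart \<Rightarrow> tw \<Rightarrow> tw \<Rightarrow>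
   tw \<Rightarrow> real" where
  "omega_minus g c = local_induced_form (- 1) (snd c ` fst c) (g c)"

definition curvature_inequality ::
  "'a chart set \<Rightarrow> ('a chart \<Rightarrow> real^4 \<Rightarrow> real^4^4) \<Rightarrow> bool" where
  "curvature_inequality atlas g \<longleftrightarrow>
     (\<forall>x. \<forall>c \<in> charts_at atlas x. let u = snd c x; M = g c u in
        \<forall>v \<in> Lambda_plus M. form_norm M v = 1 \<longrightarrow>
          \<bar>form_inner M (Wplus_s12 (g c) u v) v\<bar> > form_norm M (Ric0 (g c) u v))"

definition det_Wplus_s12 ::
  "('a chart \<Rightarrow> real^4 \<Rightarrow> real^4^4) \<Rightarrow> 'a chart \<Rightarrow> 'a \<Rightarrow> real" where
  "det_Wplus_s12 g c x = det_plus (g c (snd c x)) (Wplus_s12 (g c) (snd c x))"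

end

theory Submission
  imports Defs
begin

text \<open>
  Let \<open>(u, A)\<close> be a point of the twistor space, \<open>J\<close> the almost complex structure of \<open>A\<close>, and let the tangent
  vectors \<open>\<xi>\<close>, \<open>\<eta>\<close> have horizontal parts \<open>x\<close>, \<open>y\<close> and vertical parts \<open>v\<close>, \<open>w\<close>.  The connection on \<open>V\<close> is the
  Levi-Civita connection of \<open>\<Lambda>\<^sup>+\<close> followed by the projection orthogonal to the tautological section \<open>A\<close>, whose
  covariant derivative along \<open>\<xi>\<close> is \<open>v\<close>.  So the Gauss equation gives its curvature on a section \<open>s\<close>: the
  tangential part of the action of the Riemann curvature \<open>R(x, y)\<close>, plus \<open>\<langle>s, w\<rangle>v - \<langle>s, v\<rangle>w\<close>.  On the
  oriented plane \<open>V\<close> each term is a multiple of the rotation (\<open>isometry_action_vertical\<close>,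
  \<open>vertical_plane_area\<close>), the first one by the component of \<open>R(x, y)\<close> along \<open>A\<close>, and up to a positive factor
  \<open>\<omega>(\<xi>, \<eta>)\<close> is
  \<open>\<epsilon> (\<surd>2 Rm(A)(x, y) + area(v, w))\<close>,
  where \<open>\<epsilon> = \<plusminus>1\<close> is the orientation of the fibre (\<open>V_curvature_eq\<close>, \<open>local_induced_form_eq\<close>).

  Put \<open>\<eta> = J\<^sub>\<epsilon> \<xi>\<close>, so that \<open>y = J x\<close> and \<open>w\<close> is \<open>\<epsilon>\<close> times the rotation of \<open>v\<close>.  The area term becomes
  \<open>|v|\<^sup>2\<close>.  Up to scale the bivector \<open>x \<and> J x\<close> is \<open>A\<close> plus an anti-self-dual form of the same length, and the
  block decomposition of \<open>Rm\<close> turns the first term into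
  \<open>\<epsilon> |x|\<^sup>2 (\<langle>(W\<^sup>+ + s/12)A, A\<rangle> + \<langle>Ric\<^sub>0 A, B\<rangle>)\<close> with \<open>B\<close> anti-self-dual of unit length
  (\<open>horizontal_contribution\<close>).  By the curvature inequality its sign is that of
  \<open>\<epsilon> \<langle>(W\<^sup>+ + s/12)A, A\<rangle>\<close>.  The inequality also keeps this quadratic form from vanishing on the unit sphere of
  \<open>\<Lambda>\<^sup>+\<close>, which is connected; hence it is definite, with the sign of its determinant
  (\<open>form_determinant_sign\<close>), and \<open>\<epsilon>\<close> is chosen to be that sign.

  Pointwise identities are reduced to the standard inner product and the standard Kaehler form by pulling back
  along a frame (\<open>adapted_frame_exists\<close>).  The same naturality under linear maps, used to first order, shows
  that the Hodge star is parallel (\<open>hodge_parallel\<close>), which is what makes the tangent spaces of the twistor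
  space split.
\<close>

section \<open>Determinants of size four\<close>

lemma det_4:
  "det (A::'a::comm_ring_1^4^4) =
    A$1$1 * (A$2$2 * (A$3$3 * A$4$4 - A$3$4 * A$4$3) - A$2$3 * (A$3$2 * A$4$4 - A$3$4 * A$4$2)
       + A$2$4 * (A$3$2 * A$4$3 - A$3$3 * A$4$2))
    - A$1$2 * (A$2$1 * (A$3$3 * A$4$4 - A$3$4 * A$4$3) - A$2$3 * (A$3$1 * A$4$4 - A$3$4 * A$4$1)
       + A$2$4 * (A$3$1 * A$4$3 - A$3$3 * A$4$1))
    + A$1$3 * (A$2$1 * (A$3$2 * A$4$4 - A$3$4 * A$4$2) - A$2$2 * (A$3$1 * A$4$4 - A$3$4 * A$4$1)
       + A$2$4 * (A$3$1 * A$4$2 - A$3$2 * A$4$1))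
    - A$1$4 * (A$2$1 * (A$3$2 * A$4$3 - A$3$3 * A$4$2) - A$2$2 * (A$3$1 * A$4$3 - A$3$3 * A$4$1)
       + A$2$3 * (A$3$1 * A$4$2 - A$3$2 * A$4$1))"
proof -
  have f1: "finite {2::4, 3, 4}" "1 \<notin> {2::4, 3, 4}" by auto
  have f2: "finite {3::4, 4}" "2 \<notin> {3::4, 4}" by auto
  have f3: "finite {4::4}" "3 \<notin> {4::4}" by auto
  show ?thesis
    unfolding det_def UNIV_4
    unfolding sum_over_permutations_insert[OF f1]
    unfolding sum_over_permutations_insert[OF f2]
    unfolding sum_over_permutations_insert[OF f3]
    unfolding permutes_sing
    by (simp add: sign_swap_id permutation_swap_id permutation_compose sign_compose sign_id
        swap_id_eq algebra_simps)
qed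

lemma vector_4 [simp]:
  "(vector [x, y, z, w] :: 'a::zero^4) $ 1 = x"
  "(vector [x, y, z, w] :: 'a::zero^4) $ 2 = y"
  "(vector [x, y, z, w] :: 'a::zero^4) $ 3 = z"
  "(vector [x, y, z, w] :: 'a::zero^4) $ 4 = w"
  unfolding vector_def by simp_all

lemma det_row_expand_4:
  fixes x y z w :: "real^4"
  shows "det (vector [x, y, z, w] :: real^4^4) = (\<Sum>i\<in>UNIV. x$i * det (vector [axis i 1, y, z, w] :: real^4^4))"
    and "det (vector [x, y, z, w] :: real^4^4) = (\<Sum>i\<in>UNIV. y$i * det (vector [x, axis i 1, z, w] :: real^4^4))"
    and "det (vector [x, y, z, w] :: real^4^4) = (\<Sum>i\<in>UNIV. z$i * det (vector [x, y, axis i 1, w] :: real^4^4))"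
    and "det (vector [x, y, z, w] :: real^4^4) = (\<Sum>i\<in>UNIV. w$i * det (vector [x, y, z, axis i 1] :: real^4^4))"
  by (simp_all add: sum_4 det_4 axis_def algebra_simps)

text \<open>Writing the determinant through the Levi-Civita symbol reduces the behaviour of the Hodge star under linear
  maps to multiplicativity of the determinant.\<close>

lemma det_vector_4:
  fixes x y z w :: "real^4"
  shows "det (vector [x, y, z, w] :: real^4^4) = (\<Sum>i\<in>UNIV. \<Sum>j\<in>UNIV. \<Sum>k\<in>UNIV. \<Sum>l\<in>UNIV.
            x$i * y$j * z$k * w$l * levi_civita_symbol i j k l)"
  unfolding levi_civita_symbol_def
  apply (subst det_row_expand_4(1))
  apply (subst det_row_expand_4(2))
  apply (subst det_row_expand_4(3))
  apply (subst det_row_expand_4(4))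
  apply (simp add: sum_distrib_left mult.assoc)
  done

section \<open>Matrix algebra\<close>

lemma bounded_bilinear_matrix_mult: "bounded_bilinear ((**) :: real^'n^'m \<Rightarrow> real^'p^'n \<Rightarrow> real^'p^'m)"
proof (rule bilinear_conv_bounded_bilinear[THEN iffD1], unfold bilinear_def, intro conjI allI)
  show "linear (\<lambda>y. x ** y)" for x :: "real^'n^'m" and y
    by (rule linearI) (simp_all add: matrix_matrix_mult_def distrib_left sum.distrib vec_eq_iff sum_distrib_left mult_ac)
  show "linear (\<lambda>x. x ** y)" for y :: "real^'p^'n"
    by (rule linearI) (simp_all add: matrix_matrix_mult_def distrib_left sum.distrib vec_eq_iff sum_distrib_left mult_ac)
qed

interpretation mmul: bounded_bilinear "(**) :: real^'n^'m \<Rightarrow> real^'p^'n \<Rightarrow> real^'p^'m"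
  by (rule bounded_bilinear_matrix_mult)

lemma transpose_add: "transpose (A + B) = transpose A + transpose (B :: real^'n^'m)"
  by (simp add: transpose_def vec_eq_iff)

lemma transpose_diff: "transpose (A - B) = transpose A - transpose (B :: real^'n^'m)"
  by (simp add: transpose_def vec_eq_iff)

lemma bounded_linear_transpose: "bounded_linear (transpose :: real^'n^'m \<Rightarrow> real^'m^'n)"
  by (rule linear_conv_bounded_linear[THEN iffD1], rule linearI) (simp_all add: transpose_add transpose_scalar)

lemma bounded_linear_trace: "bounded_linear (trace :: real^'n^'n \<Rightarrow> real)"
  by (rule linear_conv_bounded_linear[THEN iffD1], rule linearI)
    (simp_all add: trace_def sum.distrib sum_distrib_left)

lemma trace_transpose: "trace (transpose A) = trace (A :: real^'n^'n)"
  by (simp add: trace_def transpose_def)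

lemma matrix_inv_eqI:
  fixes A B :: "real^'n^'n"
  assumes "A ** B = mat 1"
  shows "matrix_inv A = B"
  unfolding matrix_inv_def
proof (rule some_equality)
  show "A ** B = mat 1 \<and> B ** A = mat 1"
    using assms matrix_left_right_inverse by blast
  show "C = B" if "A ** C = mat 1 \<and> C ** A = mat 1" for C
    by (metis that assms matrix_mul_assoc matrix_mul_lid matrix_mul_rid)
qed

lemma matrix_inv_right: "invertible (A::real^'n^'n) \<Longrightarrow> A ** matrix_inv A = mat 1"
  by (metis invertible_def matrix_inv_eqI)

lemma matrix_inv_left: "invertible (A::real^'n^'n) \<Longrightarrow> matrix_inv A ** A = mat 1"
  by (metis invertible_def matrix_inv_eqI)

section \<open>Pull-back of two-tensors\<close>

text \<open>A linear change of frame with matrix \<open>P\<close> acts in this way on the components of metrics and of two-forms.\<close>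

definition pull :: "real^4^4 \<Rightarrow> real^4^4 \<Rightarrow> real^4^4" where
  "pull P A = transpose P ** A ** P"

lemma pull_simps:
  "pull P (A + B) = pull P A + pull P B" "pull P (A - B) = pull P A - pull P B"
  "pull P (- A) = - pull P A" "pull P (c *\<^sub>R A) = c *\<^sub>R pull P A" "pull P 0 = 0"
  by (simp_all add: pull_def mmul.add_left mmul.add_right mmul.diff_left mmul.diff_right
      mmul.minus_left mmul.minus_right mmul.scaleR_left mmul.scaleR_right)

lemma transpose_pull: "transpose (pull P A) = pull P (transpose A)"
  by (simp add: pull_def matrix_transpose_mul transpose_transpose matrix_mul_assoc)

lemma pull_pull: "pull P (pull Q A) = pull (Q ** P) A"
  by (simp add: pull_def matrix_transpose_mul matrix_mul_assoc)

lemma pull_id [simp]: "pull (mat 1) A = A"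
  by (simp add: pull_def)

lemma pull_nth: "pull P A $ a $ b = (\<Sum>i\<in>UNIV. \<Sum>j\<in>UNIV. P$i$a * P$j$b * A$i$j)"
  unfolding pull_def matrix_matrix_mult_def transpose_def
  by (simp add: sum_distrib_left sum_distrib_right) (subst sum.swap, simp add: mult_ac)

lemma inj_pull:
  assumes "invertible P" "pull P A = pull P B" shows "A = B"
  by (metis assms matrix_inv_right pull_id pull_pull)

lemma matrix_inv_pull:
  assumes "invertible P" "invertible M"
  shows "matrix_inv (pull P M) = matrix_inv P ** matrix_inv M ** transpose (matrix_inv P)"
proof (rule matrix_inv_eqI)
  let ?Q = "matrix_inv P"
  have PQ: "P ** ?Q = mat 1" "transpose P ** transpose ?Q = mat 1"
    using assms matrix_inv_right matrix_inv_left by (metis, metis matrix_transpose_mul transpose_mat)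
  have "pull P M ** (?Q ** matrix_inv M ** transpose ?Q)
      = transpose P ** (M ** ((P ** ?Q) ** matrix_inv M)) ** transpose ?Q"
    by (simp only: pull_def matrix_mul_assoc)
  also have "\<dots> = mat 1" using assms by (simp add: PQ matrix_inv_right)
  finally show "pull P M ** (?Q ** matrix_inv M ** transpose ?Q) = mat 1" .
qed

text \<open>Raising both indices turns forms into bivectors, which are pushed forward rather than pulled back.\<close>

lemma raise_pull:
  assumes "invertible P" "invertible M"
  shows "raise M A = P ** raise (pull P M) (pull P A) ** transpose P"
proof -
  let ?Q = "matrix_inv P"
  have PQ: "P ** ?Q = mat 1" "transpose ?Q ** transpose P = mat 1"
    using assms matrix_inv_right by (metis, metis matrix_transpose_mul transpose_mat matrix_inv_right)
  have "P ** raise (pull P M) (pull P A) ** transpose P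
      = (P ** ?Q) ** matrix_inv M ** (transpose ?Q ** transpose P) ** A ** (P ** ?Q) ** matrix_inv M
          ** (transpose ?Q ** transpose P)"
    unfolding raise_def matrix_inv_pull[OF assms] pull_def[of P A] by (simp only: matrix_mul_assoc)
  then show ?thesis by (simp add: PQ raise_def)
qed

lemma form_inner_trace: "form_inner M A B = (1/2) * trace (transpose A ** raise M B)"
  unfolding form_inner_def trace_def matrix_matrix_mult_def transpose_def
  by (simp add: sum_distrib_left) (rule sum.swap)

lemma form_inner_pull:
  assumes "invertible P" "invertible M"
  shows "form_inner (pull P M) (pull P A) (pull P B) = form_inner M A B"
proof -
  let ?R = "raise (pull P M) (pull P B)"
  have "trace (transpose A ** raise M B) = trace ((transpose A ** P ** ?R) ** transpose P)"
    by (simp add: raise_pull[OF assms] matrix_mul_assoc)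
  also have "\<dots> = trace (transpose P ** (transpose A ** P ** ?R))"
    by (rule trace_mul_sym)
  finally show ?thesis
    by (simp add: form_inner_trace transpose_pull) (simp add: pull_def matrix_mul_assoc)
qed

lemma bounded_linear_raise: "bounded_linear (raise M)"
  by (rule linear_conv_bounded_linear[THEN iffD1], rule linearI)
    (simp_all add: raise_def mmul.add_left mmul.add_right mmul.scaleR_left mmul.scaleR_right)

lemma bounded_bilinear_form_inner: "bounded_bilinear (form_inner M)"
proof (rule bilinear_conv_bounded_bilinear[THEN iffD1], unfold bilinear_def, intro conjI allI)
  interpret r: bounded_linear "raise M" by (rule bounded_linear_raise)
  show "linear (form_inner M A)" for A
    by (rule linearI) (simp_all add: form_inner_def r.add r.scaleR algebra_simps sum.distrib sum_distrib_left)
  show "linear (\<lambda>A. form_inner M A B)" for B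
    by (rule linearI) (simp_all add: form_inner_def algebra_simps sum.distrib sum_distrib_left)
qed

interpretation finner: bounded_bilinear "form_inner M" for M
  by (rule bounded_bilinear_form_inner)

lemma form_inner_commute:
  assumes "transpose M = M" "invertible M" shows "form_inner M A B = form_inner M B A"
proof -
  let ?I = "matrix_inv M"
  have t: "transpose ?I = ?I"
    using assms by (metis matrix_inv_eqI matrix_inv_left matrix_transpose_mul transpose_mat)
  have "trace (transpose A ** (?I ** B ** ?I)) = trace (transpose (transpose A ** (?I ** B ** ?I)))"
    by (simp add: trace_transpose)
  also have "\<dots> = trace ((?I ** transpose B ** ?I) ** A)"
    by (simp add: matrix_transpose_mul t matrix_mul_assoc)
  also have "\<dots> = trace ((?I ** A) ** (?I ** transpose B))"
    using trace_mul_sym[of "?I ** transpose B" "?I ** A"] by (simp add: matrix_mul_assoc)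
  also have "\<dots> = trace (transpose B ** (?I ** A ** ?I))"
    using trace_mul_sym[of "?I ** A ** ?I" "transpose B"] by (simp add: matrix_mul_assoc)
  finally show ?thesis by (simp add: form_inner_trace raise_def)
qed

definition star :: "real^4^4 \<Rightarrow> real^4^4" where
  "star X = (\<chi> i j. (1/2) * (\<Sum>k\<in>UNIV. \<Sum>l\<in>UNIV. levi_civita_symbol i j k l * X $k$l))"

lemma bounded_linear_star: "bounded_linear star"
  by (rule linear_conv_bounded_linear[THEN iffD1], rule linearI)
    (simp_all add: star_def vec_eq_iff algebra_simps sum.distrib sum_distrib_left)

lemma hodge_star: "hodge M A = sqrt (det M) *\<^sub>R star (raise M A)"
  by (simp add: hodge_def star_def vec_eq_iff)

lemma levi_civita_symbol_pull:
  "(\<Sum>a\<in>UNIV. \<Sum>b\<in>UNIV. \<Sum>c\<in>UNIV. \<Sum>d\<in>UNIV.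
      P$a$i * P$b$j * P$c$k * P$d$l * levi_civita_symbol a b c d) = det P * levi_civita_symbol i j k l"
proof -
  have "(vector [column i P, column j P, column k P, column l P] :: real^4^4)
      = vector [axis i 1, axis j 1, axis k 1, axis l 1] ** transpose P"
    unfolding vec_eq_iff forall_4
    by (simp add: matrix_matrix_mult_def axis_def transpose_def column_def if_distrib if_distribR cong: if_cong)
  then have "det (vector [column i P, column j P, column k P, column l P] :: real^4^4)
      = det P * levi_civita_symbol i j k l"
    by (simp add: det_mul levi_civita_symbol_def)
  then show ?thesis
    by (simp add: det_vector_4 column_def)
qed

lemma sum_swap_pairs:
  "(\<Sum>a\<in>A. \<Sum>b\<in>B. \<Sum>c\<in>C. \<Sum>d\<in>D. f a b c d) = (\<Sum>c\<in>C. \<Sum>d\<in>D. \<Sum>a\<in>A. \<Sum>b\<in>B. f a b c d)"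
proof -
  have "(\<Sum>a\<in>A. \<Sum>b\<in>B. \<Sum>c\<in>C. \<Sum>d\<in>D. f a b c d) = (\<Sum>a\<in>A. \<Sum>c\<in>C. \<Sum>d\<in>D. \<Sum>b\<in>B. f a b c d)"
    by (subst sum.swap[of _ C B], subst sum.swap[of _ D B], rule refl)
  also have "\<dots> = (\<Sum>c\<in>C. \<Sum>a\<in>A. \<Sum>d\<in>D. \<Sum>b\<in>B. f a b c d)"
    by (rule sum.swap)
  also have "\<dots> = (\<Sum>c\<in>C. \<Sum>d\<in>D. \<Sum>a\<in>A. \<Sum>b\<in>B. f a b c d)"
    by (rule sum.cong[OF refl]) (rule sum.swap)
  finally show ?thesis .
qed

lemma pull_star: "pull P (star (P ** Y ** transpose P)) = det P *\<^sub>R star Y"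
proof -
  have e: "(P ** Y ** transpose P) $ c $ d = (\<Sum>k\<in>UNIV. \<Sum>l\<in>UNIV. P$c$k * P$d$l * Y$k$l)" for c d
    unfolding matrix_matrix_mult_def transpose_def
    by (simp add: sum_distrib_left sum_distrib_right) (subst sum.swap, simp add: mult_ac)
  have "pull P (star (P ** Y ** transpose P)) $ i $ j = (det P *\<^sub>R star Y) $ i $ j" for i j
  proof -
    have "pull P (star (P ** Y ** transpose P)) $ i $ j
        = (1/2) * (\<Sum>a\<in>UNIV. \<Sum>b\<in>UNIV. \<Sum>c\<in>UNIV. \<Sum>d\<in>UNIV. \<Sum>k\<in>UNIV. \<Sum>l\<in>UNIV.
             P$a$i * P$b$j * P$c$k * P$d$l * levi_civita_symbol a b c d * Y$k$l)"
      by (simp add: pull_nth star_def e sum_distrib_left mult_ac)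
    also have "\<dots> = (1/2) * (\<Sum>a\<in>UNIV. \<Sum>b\<in>UNIV. \<Sum>k\<in>UNIV. \<Sum>l\<in>UNIV. \<Sum>c\<in>UNIV. \<Sum>d\<in>UNIV.
             P$a$i * P$b$j * P$c$k * P$d$l * levi_civita_symbol a b c d * Y$k$l)"
      by (intro arg_cong[where f="(*) (1/2)"] sum.cong refl sum_swap_pairs)
    also have "\<dots> = (1/2) * (\<Sum>k\<in>UNIV. \<Sum>l\<in>UNIV. \<Sum>a\<in>UNIV. \<Sum>b\<in>UNIV. \<Sum>c\<in>UNIV. \<Sum>d\<in>UNIV.
             P$a$i * P$b$j * P$c$k * P$d$l * levi_civita_symbol a b c d * Y$k$l)"
      by (intro arg_cong[where f="(*) (1/2)"] sum_swap_pairs)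
    also have "\<dots> = (1/2) * (\<Sum>k\<in>UNIV. \<Sum>l\<in>UNIV. det P * levi_civita_symbol i j k l * Y$k$l)"
      by (simp only: levi_civita_symbol_pull[symmetric] sum_distrib_right)
    also have "\<dots> = (det P *\<^sub>R star Y) $ i $ j"
      by (simp add: star_def sum_distrib_left mult_ac)
    finally show ?thesis .
  qed
  then show ?thesis by (simp add: vec_eq_iff)
qed

text \<open>The Hodge star is built from the metric and the volume form.  A linear map carries the metric along, but the
  volume form only up to the sign of the determinant.\<close>

lemma hodge_pull:
  assumes "invertible P" "invertible M"
  shows "hodge (pull P M) (pull P A) = sgn (det P) *\<^sub>R pull P (hodge M A)"
proof -
  have "pull P (hodge M A) = (sqrt (det M) * det P) *\<^sub>R star (raise (pull P M) (pull P A))"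
    by (simp add: hodge_star pull_simps raise_pull[OF assms] pull_star)
  moreover have "det (pull P M) = (det P)\<^sup>2 * det M"
    by (simp add: pull_def det_mul power2_eq_square)
  ultimately show ?thesis
    by (simp add: hodge_star real_sqrt_mult) (simp add: sgn_if)
qed

section \<open>Self-dual forms on standard four-space\<close>

lemma raise_id [simp]: "raise (mat 1) A = A"
  by (simp add: raise_def matrix_inv_eqI)

lemma hodge_id [simp]: "hodge (mat 1) A = star A"
  by (simp add: hodge_star)

lemma star_explicit:
  "star X = (1/2) *\<^sub>R vector
    [vector [0, X$3$4 - X$4$3, X$4$2 - X$2$4, X$2$3 - X$3$2],
     vector [X$4$3 - X$3$4, 0, X$1$4 - X$4$1, X$3$1 - X$1$3],
     vector [X$2$4 - X$4$2, X$4$1 - X$1$4, 0, X$1$2 - X$2$1],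
     vector [X$3$2 - X$2$3, X$1$3 - X$3$1, X$2$1 - X$1$2, 0]]"
  unfolding vec_eq_iff forall_4
  by (simp add: star_def sum_4 levi_civita_symbol_def det_4 axis_def)

definition std_sd :: "real^3 \<Rightarrow> real^4^4" where
  "std_sd y = (1 / sqrt 2) *\<^sub>R vector
    [vector [0, y$1, y$2, y$3], vector [- y$1, 0, y$3, - y$2],
     vector [- y$2, - y$3, 0, y$1], vector [- y$3, y$2, - y$1, 0]]"

definition std_asd :: "real^3 \<Rightarrow> real^4^4" where
  "std_asd y = (1 / sqrt 2) *\<^sub>R vector
    [vector [0, y$1, y$2, y$3], vector [- y$1, 0, - y$3, y$2],
     vector [- y$2, y$3, 0, - y$1], vector [- y$3, - y$2, y$1, 0]]"

lemma two_forms_nth: "A \<in> two_forms \<longleftrightarrow> (\<forall>i j. A$j$i = - A$i$j)"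
  by (auto simp: two_forms_def transpose_def vec_eq_iff)

lemma two_forms_4:
  "A \<in> two_forms \<longleftrightarrow> A$1$1 = 0 \<and> A$2$2 = 0 \<and> A$3$3 = 0 \<and> A$4$4 = 0 \<and> A$2$1 = - A$1$2 \<and> A$3$1 = - A$1$3 \<and>
     A$4$1 = - A$1$4 \<and> A$3$2 = - A$2$3 \<and> A$4$2 = - A$2$4 \<and> A$4$3 = - A$3$4"
  unfolding two_forms_nth forall_4 by (rule iffI; elim conjE; intro conjI; linarith)

lemma pull_two_forms: "A \<in> two_forms \<Longrightarrow> pull P A \<in> two_forms"
  by (simp add: two_forms_def transpose_pull pull_simps)

lemma star_two_forms: "star A \<in> two_forms"
  by (simp add: two_forms_4 star_explicit field_simps)

lemma std_sd_two_forms: "std_sd y \<in> two_forms"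
  by (simp add: two_forms_4 std_sd_def)

lemma star_std_sd: "star (std_sd y) = std_sd y"
  unfolding vec_eq_iff forall_4 by (simp add: star_explicit std_sd_def)

lemma star_star: "A \<in> two_forms \<Longrightarrow> star (star A) = A"
  unfolding vec_eq_iff forall_4 by (simp add: star_explicit two_forms_4)

lemma form_inner_id: "form_inner (mat 1) A B = (1/2) * (\<Sum>i\<in>UNIV. \<Sum>j\<in>UNIV. A$i$j * B$i$j)"
  by (simp add: form_inner_def)

text \<open>Self-duality identifies the components \<open>34\<close>, \<open>42\<close>, \<open>23\<close> with \<open>12\<close>, \<open>13\<close>, \<open>14\<close>, which are free.\<close>

lemma Lambda_plus_id: "Lambda_plus (mat 1) = range std_sd"
proof (intro set_eqI iffI)
  fix A assume "A \<in> Lambda_plus (mat 1)"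
  then have a: "A \<in> two_forms" "star A = A" by (auto simp: Lambda_plus_def)
  have a4: "A$2$1 = - A$1$2" "A$3$1 = - A$1$3" "A$4$1 = - A$1$4" "A$3$2 = - A$2$3" "A$4$2 = - A$2$4"
      "A$4$3 = - A$3$4" "A$1$1 = 0" "A$2$2 = 0" "A$3$3 = 0" "A$4$4 = 0"
    using a(1) unfolding two_forms_4 by blast+
  have e: "A$3$4 = A$1$2" "A$2$4 = - A$1$3" "A$2$3 = A$1$4"
    using arg_cong[OF a(2), of "\<lambda>X. X$1$2"] arg_cong[OF a(2), of "\<lambda>X. X$1$3"]
      arg_cong[OF a(2), of "\<lambda>X. X$1$4"]
    by (simp_all add: star_explicit a4)
  have "A = std_sd (sqrt 2 *\<^sub>R vector [A$1$2, A$1$3, A$1$4])"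
    unfolding vec_eq_iff forall_4 by (simp add: std_sd_def a4 e)
  then show "A \<in> range std_sd" by blast
qed (auto simp: Lambda_plus_def std_sd_two_forms star_std_sd)

lemma form_inner_std_sd: "form_inner (mat 1) (std_sd y) (std_sd z) = y \<bullet> z"
proof -
  define h where "h = 1 / sqrt (2::real)"
  have h: "h * h = 1/2" by (simp add: h_def)
  have "form_inner (mat 1) (std_sd y) (std_sd z) = 2 * (h * h) * (y$1 * z$1 + y$2 * z$2 + y$3 * z$3)"
    unfolding form_inner_id std_sd_def h_def[symmetric] by (simp add: sum_4 algebra_simps)
  then show ?thesis by (simp add: h inner_vec_def sum_3)
qed

lemma std_sd_linear: "std_sd (y + z) = std_sd y + std_sd z" "std_sd (c *\<^sub>R y) = c *\<^sub>R std_sd y"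
proof -
  define h where "h = 1 / sqrt (2::real)"
  show "std_sd (y + z) = std_sd y + std_sd z" "std_sd (c *\<^sub>R y) = c *\<^sub>R std_sd y"
    unfolding vec_eq_iff forall_4 std_sd_def h_def[symmetric] by (simp_all add: algebra_simps)
qed

lemma std_sd_diff: "std_sd (y - z) = std_sd y - std_sd z"
  using std_sd_linear(1)[of y "- 1 *\<^sub>R z"] std_sd_linear(2)[of "- 1" z] by simp

text \<open>The three standard self-dual forms multiply like imaginary quaternions, up to the factor \<open>1/\<surd>2\<close>.\<close>

lemma std_sd_square: "std_sd y ** std_sd y = (- (1/2) * (y \<bullet> y)) *\<^sub>R mat 1"
proof -
  define h where "h = 1 / sqrt (2::real)"
  have h: "1/2 = h * h" by (simp add: h_def)
  show ?thesis
    unfolding vec_eq_iff forall_4 std_sd_def h_def[symmetric] h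
    by (simp add: matrix_matrix_mult_def sum_4 mat_def inner_vec_def sum_3 algebra_simps)
qed

section \<open>Orthonormal frames\<close>

lemma mat_one_nth: "(mat 1 :: real^'n^'n) $ i $ j = (if i = j then 1 else 0)"
  by (simp add: mat_def)

lemma inner_matrix_symmetric:
  fixes M :: "real^'n^'n"
  assumes "transpose M = M"
  shows "v \<bullet> (M *v w) = w \<bullet> (M *v v)"
  by (metis assms dot_lmul_matrix inner_commute transpose_matrix_vector)

text \<open>The step of the Gram-Schmidt process: fewer than four linear conditions on a vector of four-space have a
  nonzero solution.\<close>

lemma conjugate_unit_vector:
  fixes M :: "real^4^4" and S :: "(real^4) set"
  assumes M: "inner_product_matrix M" and S: "finite S" "card S < 4"
  shows "\<exists>v. v \<bullet> (M *v v) = 1 \<and> (\<forall>s\<in>S. s \<bullet> (M *v v) = 0 \<and> v \<bullet> (M *v s) = 0)"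
proof -
  have sym: "transpose M = M" using M by (simp add: inner_product_matrix_def)
  have "dim ((*v) M ` S) \<le> card ((*v) M ` S)" by (rule dim_le_card') (simp add: S)
  also have "\<dots> \<le> card S" by (rule card_image_le[OF S(1)])
  finally have "dim ((*v) M ` S) < DIM(real^4)" using S(2) by simp
  then obtain x where x: "x \<noteq> 0" "\<And>y. y \<in> span ((*v) M ` S) \<Longrightarrow> orthogonal x y"
    using orthogonal_to_subspace_exists by blast
  have pos: "x \<bullet> (M *v x) > 0" using M x(1) by (simp add: inner_product_matrix_def)
  define v where "v = (1 / sqrt (x \<bullet> (M *v x))) *\<^sub>R x"
  have "v \<bullet> (M *v v) = 1"
    using pos by (simp add: v_def matrix_vector_mult_scaleR)
  moreover have "v \<bullet> (M *v s) = 0" if "s \<in> S" for s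
    using x(2)[of "M *v s"] that by (simp add: v_def orthogonal_def span_base)
  ultimately show ?thesis using inner_matrix_symmetric[OF sym] by metis
qed

definition column_matrix :: "real^4 \<Rightarrow> real^4 \<Rightarrow> real^4 \<Rightarrow> real^4 \<Rightarrow> real^4^4" where
  "column_matrix a b c d = transpose (vector [a, b, c, d])"

lemma pull_frame_nth: "pull P A $ i $ j = column i P \<bullet> (A *v column j P)"
  by (simp add: pull_nth inner_vec_def matrix_vector_mult_def column_def sum_distrib_left mult_ac)

lemma column_frame [simp]:
  "column 1 (column_matrix a b c d) = a" "column 2 (column_matrix a b c d) = b"
  "column 3 (column_matrix a b c d) = c" "column 4 (column_matrix a b c d) = d"
  by (simp_all add: column_matrix_def column_def transpose_def)

lemma invertible_if_pull_id: "pull P M = mat 1 \<Longrightarrow> invertible P \<and> invertible M"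
proof -
  assume a: "pull P M = mat 1"
  have "det (pull P M) = det P * det P * det M" by (simp add: pull_def det_mul)
  then have "det P * det P * det M = 1" by (simp add: a)
  then have "det P \<noteq> 0" "det M \<noteq> 0" by auto
  then show ?thesis by (simp add: invertible_det_nz)
qed

lemma orthonormal_frame_exists:
  assumes M: "inner_product_matrix M"
  obtains P where "pull P M = mat 1" "det P > 0"
proof -
  obtain a where a: "a \<bullet> (M *v a) = 1" using conjugate_unit_vector[OF M, of "{}"] by auto
  obtain b where b: "b \<bullet> (M *v b) = 1" "a \<bullet> (M *v b) = 0" "b \<bullet> (M *v a) = 0"
    using conjugate_unit_vector[OF M, of "{a}"] by auto
  have "card {a, b} < 4" by (simp add: card_insert_if)
  then obtain c where c: "c \<bullet> (M *v c) = 1" "a \<bullet> (M *v c) = 0" "c \<bullet> (M *v a) = 0"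
      "b \<bullet> (M *v c) = 0" "c \<bullet> (M *v b) = 0"
    using conjugate_unit_vector[OF M, of "{a,b}"] by auto
  have "card {a, b, c} < 4"
    by (simp add: card_insert_if)
  then obtain d where d: "d \<bullet> (M *v d) = 1" "a \<bullet> (M *v d) = 0" "d \<bullet> (M *v a) = 0"
      "b \<bullet> (M *v d) = 0" "d \<bullet> (M *v b) = 0" "c \<bullet> (M *v d) = 0" "d \<bullet> (M *v c) = 0"
    using conjugate_unit_vector[OF M, of "{a,b,c}"] by auto
  \<comment> \<open>Reversing the first vector corrects the orientation.\<close>
  have *: "pull (column_matrix (s *\<^sub>R a) b c d) M = mat 1" if "s * s = 1" for s
    unfolding vec_eq_iff forall_4
    by (simp add: pull_frame_nth mat_one_nth a b c d matrix_vector_mult_scaleR that)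
  have "det (column_matrix ((- 1) *\<^sub>R a) b c d) = - det (column_matrix (1 *\<^sub>R a) b c d)"
    unfolding column_matrix_def det_transpose by (simp add: det_4)
  moreover have "det (column_matrix (1 *\<^sub>R a) b c d) \<noteq> 0"
    using invertible_if_pull_id[OF *[of 1]] by (simp add: invertible_det_nz)
  ultimately have "det (column_matrix (1 *\<^sub>R a) b c d) > 0 \<or> det (column_matrix ((-1) *\<^sub>R a) b c d) > 0" by linarith
  then show thesis using that *[of 1] *[of "-1"] by auto
qed

lemma inner_product_matrix_invertible: "inner_product_matrix M \<Longrightarrow> invertible M"
  using orthonormal_frame_exists invertible_if_pull_id by metis

lemma inner_product_matrix_det_pos: "inner_product_matrix M \<Longrightarrow> det M > 0"
proof -
  assume "inner_product_matrix M"
  then obtain P where "pull P M = mat 1" using orthonormal_frame_exists by metis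
  moreover have "det (pull P M) = det P * det P * det M" by (simp add: pull_def det_mul)
  ultimately have "det P * det P * det M = 1" by simp
  then show "det M > 0" by (metis mult_nonneg_nonpos not_le zero_le_square zero_less_one)
qed

lemma pull_Lambda_plus:
  assumes "invertible P" "det P > 0" "invertible M"
  shows "pull P A \<in> Lambda_plus (pull P M) \<longleftrightarrow> A \<in> Lambda_plus M"
proof -
  have "pull P A \<in> two_forms \<longleftrightarrow> A \<in> two_forms"
    unfolding two_forms_def mem_Collect_eq transpose_pull
    by (metis assms(1) inj_pull pull_simps(3))
  moreover have "hodge (pull P M) (pull P A) = pull P A \<longleftrightarrow> hodge M A = A"
    using assms inj_pull[OF assms(1)] by (auto simp: hodge_pull)
  ultimately show ?thesis by (simp add: Lambda_plus_def)
qed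

definition kaehler :: "real^4^4" where "kaehler = std_sd (axis 1 1)"

text \<open>In any orthonormal frame the matrix of \<open>A\<close> squares to \<open>-1/2\<close>, so \<open>J = -\<surd>2 A\<close> is an orthogonal complex
  structure.  Two orthonormal vectors \<open>a\<close>, \<open>c\<close> that span different \<open>J\<close>-lines give the frame
  \<open>a, Ja, c, Jc\<close>.  Its orientation is forced: an orientation-reversing frame would make the standard Kaehler form
  anti-self-dual.\<close>

lemma adapted_frame_exists:
  assumes M: "inner_product_matrix M" and A: "A \<in> Lambda_plus M" "form_inner M A A = 1"
  obtains P where "pull P M = mat 1" "pull P A = kaehler" "det P > 0"
proof -
  obtain Q where Q: "pull Q M = mat 1" "det Q > 0" using orthonormal_frame_exists[OF M] by auto
  note inv = invertible_if_pull_id[OF Q(1)]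
  have "pull Q A \<in> Lambda_plus (mat 1)" using A(1) inv Q pull_Lambda_plus by metis
  then obtain y where y: "pull Q A = std_sd y" by (auto simp: Lambda_plus_id)
  define B where "B = std_sd y"
  have "y \<bullet> y = 1" using form_inner_pull[of Q M A A] inv A(2) by (simp add: Q y form_inner_std_sd)
  then have BB: "B ** B = (- (1/2)) *\<^sub>R mat 1" by (simp add: B_def std_sd_square)
  have BBv: "B *v (B *v v) = (- (1/2)) *\<^sub>R v" for v
    unfolding matrix_vector_mul_assoc BB
    by (simp only: scaleR_matrix_vector_assoc[symmetric] matrix_vector_mul_lid)
  have sk: "v \<bullet> (B *v w) = - (w \<bullet> (B *v v))" for v w
  proof -
    have "transpose B = - B" using std_sd_two_forms[of y] by (simp add: B_def two_forms_def)
    then have "v \<bullet> (B *v w) = ((- B) *v v) \<bullet> w" by (metis dot_lmul_matrix transpose_matrix_vector)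
    also have "\<dots> = - (w \<bullet> (B *v v))"
      by (simp add: inner_commute matrix_vector_mult_def inner_vec_def sum_negf)
    finally show ?thesis .
  qed
  have I: "inner_product_matrix (mat 1)" by (simp add: inner_product_matrix_def)
  define a :: "real^4" where "a = axis 1 1"
  have a: "a \<bullet> a = 1" by (simp add: a_def inner_axis_axis)
  let ?J = "\<lambda>v. (- sqrt 2) *\<^sub>R (B *v v)"
  have "card {a, ?J a} < 4" by (simp add: card_insert_if)
  then obtain c where c: "c \<bullet> c = 1" "a \<bullet> c = 0" "c \<bullet> a = 0" "c \<bullet> (B *v a) = 0"
    using conjugate_unit_vector[OF I, of "{a,?J a}"] by (auto simp: inner_commute)
  have c': "a \<bullet> (B *v c) = 0" using c sk[of a c] by simp
  have 0: "v \<bullet> (B *v v) = 0" for v using sk[of v v] by simp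
  have BvBw: "(B *v v) \<bullet> (B *v w) = (1/2) * (v \<bullet> w)" for v w
    using sk[of w "B *v v"] by (simp add: BBv inner_commute)
  have c2: "(B *v a) \<bullet> c = 0" "(B *v a) \<bullet> a = 0" "(B *v c) \<bullet> c = 0" "(B *v c) \<bullet> a = 0"
    using c c' 0 by (simp_all add: inner_commute)
  have neg: "B *v (- v) = - (B *v v)" for v
    by (rule linear_neg) (rule matrix_vector_mul_linear)
  let ?F = "column_matrix a (?J a) c (?J c)"
  have F1: "pull ?F (mat 1) = mat 1"
    unfolding vec_eq_iff forall_4
    by (simp add: pull_frame_nth mat_one_nth a c c' 0 BvBw c2)
  have F2: "pull ?F B = kaehler"
    unfolding vec_eq_iff forall_4
    by (simp add: pull_frame_nth kaehler_def std_sd_def axis_def a c c' 0 BvBw BBv matrix_vector_mult_scaleR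
       c2 neg field_simps)
  define P where "P = Q ** ?F"
  have P: "pull P M = mat 1" "pull P A = kaehler"
    using F1 F2 by (simp_all add: P_def Q y B_def flip: pull_pull)
  have invP: "invertible P" using invertible_if_pull_id[OF P(1)] by simp
  \<comment> \<open>Both forms are self-dual, and the Hodge star changes sign with the orientation of the frame.\<close>
  have "kaehler = sgn (det P) *\<^sub>R kaehler"
    using hodge_pull[OF invP, of M A] inv A(1)
    by (simp add: P Lambda_plus_def) (simp add: kaehler_def star_std_sd)
  moreover have "kaehler \<noteq> 0" using form_inner_std_sd[of "axis 1 1" "axis 1 1"]
    by (auto simp: kaehler_def inner_axis_axis form_inner_id)
  ultimately have "sgn (det P) = 1" by (metis scaleR_one scaleR_right_imp_eq)
  then have "det P > 0" by (simp add: sgn_if split: if_splits)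
  then show thesis using that P by blast
qed

section \<open>The vertical plane at a point\<close>

lemma matrix_inv_frame:
  assumes "pull P M = mat 1" shows "matrix_inv M = P ** transpose P"
proof (rule matrix_inv_eqI)
  have "(transpose P ** M) ** P = mat 1" using assms by (simp add: pull_def)
  then have "P ** (transpose P ** M) = mat 1" using matrix_left_right_inverse by blast
  then have "(P ** transpose P) ** M = mat 1" by (simp add: matrix_mul_assoc)
  then show "M ** (P ** transpose P) = mat 1" using matrix_left_right_inverse by blast
qed

lemma pull_contract:
  assumes "pull P M = mat 1"
  shows "pull P (A ** matrix_inv M ** B) = pull P A ** pull P B"
  by (simp add: matrix_inv_frame[OF assms] pull_def matrix_mul_assoc)

text \<open>The two endomorphisms multiply to \<open>2 M\<^sup>-\<^sup>1 A M\<^sup>-\<^sup>1 B\<close>; the leading inverse cancels on lowering the index.\<close>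

lemma fibre_rotation_eq:
  assumes "invertible M"
  shows "fibre_rotation M A B = (- sqrt 2) *\<^sub>R (A ** matrix_inv M ** B)"
proof -
  have "M ** (matrix_inv M ** A ** (matrix_inv M ** B)) = A ** matrix_inv M ** B"
    by (simp add: matrix_mul_assoc matrix_inv_right[OF assms])
  then show ?thesis
    by (simp add: fibre_rotation_def endo_of_form_def form_of_endo_def mmul.scaleR_left mmul.scaleR_right
        mmul.minus_left mmul.minus_right) (simp add: field_simps)
qed

lemma invertible_id [simp]: "invertible (mat 1 :: real^'n^'n)"
  by (simp add: invertible_det_nz)

lemma pull_fibre_rotation:
  assumes "pull P M = mat 1"
  shows "pull P (fibre_rotation M A B) = fibre_rotation (mat 1) (pull P A) (pull P B)"
  using invertible_if_pull_id[OF assms]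
  by (simp add: fibre_rotation_eq matrix_inv_eqI pull_simps pull_contract[OF assms])

definition vertical_plane :: "real^4^4 \<Rightarrow> real^4^4 \<Rightarrow> (real^4^4) set" where
  "vertical_plane M A = {B \<in> Lambda_plus M. form_inner M B A = 0}"

lemma vertical_space_plane: "vertical_space G z = vertical_plane (G (fst z)) (snd z)"
  by (simp add: vertical_space_def vertical_plane_def)

lemma pull_vertical_plane:
  assumes "pull P M = mat 1" "det P > 0" "pull P A = kaehler"
  shows "B \<in> vertical_plane M A \<longleftrightarrow> (\<exists>q r. pull P B = std_sd (vector [0, q, r]))"
proof -
  note inv = invertible_if_pull_id[OF assms(1)]
  have "B \<in> vertical_plane M A \<longleftrightarrow> pull P B \<in> Lambda_plus (mat 1) \<and> form_inner (mat 1) (pull P B) kaehler = 0"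
    using inv assms pull_Lambda_plus[of P M B] form_inner_pull[of P M B A] by (simp add: vertical_plane_def)
  also have "\<dots> \<longleftrightarrow> (\<exists>y. pull P B = std_sd y \<and> y$1 = 0)"
    by (auto simp: Lambda_plus_id kaehler_def form_inner_std_sd inner_axis)
  also have "\<dots> \<longleftrightarrow> (\<exists>q r. pull P B = std_sd (vector [0, q, r]))"
  proof -
    have "y$1 = 0 \<longleftrightarrow> y = vector [0, y$2, y$3]" for y :: "real^3"
      by (simp add: vec_eq_iff forall_3)
    then show ?thesis by (metis vector_3(1))
  qed
  finally show ?thesis .
qed

lemma fibre_rotation_std:
  "fibre_rotation (mat 1) kaehler (std_sd (vector [0, q, r])) = std_sd (vector [0, - r, q])"
proof -
  define h where "h = 1 / sqrt (2::real)"
  have h: "h * h * sqrt 2 = h" "sqrt 2 * h = 1" by (simp_all add: h_def real_div_sqrt)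
  have "kaehler ** std_sd (vector [0, q, r]) = (- h) *\<^sub>R std_sd (vector [0, - r, q])"
    unfolding vec_eq_iff forall_4 std_sd_def kaehler_def h_def[symmetric]
    by (simp add: matrix_matrix_mult_def sum_4 axis_def)
  then show ?thesis
    by (simp add: fibre_rotation_eq matrix_inv_eqI h)
qed

text \<open>An oriented Euclidean plane has, up to scale, one skew endomorphism, namely its rotation; the skew endomorphism
  \<open>s \<mapsto> \<langle>s, w\<rangle>v - \<langle>s, v\<rangle>w\<close> is this rotation scaled by the area spanned by \<open>v\<close> and \<open>w\<close>.\<close>

lemma vertical_plane_area:
  assumes M: "inner_product_matrix M" and A: "A \<in> Lambda_plus M" "form_inner M A A = 1"
    and s: "s \<in> vertical_plane M A" and v: "v \<in> vertical_plane M A" and w: "w \<in> vertical_plane M A"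
  shows "form_inner M s w *\<^sub>R v - form_inner M s v *\<^sub>R w
       = (- form_inner M (fibre_rotation M A v) w) *\<^sub>R fibre_rotation M A s"
    and "fibre_rotation M A s \<in> vertical_plane M A"
    and "form_inner M (fibre_rotation M A s) (fibre_rotation M A s) = form_inner M s s"
    and "form_inner M s s = 0 \<longleftrightarrow> s = 0" and "form_inner M s s \<ge> 0"
proof -
  obtain P where P: "pull P M = mat 1" "pull P A = kaehler" "det P > 0"
    using adapted_frame_exists[OF M A] by blast
  note inv = invertible_if_pull_id[OF P(1)]
  note V = pull_vertical_plane[OF P(1,3,2)]
  obtain q r where s': "pull P s = std_sd (vector [0, q, r])" using s V by blast
  obtain q' r' where v': "pull P v = std_sd (vector [0, q', r'])" using v V by blast
  obtain q'' r'' where w': "pull P w = std_sd (vector [0, q'', r''])" using w V by blast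
  have fi: "form_inner M X Y = form_inner (mat 1) (pull P X) (pull P Y)" for X Y
    using form_inner_pull[of P M X Y] inv P(1) by simp
  note std = fi pull_fibre_rotation[OF P(1)] P(2) s' v' w' fibre_rotation_std form_inner_std_sd
  have v3: "(vector [0, a, b] :: real^3) \<bullet> vector [0, c, d] = a * c + b * d" for a b c d
    by (simp add: inner_vec_def sum_3)
  show "form_inner M s w *\<^sub>R v - form_inner M s v *\<^sub>R w
       = (- form_inner M (fibre_rotation M A v) w) *\<^sub>R fibre_rotation M A s"
  proof (rule inj_pull[of P])
    have "(q * q'' + r * r'') *\<^sub>R (vector [0, q', r'] :: real^3) - (q * q' + r * r') *\<^sub>R vector [0, q'', r'']
       = (r' * q'' - q' * r'') *\<^sub>R vector [0, - r, q]"
      by (simp add: vec_eq_iff forall_3 algebra_simps)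
    from arg_cong[OF this, of std_sd]
    show "pull P (form_inner M s w *\<^sub>R v - form_inner M s v *\<^sub>R w)
       = pull P ((- form_inner M (fibre_rotation M A v) w) *\<^sub>R fibre_rotation M A s)"
      by (simp add: pull_simps std v3 std_sd_linear std_sd_diff)
  qed (use inv in simp)
  show "fibre_rotation M A s \<in> vertical_plane M A"
    unfolding V by (auto simp: std)
  show "form_inner M (fibre_rotation M A s) (fibre_rotation M A s) = form_inner M s s"
    by (simp add: std v3)
  have "form_inner M s s = 0 \<longleftrightarrow> q = 0 \<and> r = 0"
    by (simp add: std v3 add_nonneg_eq_0_iff)
  also have "\<dots> \<longleftrightarrow> pull P s = pull P 0"
  proof -
    have "pull P s = 0 \<longrightarrow> (vector [0, q, r] :: real^3) \<bullet> vector [0, q, r] = 0"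
      unfolding form_inner_std_sd[symmetric] s'[symmetric] by (simp add: form_inner_id)
    moreover have "q = 0 \<and> r = 0 \<longrightarrow> vector [0, q, r] = (0 :: real^3)"
      by (simp add: vec_eq_iff forall_3)
    ultimately show ?thesis using std_sd_linear(2)[of 0 0]
      by (auto simp: s' v3 pull_simps add_nonneg_eq_0_iff)
  qed
  also have "\<dots> \<longleftrightarrow> s = 0" using inj_pull inv by metis
  finally show "form_inner M s s = 0 \<longleftrightarrow> s = 0" .
  show "form_inner M s s \<ge> 0" by (simp add: std v3)
qed

lemma vertical_plane_nontrivial:
  assumes M: "inner_product_matrix M" and A: "A \<in> Lambda_plus M" "form_inner M A A = 1"
  obtains s where "s \<in> vertical_plane M A" "s \<noteq> 0"
proof -
  obtain P where P: "pull P M = mat 1" "pull P A = kaehler" "det P > 0"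
    using adapted_frame_exists[OF M A] by blast
  note inv = invertible_if_pull_id[OF P(1)]
  define s where "s = pull (matrix_inv P) (std_sd (vector [0, 1, 0]))"
  have s: "pull P s = std_sd (vector [0, 1, 0])"
    using inv by (simp add: s_def pull_pull matrix_inv_left)
  have "form_inner (mat 1) (pull P s) (pull P s) = 1"
    by (simp add: s form_inner_std_sd inner_vec_def sum_3)
  then have "s \<noteq> 0" by (auto simp: form_inner_id pull_simps)
  moreover have "s \<in> vertical_plane M A" using pull_vertical_plane[OF P(1,3,2)] s by blast
  ultimately show thesis using that by blast
qed

text \<open>Infinitesimal isometries act on \<open>\<Lambda>\<^sup>+\<close> through their self-dual part, as a cross product with it in the
  three-space \<open>\<Lambda>\<^sup>+\<close>.  The component of \<open>S\<close> along the Kaehler form rotates the orthogonal plane, while the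
  components in that plane contribute multiples of the Kaehler form only.\<close>

lemma isometry_action_vertical_std:
  assumes S: "S \<in> two_forms" and s: "s = std_sd (vector [0, q, r])"
  defines "Z \<equiv> S ** s - s ** S"
  shows "Z - form_inner (mat 1) Z kaehler *\<^sub>R kaehler
       = (- sqrt 2 * form_inner (mat 1) S kaehler) *\<^sub>R std_sd (vector [0, - r, q])"
proof -
  define h where "h = 1 / sqrt (2::real)"
  have h: "h * h = 1/2" "sqrt 2 = 2 * h" by (simp_all add: h_def real_div_sqrt)
  have S': "S$2$1 = - S$1$2" "S$3$1 = - S$1$3" "S$4$1 = - S$1$4" "S$3$2 = - S$2$3" "S$4$2 = - S$2$4"
      "S$4$3 = - S$3$4" "S$1$1 = 0" "S$2$2 = 0" "S$3$3 = 0" "S$4$4 = 0"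
    using S unfolding two_forms_4 by blast+
  have Z: "Z $ i $ j = (\<Sum>k\<in>UNIV. S$i$k * s$k$j - s$i$k * S$k$j)" for i j
    by (simp add: Z_def matrix_matrix_mult_def sum_subtractf)
  have "form_inner (mat 1) S kaehler = h * (S$1$2 + S$3$4)"
    unfolding form_inner_id kaehler_def std_sd_def h_def[symmetric]
    by (simp add: sum_4 axis_def S' algebra_simps)
  then have f: "- sqrt 2 * form_inner (mat 1) S kaehler = - (S$1$2 + S$3$4)"
    by (simp add: h_def)
  have "form_inner (mat 1) Z kaehler = (h * h) * ((S$1$3 - S$2$4) * (- 2 * r) + (S$1$4 + S$2$3) * (2 * q))"
    unfolding form_inner_id Z s kaehler_def std_sd_def h_def[symmetric]
    by (simp add: sum_4 axis_def S' algebra_simps)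
  then have fZ: "form_inner (mat 1) Z kaehler = (S$2$4 - S$1$3) * r + (S$1$4 + S$2$3) * q"
    by (simp add: h(1) algebra_simps)
  show ?thesis
    unfolding f fZ
    unfolding vec_eq_iff forall_4 vector_minus_component vector_scaleR_component Z s kaehler_def std_sd_def
      h_def[symmetric]
    by (simp add: sum_4 axis_def S' algebra_simps)
qed

text \<open>In the application \<open>R\<close> is the curvature endomorphism of a pair of tangent vectors.  Antisymmetry of \<open>M R\<close> says
  that \<open>R\<close> is an infinitesimal isometry, and minus its transpose is its action on covectors.\<close>

lemma isometry_action_vertical:
  assumes M: "inner_product_matrix M" and A: "A \<in> Lambda_plus M" "form_inner M A A = 1"
    and s: "s \<in> vertical_plane M A" and R: "M ** R \<in> two_forms"
  defines "Z \<equiv> - (transpose R ** s + s ** R)"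
  shows "Z - form_inner M Z A *\<^sub>R A = (- sqrt 2 * form_inner M (M ** R) A) *\<^sub>R fibre_rotation M A s"
proof -
  obtain P where P: "pull P M = mat 1" "pull P A = kaehler" "det P > 0"
    using adapted_frame_exists[OF M A] by blast
  note inv = invertible_if_pull_id[OF P(1)]
  obtain q r where s': "pull P s = std_sd (vector [0, q, r])"
    using s pull_vertical_plane[OF P(1,3,2)] by blast
  have fi: "form_inner M X Y = form_inner (mat 1) (pull P X) (pull P Y)" for X Y
    using form_inner_pull[of P M X Y] inv P(1) by simp
  define S where "S = pull P (M ** R)"
  have S: "S \<in> two_forms" using pull_two_forms[OF R] by (simp add: S_def)
  have tS: "transpose S = - S" using S by (simp add: two_forms_def)
  have e: "matrix_inv M ** (M ** R) = R"
    using inv by (simp add: matrix_mul_assoc matrix_inv_left)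
  have sym: "transpose M = M" using M by (simp add: inner_product_matrix_def)
  have "transpose (matrix_inv M) = matrix_inv M"
    by (simp add: matrix_inv_frame[OF P(1)] matrix_transpose_mul)
  then have e': "transpose R ** s = (- (M ** R)) ** matrix_inv M ** s"
    using arg_cong[OF e, of transpose] R by (simp add: matrix_transpose_mul two_forms_def)
  have "pull P (s ** R) = pull P s ** S"
    using pull_contract[OF P(1), of s "M ** R"] e by (simp add: S_def flip: matrix_mul_assoc)
  moreover have "pull P (transpose R ** s) = - (S ** pull P s)"
    using pull_contract[OF P(1), of "- (M ** R)" s] e' by (simp add: S_def pull_simps mmul.minus_left)
  ultimately have Z: "pull P Z = S ** pull P s - pull P s ** S"
    by (simp add: Z_def pull_simps)
  show ?thesis
  proof (rule inj_pull[of P])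
    show "pull P (Z - form_inner M Z A *\<^sub>R A)
        = pull P ((- sqrt 2 * form_inner M (M ** R) A) *\<^sub>R fibre_rotation M A s)"
      using isometry_action_vertical_std[OF S s']
      by (simp add: pull_simps fi Z P(2) pull_fibre_rotation[OF P(1)] s' fibre_rotation_std flip: S_def)
  qed (use inv in simp)
qed

section \<open>Algebraic curvature tensors\<close>

type_synonym tensor4 = "4 \<Rightarrow> 4 \<Rightarrow> 4 \<Rightarrow> 4 \<Rightarrow> real"

text \<open>The Weyl and Ricci parts are algebraic in the Riemann tensor at a point.  The operators that follow repeat
  their definitions for an arbitrary lowered tensor \<open>R k l i j = g(R(\<partial>\<^sub>i, \<partial>\<^sub>j)\<partial>\<^sub>l, \<partial>\<^sub>k)\<close>, because a change of
  frame at the point cannot be made on the metric as a function.\<close>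

definition curvature_tensor :: "tensor4 \<Rightarrow> bool" where
  "curvature_tensor R \<longleftrightarrow> (\<forall>k l i j. R k l j i = - R k l i j \<and> R l k i j = - R k l i j \<and>
     R k l i j + R k i j l + R k j l i = 0)"

lemma curvature_tensorD:
  assumes "curvature_tensor R"
  shows "R k l j i = - R k l i j" "R l k i j = - R k l i j" "R k l i j + R k i j l + R k j l i = 0"
proof -
  note * = assms[unfolded curvature_tensor_def, rule_format, of k l j i]
  show "R k l j i = - R k l i j" by (rule *[THEN conjunct1])
  show "R l k i j = - R k l i j" by (rule *[THEN conjunct2, THEN conjunct1])
  show "R k l i j + R k i j l + R k j l i = 0" by (rule *[THEN conjunct2, THEN conjunct2])
qed

definition form_op :: "real^4^4 \<Rightarrow> tensor4 \<Rightarrow> real^4^4 \<Rightarrow> real^4^4" where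
  "form_op M R A = (\<chi> i j. (1/2) * (\<Sum>k\<in>UNIV. \<Sum>l\<in>UNIV. R k l i j * raise M A $k$l))"

definition ricci_of :: "real^4^4 \<Rightarrow> tensor4 \<Rightarrow> real^4^4" where
  "ricci_of M R = (\<chi> j k. \<Sum>i\<in>UNIV. \<Sum>m\<in>UNIV. matrix_inv M $i$m * R m k i j)"

definition scal_of :: "real^4^4 \<Rightarrow> tensor4 \<Rightarrow> real" where
  "scal_of M R = trace (matrix_inv M ** transpose (ricci_of M R))"

definition Ric0_of :: "real^4^4 \<Rightarrow> tensor4 \<Rightarrow> real^4^4 \<Rightarrow> real^4^4" where
  "Ric0_of M R A = (let r = (ricci_of M R - (scal_of M R / 4) *\<^sub>R M) ** matrix_inv M
                   in (1/2) *\<^sub>R (r ** A + A ** transpose r))"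

definition Wplus_of :: "real^4^4 \<Rightarrow> tensor4 \<Rightarrow> real^4^4 \<Rightarrow> real^4^4" where
  "Wplus_of M R A = sd_part M (form_op M R A - Ric0_of M R A - (scal_of M R / 12) *\<^sub>R A)
     + (scal_of M R / 12) *\<^sub>R A"

definition tensor_pull :: "real^4^4 \<Rightarrow> tensor4 \<Rightarrow> tensor4" where
  "tensor_pull P R a b c d = (\<Sum>k\<in>UNIV. \<Sum>l\<in>UNIV. \<Sum>i\<in>UNIV. \<Sum>j\<in>UNIV.
     P$k$a * P$l$b * P$i$c * P$j$d * R k l i j)"

lemma sum_rotate:
  "(\<Sum>i\<in>A. \<Sum>j\<in>B. \<Sum>l\<in>C. f i j l) = (\<Sum>l\<in>C. \<Sum>i\<in>A. \<Sum>j\<in>B. f i j l)"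
proof -
  have "(\<Sum>i\<in>A. \<Sum>j\<in>B. \<Sum>l\<in>C. f i j l) = (\<Sum>i\<in>A. \<Sum>l\<in>C. \<Sum>j\<in>B. f i j l)"
    by (rule sum.cong[OF refl]) (rule sum.swap)
  also have "\<dots> = (\<Sum>l\<in>C. \<Sum>i\<in>A. \<Sum>j\<in>B. f i j l)"
    by (rule sum.swap)
  finally show ?thesis .
qed

lemma tensor_pull_pull:
  "tensor_pull P R a b c d = (\<Sum>k\<in>UNIV. \<Sum>l\<in>UNIV. P$k$a * P$l$b * pull P (\<chi> i j. R k l i j) $ c $ d)"
  by (simp add: tensor_pull_def pull_nth sum_distrib_left mult_ac)

lemma tensor_pull_pull':
  "tensor_pull P R a b c d = (\<Sum>i\<in>UNIV. \<Sum>j\<in>UNIV. P$i$c * P$j$d * pull P (\<chi> k l. R k l i j) $ a $ b)"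
proof -
  have "tensor_pull P R a b c d = (\<Sum>i\<in>UNIV. \<Sum>j\<in>UNIV. \<Sum>k\<in>UNIV. \<Sum>l\<in>UNIV.
     P$k$a * P$l$b * P$i$c * P$j$d * R k l i j)"
    unfolding tensor_pull_def by (rule sum_swap_pairs)
  then show ?thesis by (simp add: pull_nth sum_distrib_left mult_ac)
qed

lemma pull_swap_nth: "pull P A $ b $ a = pull P (transpose A) $ a $ b"
  by (simp flip: transpose_pull) (simp add: transpose_def)

text \<open>Permuting the last three arguments only renames summation indices, so that the Bianchi identity can be
  applied under the sum.\<close>

lemma curvature_tensor_pull:
  assumes "curvature_tensor R" shows "curvature_tensor (tensor_pull P R)"
proof -
  note R = curvature_tensorD[OF assms]
  have t: "transpose (\<chi> i j. R k l i j) = - (\<chi> i j. R k l i j)" for k l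
    unfolding vec_eq_iff transpose_def vector_uminus_component vec_lambda_beta by (intro allI R(1))
  have t': "transpose (\<chi> k l. R k l i j) = - (\<chi> k l. R k l i j)" for i j
    unfolding vec_eq_iff transpose_def vector_uminus_component vec_lambda_beta by (intro allI R(2))
  have 1: "tensor_pull P R k l j i = - tensor_pull P R k l i j" for k l i j
    unfolding tensor_pull_pull pull_swap_nth[of P _ j i] t pull_simps by (simp add: sum_negf)
  have 2: "tensor_pull P R l k i j = - tensor_pull P R k l i j" for k l i j
    unfolding tensor_pull_pull' pull_swap_nth[of P _ l k] t' pull_simps by (simp add: sum_negf)
  have "tensor_pull P R a b c d + tensor_pull P R a c d b + tensor_pull P R a d b c = 0" for a b c d
  proof -
    have A: "tensor_pull P R a c d b = (\<Sum>k\<in>UNIV. \<Sum>l\<in>UNIV. \<Sum>i\<in>UNIV. \<Sum>j\<in>UNIV.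
        P$k$a * P$l$b * P$i$c * P$j$d * R k i j l)"
      unfolding tensor_pull_def
      by (rule sum.cong[OF refl], rule trans[OF sum_rotate], intro sum.cong refl, simp add: mult_ac)
    have B: "tensor_pull P R a d b c = (\<Sum>k\<in>UNIV. \<Sum>l\<in>UNIV. \<Sum>i\<in>UNIV. \<Sum>j\<in>UNIV.
        P$k$a * P$l$b * P$i$c * P$j$d * R k j l i)"
      unfolding tensor_pull_def
      by (rule sum.cong[OF refl], rule trans[OF sum_rotate[symmetric]], intro sum.cong refl, simp add: mult_ac)
    have "tensor_pull P R a b c d + tensor_pull P R a c d b + tensor_pull P R a d b c =
      (\<Sum>k\<in>UNIV. \<Sum>l\<in>UNIV. \<Sum>i\<in>UNIV. \<Sum>j\<in>UNIV.
        P$k$a * P$l$b * P$i$c * P$j$d * (R k l i j + R k i j l + R k j l i))"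
      unfolding A B unfolding tensor_pull_def by (simp only: sum.distrib[symmetric] distrib_left)
    then show ?thesis by (simp only: R(3) mult_zero_right sum.neutral_const)
  qed
  with 1 2 show ?thesis unfolding curvature_tensor_def by blast
qed

text \<open>Here and in the next lemmas each contraction uses the inverse metric \<open>P P\<^sup>T\<close>, which supplies the two frame
  matrices that the pulled-back tensor needs.\<close>

lemma form_op_pull:
  assumes "pull P M = mat 1"
  shows "pull P (form_op M R A) = form_op (mat 1) (tensor_pull P R) (pull P A)"
proof -
  define A' where "A' = pull P A"
  note inv = invertible_if_pull_id[OF assms]
  have r: "raise M A $k$l = (\<Sum>a\<in>UNIV. \<Sum>b\<in>UNIV. P$k$a * P$l$b * A' $ a $ b)" for k l
  proof -
    have "raise M A = P ** A' ** transpose P"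
      using raise_pull[of P M A] inv assms by (simp add: A'_def)
    then show ?thesis
      unfolding matrix_matrix_mult_def transpose_def
      by (simp add: sum_distrib_left sum_distrib_right) (subst sum.swap, simp add: mult_ac)
  qed
  have "pull P (form_op M R A) $ c $ d = form_op (mat 1) (tensor_pull P R) A' $ c $ d" for c d
  proof -
    have "pull P (form_op M R A) $ c $ d = (1/2) * (\<Sum>i\<in>UNIV. \<Sum>j\<in>UNIV. \<Sum>k\<in>UNIV. \<Sum>l\<in>UNIV.
        P$i$c * P$j$d * R k l i j * raise M A $k$l)"
      by (simp add: pull_nth form_op_def sum_distrib_left mult_ac)
    also have "\<dots> = (1/2) * (\<Sum>k\<in>UNIV. \<Sum>l\<in>UNIV. \<Sum>i\<in>UNIV. \<Sum>j\<in>UNIV.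
        P$i$c * P$j$d * R k l i j * raise M A $k$l)"
      by (intro arg_cong[where f="(*) (1/2)"] sum_swap_pairs)
    also have "\<dots> = (1/2) * (\<Sum>k\<in>UNIV. \<Sum>l\<in>UNIV. \<Sum>a\<in>UNIV. \<Sum>b\<in>UNIV.
        pull P (\<chi> i j. R k l i j) $ c $ d * (P$k$a * P$l$b * A' $ a $ b))"
      by (simp add: r pull_nth sum_distrib_left sum_distrib_right mult_ac)
        (rule sum.cong[OF refl], rule sum.cong[OF refl], rule sum_swap_pairs)
    also have "\<dots> = (1/2) * (\<Sum>a\<in>UNIV. \<Sum>b\<in>UNIV. \<Sum>k\<in>UNIV. \<Sum>l\<in>UNIV.
        pull P (\<chi> i j. R k l i j) $ c $ d * (P$k$a * P$l$b * A' $ a $ b))"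
      by (intro arg_cong[where f="(*) (1/2)"] sum_swap_pairs)
    also have "\<dots> = form_op (mat 1) (tensor_pull P R) A' $ c $ d"
      by (simp add: form_op_def tensor_pull_pull sum_distrib_left sum_distrib_right mult_ac)
    finally show ?thesis .
  qed
  then show ?thesis by (simp add: vec_eq_iff A'_def)
qed

lemma ricci_of_pull:
  assumes "pull P M = mat 1"
  shows "pull P (ricci_of M R) = ricci_of (mat 1) (tensor_pull P R)"
proof -
  have "pull P (ricci_of M R) $ d $ b = ricci_of (mat 1) (tensor_pull P R) $ d $ b" for d b
  proof -
    have "pull P (ricci_of M R) $ d $ b = (\<Sum>j\<in>UNIV. \<Sum>l\<in>UNIV. \<Sum>i\<in>UNIV. \<Sum>k\<in>UNIV. \<Sum>a\<in>UNIV.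
        P$j$d * P$l$b * P$i$a * P$k$a * R k l i j)"
      by (simp add: pull_nth ricci_of_def matrix_inv_frame[OF assms] matrix_matrix_mult_def transpose_def
          sum_distrib_left sum_distrib_right mult_ac)
    also have "\<dots> = (\<Sum>a\<in>UNIV. \<Sum>j\<in>UNIV. \<Sum>l\<in>UNIV. \<Sum>i\<in>UNIV. \<Sum>k\<in>UNIV.
        P$j$d * P$l$b * P$i$a * P$k$a * R k l i j)"
      by (rule trans[OF _ sum_rotate], intro sum.cong refl sum_rotate)
    also have "\<dots> = (\<Sum>a\<in>UNIV. \<Sum>j\<in>UNIV. \<Sum>k\<in>UNIV. \<Sum>l\<in>UNIV. \<Sum>i\<in>UNIV.
        P$j$d * P$l$b * P$i$a * P$k$a * R k l i j)"
      by (intro sum.cong refl sum_rotate)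
    also have "\<dots> = (\<Sum>a\<in>UNIV. \<Sum>k\<in>UNIV. \<Sum>l\<in>UNIV. \<Sum>i\<in>UNIV. \<Sum>j\<in>UNIV.
        P$j$d * P$l$b * P$i$a * P$k$a * R k l i j)"
      by (rule sum.cong[OF refl], rule trans[OF sum.swap], intro sum.cong refl sum_rotate[symmetric])
    also have "\<dots> = (\<Sum>a\<in>UNIV. tensor_pull P R a b a d)"
      by (simp add: tensor_pull_def mult_ac)
    also have "\<dots> = ricci_of (mat 1) (tensor_pull P R) $ d $ b"
      by (simp add: ricci_of_def matrix_inv_eqI mat_one_nth if_distrib[of "\<lambda>x. x * _"] cong: if_cong)
    finally show ?thesis .
  qed
  then show ?thesis by (simp add: vec_eq_iff)
qed

lemma scal_of_pull:
  assumes "pull P M = mat 1"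
  shows "scal_of M R = scal_of (mat 1) (tensor_pull P R)"
proof -
  have "trace (P ** transpose P ** transpose (ricci_of M R)) = trace (transpose P ** transpose (ricci_of M R) ** P)"
    using trace_mul_sym[of P "transpose P ** transpose (ricci_of M R)"] by (simp add: matrix_mul_assoc)
  also have "\<dots> = trace (transpose (pull P (ricci_of M R)))"
    unfolding transpose_pull by (simp add: pull_def)
  finally show ?thesis
    by (simp add: scal_of_def matrix_inv_frame[OF assms] ricci_of_pull[OF assms] matrix_inv_eqI)
qed

lemma Ric0_of_pull:
  assumes M: "transpose M = M" and P: "pull P M = mat 1"
  shows "pull P (Ric0_of M R A) = Ric0_of (mat 1) (tensor_pull P R) (pull P A)"
proof -
  define r where "r = ricci_of M R - (scal_of M R / 4) *\<^sub>R M"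
  have tinv: "transpose (matrix_inv M) = matrix_inv M"
    by (simp add: matrix_inv_frame[OF P] matrix_transpose_mul)
  have "Ric0_of M R A = (1/2) *\<^sub>R (r ** matrix_inv M ** A + A ** matrix_inv M ** transpose r)"
    by (simp add: Ric0_of_def Let_def r_def matrix_transpose_mul tinv matrix_mul_assoc)
  then show ?thesis
    by (simp add: pull_simps pull_contract[OF P] flip: transpose_pull)
      (simp add: Ric0_of_def Let_def r_def pull_simps ricci_of_pull[OF P] scal_of_pull[OF P] P matrix_inv_eqI)
qed

lemma sd_part_pull:
  assumes "pull P M = mat 1" "det P > 0"
  shows "pull P (sd_part M A) = sd_part (mat 1) (pull P A)"
  using hodge_pull[of P M A] assms invertible_if_pull_id[OF assms(1)]
  by (simp add: sd_part_def pull_simps)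

lemma Wplus_of_pull:
  assumes "transpose M = M" "pull P M = mat 1" "det P > 0"
  shows "pull P (Wplus_of M R A) = Wplus_of (mat 1) (tensor_pull P R) (pull P A)"
  by (simp add: Wplus_of_def pull_simps sd_part_pull[OF assms(2,3)] form_op_pull[OF assms(2)]
      Ric0_of_pull[OF assms(1,2)] scal_of_pull[OF assms(2), symmetric])

section \<open>The curvature operator on a complex line\<close>

lemma curvature_tensor_pair_symmetric:
  assumes "curvature_tensor R" shows "R k l i j = R i j k l"
proof -
  note R = curvature_tensorD[OF assms]
  have "R l k i j = - R k l i j" "R j i k l = - R i j k l" "R l j k i = - R j l k i" "R i l j k = - R l i j k"
    "R j k l i = - R k j l i" "R i k l j = - R k i l j"
    by (rule R(2))+
  moreover have "R j l i k = - R j l k i" "R k i l j = - R k i j l"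
    by (rule R(1))+
  ultimately show ?thesis
    using R(3)[of k l i j] R(3)[of l i j k] R(3)[of i j k l] R(3)[of j k l i] by linarith
qed

text \<open>A simplification set that reduces every component to twenty independent ones.\<close>

lemma curvature_tensor_components:
  assumes "curvature_tensor R"
  shows "R i i k l = 0" "R k l i i = 0"
    "R 2 1 i j = - R 1 2 i j" "R 3 1 i j = - R 1 3 i j" "R 4 1 i j = - R 1 4 i j"
    "R 3 2 i j = - R 2 3 i j" "R 4 2 i j = - R 2 4 i j" "R 4 3 i j = - R 3 4 i j"
    "R i j 2 1 = - R i j 1 2" "R i j 3 1 = - R i j 1 3" "R i j 4 1 = - R i j 1 4"
    "R i j 3 2 = - R i j 2 3" "R i j 4 2 = - R i j 2 4" "R i j 4 3 = - R i j 3 4"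
    "R 1 3 1 2 = R 1 2 1 3" "R 1 4 1 2 = R 1 2 1 4" "R 2 3 1 2 = R 1 2 2 3" "R 2 4 1 2 = R 1 2 2 4"
    "R 3 4 1 2 = R 1 2 3 4" "R 1 4 1 3 = R 1 3 1 4" "R 2 3 1 3 = R 1 3 2 3" "R 2 4 1 3 = R 1 3 2 4"
    "R 3 4 1 3 = R 1 3 3 4" "R 2 3 1 4 = R 1 4 2 3" "R 2 4 1 4 = R 1 4 2 4" "R 3 4 1 4 = R 1 4 3 4"
    "R 2 4 2 3 = R 2 3 2 4" "R 3 4 2 3 = R 2 3 3 4" "R 3 4 2 4 = R 2 4 3 4"
    "R 1 4 2 3 = R 1 3 2 4 - R 1 2 3 4"
proof -
  note R = curvature_tensorD[OF assms] and S = curvature_tensor_pair_symmetric[OF assms]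
  show "R i i k l = 0" "R k l i i = 0" using R(2)[of i i k l] R(1)[of k l i i] by linarith+
  show "R 1 4 2 3 = R 1 3 2 4 - R 1 2 3 4" using R(3)[of 1 2 3 4] R(1)[of 1 3 2 4] by linarith
qed (rule curvature_tensorD[OF assms] curvature_tensor_pair_symmetric[OF assms])+

text \<open>The block decomposition of the curvature operator, on the Kaehler form: its anti-self-dual part is the
  trace-free Ricci tensor.  The Kaehler form represents all unit self-dual forms, each being the Kaehler form of some
  frame.\<close>

lemma curvature_decomposition_std:
  assumes R: "curvature_tensor R"
  obtains y where "Ric0_of (mat 1) R kaehler = std_asd y"
    and "form_op (mat 1) R kaehler - Ric0_of (mat 1) R kaehler = sd_part (mat 1) (form_op (mat 1) R kaehler)"
proof -
  note C = curvature_tensor_components[OF R]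
  define h where "h = 1 / sqrt (2::real)"
  have hh: "sqrt 2 * h = 1" by (simp add: h_def)
  define Ric where "Ric = ricci_of (mat 1) R"
  have Ric: "Ric $ j $ k = (\<Sum>i\<in>UNIV. R i k i j)" for j k
    by (simp add: Ric_def ricci_of_def matrix_inv_eqI mat_one_nth if_distrib[of "\<lambda>x. x * _"] cong: if_cong)
  have s: "scal_of (mat 1) R = Ric$1$1 + Ric$2$2 + Ric$3$3 + Ric$4$4"
    by (simp add: scal_of_def matrix_inv_eqI Ric_def trace_def transpose_def sum_4)
  define r where "r = Ric - (scal_of (mat 1) R / 4) *\<^sub>R mat 1"
  have r: "r $ i $ j = Ric $ i $ j - (if i = j then scal_of (mat 1) R / 4 else 0)" for i j
    by (simp add: r_def mat_one_nth)
  have "Ric0_of (mat 1) R kaehler = (1/2) *\<^sub>R (r ** kaehler + kaehler ** transpose r)"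
    by (simp add: Ric0_of_def Let_def r_def Ric_def matrix_inv_eqI)
  then have Ric0: "Ric0_of (mat 1) R kaehler $ i $ j = (1/2) * (\<Sum>k\<in>UNIV. r$i$k * kaehler$k$j + kaehler$i$k * r$j$k)" for i j
    by (simp add: matrix_matrix_mult_def transpose_def sum.distrib)
  have op: "form_op (mat 1) R kaehler $ i $ j = h * (R 1 2 i j + R 3 4 i j)" for i j
    by (simp add: form_op_def sum_4 kaehler_def std_sd_def axis_def C algebra_simps flip: h_def)
  have kaehler: "kaehler$1$1 = 0" "kaehler$1$2 = h" "kaehler$1$3 = 0" "kaehler$1$4 = 0" "kaehler$2$1 = - h" "kaehler$2$2 = 0" "kaehler$2$3 = 0"
      "kaehler$2$4 = 0" "kaehler$3$1 = 0" "kaehler$3$2 = 0" "kaehler$3$3 = 0" "kaehler$3$4 = h" "kaehler$4$1 = 0" "kaehler$4$2 = 0"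
      "kaehler$4$3 = - h" "kaehler$4$4 = 0"
    by (simp_all add: kaehler_def std_sd_def axis_def h_def)
  let ?y = "vector [(1/2) * (Ric$1$1 + Ric$2$2 - Ric$3$3 - Ric$4$4) / 2, (Ric$2$3 - Ric$1$4)/2, (Ric$2$4 + Ric$1$3)/2] :: real^3"
  show thesis
  proof (rule that[of ?y])
    show "Ric0_of (mat 1) R kaehler = std_asd ?y"
      unfolding vec_eq_iff forall_4 Ric0 r s std_asd_def h_def[symmetric]
      by (simp add: kaehler Ric sum_4 axis_def C algebra_simps) (simp add: field_simps)
    show "form_op (mat 1) R kaehler - Ric0_of (mat 1) R kaehler = sd_part (mat 1) (form_op (mat 1) R kaehler)"
      unfolding vec_eq_iff forall_4 vector_minus_component op Ric0 r s sd_part_def hodge_id star_explicit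
        vector_scaleR_component vector_add_component
      by (simp add: op kaehler Ric sum_4 axis_def C algebra_simps)
  qed
qed

lemma sd_part_linear:
  "sd_part (mat 1) (A - B) = sd_part (mat 1) A - sd_part (mat 1) B"
  "sd_part (mat 1) (c *\<^sub>R A) = c *\<^sub>R sd_part (mat 1) A"
  unfolding vec_eq_iff forall_4 by (simp_all add: sd_part_def star_explicit algebra_simps)

lemma sd_part_two_forms: "A \<in> two_forms \<Longrightarrow> sd_part (mat 1) A \<in> two_forms"
  using star_two_forms[of A] by (simp add: sd_part_def two_forms_def transpose_add transpose_scalar algebra_simps)

lemma star_sd_part: "A \<in> two_forms \<Longrightarrow> star (sd_part (mat 1) A) = sd_part (mat 1) A"
proof -
  assume "A \<in> two_forms"
  moreover have "star (sd_part (mat 1) A) = (1/2) *\<^sub>R (star A + star (star A))"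
    unfolding vec_eq_iff forall_4 by (simp add: sd_part_def star_explicit algebra_simps)
  ultimately show ?thesis by (simp add: star_star sd_part_def add.commute)
qed

text \<open>Evaluating a form on the bivector \<open>x \<and> J x\<close> pairs its self-dual part with the Kaehler form, and its
  anti-self-dual part with the vector \<open>w\<close> below, which is the image of \<open>x\<close> under the Hopf map and has
  length \<open>|x|\<^sup>2\<close>.\<close>

lemma horizontal_contribution_std:
  fixes x :: "real^4"
  assumes R: "curvature_tensor R"
  shows "\<bar>sqrt 2 * (x \<bullet> (form_op (mat 1) R kaehler *v (endo_of_form (mat 1) kaehler *v x)))
            - (x \<bullet> x) * form_inner (mat 1) (Wplus_of (mat 1) R kaehler) kaehler\<bar>
         \<le> (x \<bullet> x) * form_norm (mat 1) (Ric0_of (mat 1) R kaehler)"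
proof -
  define h where "h = 1 / sqrt (2::real)"
  have h: "h * h = 1/2" "sqrt 2 * sqrt 2 = (2::real)" by (simp_all add: h_def)
  obtain y where C: "Ric0_of (mat 1) R kaehler = std_asd y"
    and D: "form_op (mat 1) R kaehler - Ric0_of (mat 1) R kaehler = sd_part (mat 1) (form_op (mat 1) R kaehler)"
    using curvature_decomposition_std[OF R] by blast
  define T where "T = form_op (mat 1) R kaehler"
  have "T \<in> two_forms"
    unfolding two_forms_nth
  proof (intro allI)
    fix i j
    have "(\<Sum>k\<in>UNIV. \<Sum>l\<in>UNIV. R k l j i * kaehler$k$l) = - (\<Sum>k\<in>UNIV. \<Sum>l\<in>UNIV. R k l i j * kaehler$k$l)"
      unfolding sum_negf[symmetric] by (intro sum.cong refl) (simp add: curvature_tensorD(1)[OF R, of _ _ i j])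
    then show "T$j$i = - T$i$j" by (simp add: T_def form_op_def)
  qed
  then have sdT: "sd_part (mat 1) T \<in> two_forms" "star (sd_part (mat 1) T) = sd_part (mat 1) T"
    by (simp_all add: sd_part_two_forms star_sd_part)
  then have "sd_part (mat 1) T \<in> Lambda_plus (mat 1)"
    by (simp add: Lambda_plus_def)
  then obtain b where b: "sd_part (mat 1) T = std_sd b" by (auto simp: Lambda_plus_id)
  have sdf1: "sd_part (mat 1) kaehler = kaehler" by (simp add: sd_part_def kaehler_def star_std_sd flip: scaleR_2)
  have "sd_part (mat 1) (sd_part (mat 1) T) = sd_part (mat 1) T"
    using sdT(2) by (simp add: sd_part_def[of _ "sd_part (mat 1) T"] flip: scaleR_2)
  then have W: "Wplus_of (mat 1) R kaehler = std_sd b"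
    using D unfolding Wplus_of_def T_def[symmetric] sd_part_linear(1)[of "T - Ric0_of (mat 1) R kaehler"]
    by (simp add: sd_part_linear(2) sdf1 flip: b)
  have T: "T = std_sd b + std_asd y" using C D b by (simp add: T_def algebra_simps)
  \<comment> \<open>The image of \<open>x\<close> under the Hopf map, arranged to match \<^const>\<open>std_asd\<close>.\<close>
  define w :: "real^3" where "w = vector [(x$1)\<^sup>2 + (x$2)\<^sup>2 - (x$3)\<^sup>2 - (x$4)\<^sup>2,
      2 * (x$2 * x$3 - x$1 * x$4), 2 * (x$1 * x$3 + x$2 * x$4)]"
  have xx: "x \<bullet> x = (x$1)\<^sup>2 + (x$2)\<^sup>2 + (x$3)\<^sup>2 + (x$4)\<^sup>2"
    by (simp add: inner_vec_def sum_4 power2_eq_square)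
  have "w \<bullet> w = (x \<bullet> x)\<^sup>2"
    unfolding xx by (simp add: w_def inner_vec_def sum_3) algebra
  then have nw: "norm w = x \<bullet> x" by (simp add: norm_eq_sqrt_inner)
  have "sqrt 2 * (x \<bullet> (T *v (endo_of_form (mat 1) kaehler *v x))) = - 2 * (x \<bullet> (T *v (kaehler *v x)))"
  proof -
    have "endo_of_form (mat 1) kaehler *v x = (- sqrt 2) *\<^sub>R (kaehler *v x)"
      unfolding endo_of_form_def matrix_inv_eqI[OF matrix_mul_lid] matrix_mul_lid
      by (rule scaleR_matrix_vector_assoc[symmetric])
    then have "x \<bullet> (T *v (endo_of_form (mat 1) kaehler *v x)) = - sqrt 2 * (x \<bullet> (T *v (kaehler *v x)))"
      by (simp only: matrix_vector_mult_scaleR inner_scaleR_right)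
    then show ?thesis using h by simp
  qed
  also have "\<dots> = 2 * (h * h) * ((x \<bullet> x) * b$1 + y \<bullet> w)"
    unfolding T xx std_sd_def std_asd_def kaehler_def h_def[symmetric]
    by (simp add: inner_vec_def sum_3 sum_4 matrix_vector_mult_def axis_def w_def power2_eq_square algebra_simps)
  finally have "sqrt 2 * (x \<bullet> (T *v (endo_of_form (mat 1) kaehler *v x))) - (x \<bullet> x) * b$1 = y \<bullet> w"
    by (simp add: h)
  moreover have "form_inner (mat 1) (Wplus_of (mat 1) R kaehler) kaehler = b$1"
    unfolding W by (simp add: kaehler_def form_inner_std_sd inner_axis)
  moreover have "form_norm (mat 1) (Ric0_of (mat 1) R kaehler) = norm y"
  proof -
    have "form_inner (mat 1) (std_asd y) (std_asd y) = 2 * (h * h) * (y \<bullet> y)"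
      unfolding form_inner_id std_asd_def h_def[symmetric]
      by (simp add: sum_4 inner_vec_def sum_3 algebra_simps)
    then show ?thesis by (simp add: C form_norm_def h norm_eq_sqrt_inner)
  qed
  moreover have "\<bar>y \<bullet> w\<bar> \<le> (x \<bullet> x) * norm y"
    using Cauchy_Schwarz_ineq2[of y w] by (simp add: nw mult.commute)
  ultimately show ?thesis by (simp add: T_def)
qed

lemma horizontal_contribution:
  fixes x :: "real^4"
  assumes M: "inner_product_matrix M" and A: "A \<in> Lambda_plus M" "form_inner M A A = 1"
    and R: "curvature_tensor R"
  shows "\<bar>sqrt 2 * (x \<bullet> (form_op M R A *v (endo_of_form M A *v x)))
            - (x \<bullet> (M *v x)) * form_inner M (Wplus_of M R A) A\<bar>
         \<le> (x \<bullet> (M *v x)) * form_norm M (Ric0_of M R A)"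
proof -
  obtain P where P: "pull P M = mat 1" "pull P A = kaehler" "det P > 0"
    using adapted_frame_exists[OF M A] by blast
  note inv = invertible_if_pull_id[OF P(1)]
  have fi: "form_inner M X Y = form_inner (mat 1) (pull P X) (pull P Y)" for X Y
    using form_inner_pull[of P M X Y] inv P(1) by simp
  have sym: "transpose M = M" using M by (simp add: inner_product_matrix_def)
  define x' where "x' = matrix_inv P *v x"
  have x: "x = P *v x'" using inv by (simp add: x'_def matrix_vector_mul_assoc matrix_inv_right)
  have q: "(P *v v) \<bullet> (X *v (P *v w)) = v \<bullet> (pull P X *v w)" for X v w
    by (simp add: pull_def dot_lmul_matrix flip: matrix_vector_mul_assoc)
      (metis dot_lmul_matrix inner_commute transpose_matrix_vector transpose_transpose)
  have e: "endo_of_form M A *v (P *v x') = P *v (endo_of_form (mat 1) kaehler *v x')"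
  proof -
    have "matrix_inv M ** A ** P = P ** kaehler"
      by (simp add: matrix_inv_frame[OF P(1)] pull_def matrix_mul_assoc flip: P(2))
    then show ?thesis
      by (simp add: endo_of_form_def matrix_vector_mul_assoc matrix_inv_eqI mmul.minus_left mmul.minus_right
          mmul.scaleR_left mmul.scaleR_right)
  qed
  show ?thesis
    using horizontal_contribution_std[OF curvature_tensor_pull[OF R], of x' P]
    unfolding x e q form_op_pull[OF P(1)] P(2) form_norm_def fi Ric0_of_pull[OF sym P(1)]
      Wplus_of_pull[OF sym P(1,3)]
    by (simp add: P)
qed

section \<open>Definiteness and determinants on self-dual forms\<close>

lemma form_inner_nonneg:
  assumes "inner_product_matrix M" shows "form_inner M A A \<ge> 0"
proof -
  obtain P where P: "pull P M = mat 1" using orthonormal_frame_exists[OF assms] by blast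
  have eq: "form_inner M A A = form_inner (mat 1) (pull P A) (pull P A)"
    using form_inner_pull[of P M A A] invertible_if_pull_id[OF P] P by simp
  show ?thesis unfolding eq form_inner_id by (auto intro!: sum_nonneg)
qed

text \<open>On the segment from the identity to \<open>T\<close> the quadratic form stays positive definite, so the determinant does
  not vanish.\<close>

lemma det_pos_if_positive_definite:
  fixes T :: "real^'n^'n"
  assumes "\<And>y. y \<noteq> 0 \<Longrightarrow> y \<bullet> (T *v y) > 0"
  shows "det T > 0"
proof (rule ccontr)
  assume neg: "\<not> det T > 0"
  define p where "p t = det ((1 - t) *\<^sub>R mat 1 + t *\<^sub>R T)" for t :: real
  have "continuous_on {0..1} p"
    unfolding p_def det_def by (intro continuous_intros)
  moreover have "p 0 = 1" "p 1 = det T" by (simp_all add: p_def)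
  ultimately obtain t where t: "0 \<le> t" "t \<le> 1" "p t = 0"
    using IVT2'[of p 1 0 0] neg by auto
  have "\<not> invertible ((1 - t) *\<^sub>R mat 1 + t *\<^sub>R T)" using t(3) by (simp add: p_def invertible_det_nz)
  then obtain y where y: "y \<noteq> 0" "((1 - t) *\<^sub>R mat 1 + t *\<^sub>R T) *v y = 0"
    unfolding invertible_left_inverse matrix_left_invertible_ker by blast
  have "((1 - t) *\<^sub>R mat 1 + t *\<^sub>R T) *v y = (1 - t) *\<^sub>R y + t *\<^sub>R (T *v y)"
    by (simp add: matrix_vector_mult_add_rdistrib scaleR_matrix_vector_assoc[symmetric])
  then have "y \<bullet> ((1 - t) *\<^sub>R y + t *\<^sub>R (T *v y)) = 0" using y(2) by simp
  then have "(1 - t) * (y \<bullet> y) + t * (y \<bullet> (T *v y)) = 0"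
    by (simp add: inner_add_right)
  moreover have "y \<bullet> y > 0" "y \<bullet> (T *v y) > 0" using y(1) assms by auto
  moreover have "(1 - t) * (y \<bullet> y) \<ge> 0" "t * (y \<bullet> (T *v y)) \<ge> 0"
    using calculation(2,3) t by auto
  ultimately have "(1 - t) * (y \<bullet> y) = 0" "t * (y \<bullet> (T *v y)) = 0" by linarith+
  with \<open>y \<bullet> y > 0\<close> \<open>y \<bullet> (T *v y) > 0\<close> have "1 - t = 0" "t = 0"
    unfolding mult_eq_0_iff by linarith+
  then show False by simp
qed

text \<open>This transports connectedness of the round sphere to the unit sphere of \<open>\<Lambda>\<^sup>+\<close>.\<close>

lemma self_dual_parametrisation:
  assumes "inner_product_matrix M"
  obtains \<phi> :: "real^3 \<Rightarrow> real^4^4" where "linear \<phi>" "Lambda_plus M = range \<phi>"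
    "\<And>y z. form_inner M (\<phi> y) (\<phi> z) = y \<bullet> z"
proof -
  obtain P where P: "pull P M = mat 1" "det P > 0" using orthonormal_frame_exists[OF assms] by blast
  note inv = invertible_if_pull_id[OF P(1)]
  define Q where "Q = matrix_inv P"
  have QP: "pull P (pull Q A) = A" "pull Q (pull P A) = A" for A
    using inv by (simp_all add: Q_def pull_pull matrix_inv_left matrix_inv_right)
  show thesis
  proof (rule that[of "\<lambda>y. pull Q (std_sd y)"])
    show "linear (\<lambda>y. pull Q (std_sd y))"
      by (rule linearI) (simp_all add: std_sd_linear pull_simps)
    show "Lambda_plus M = range (\<lambda>y. pull Q (std_sd y))"
    proof (rule set_eqI)
      fix A
      have "A \<in> Lambda_plus M \<longleftrightarrow> pull P A \<in> range std_sd"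
        using pull_Lambda_plus[of P M A] inv P by (simp add: Lambda_plus_id)
      also have "\<dots> \<longleftrightarrow> A \<in> range (\<lambda>y. pull Q (std_sd y))"
      proof
        assume "pull P A \<in> range std_sd"
        then obtain y where "pull P A = std_sd y" by blast
        then have "A = pull Q (std_sd y)" using QP(2)[of A] by simp
        then show "A \<in> range (\<lambda>y. pull Q (std_sd y))" by blast
      qed (use QP(1) in auto)
      finally show "A \<in> Lambda_plus M \<longleftrightarrow> A \<in> range (\<lambda>y. pull Q (std_sd y))" .
    qed
    show "form_inner M (pull Q (std_sd y)) (pull Q (std_sd z)) = y \<bullet> z" for y z
      using form_inner_pull[of P M "pull Q (std_sd y)" "pull Q (std_sd z)"] inv
      by (simp add: P QP form_inner_std_sd)
  qed
qed

lemma nonvanishing_form_sign: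
  assumes M: "inner_product_matrix M" and W: "linear W"
    and nz: "\<And>v. v \<in> Lambda_plus M \<Longrightarrow> form_inner M v v = 1 \<Longrightarrow> form_inner M (W v) v \<noteq> 0"
  shows "(\<forall>v\<in>Lambda_plus M. form_inner M v v = 1 \<longrightarrow> form_inner M (W v) v > 0) \<or>
         (\<forall>v\<in>Lambda_plus M. form_inner M v v = 1 \<longrightarrow> form_inner M (W v) v < 0)"
proof -
  obtain \<phi> :: "real^3 \<Rightarrow> real^4^4" where \<phi>: "linear \<phi>" "Lambda_plus M = range \<phi>"
    "\<And>y z. form_inner M (\<phi> y) (\<phi> z) = y \<bullet> z"
    using self_dual_parametrisation[OF M] by blast
  define q where "q y = form_inner M (W (\<phi> y)) (\<phi> y)" for y
  have lin: "bounded_linear \<phi>" "bounded_linear (\<lambda>y. W (\<phi> y))"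
    using \<phi>(1) linear_compose[OF \<phi>(1) W] by (simp_all add: linear_conv_bounded_linear o_def)
  have "continuous_on (sphere 0 1) q"
    unfolding q_def by (intro finner.continuous_on linear_continuous_on lin)
  moreover have "connected (sphere (0::real^3) 1)" by (rule connected_sphere) simp
  ultimately have conn: "connected (q ` sphere 0 1)" by (rule connected_continuous_image)
  have sph: "y \<in> sphere 0 1 \<longleftrightarrow> form_inner M (\<phi> y) (\<phi> y) = 1" for y
    by (simp add: \<phi>(3) norm_eq_sqrt_inner)
  have "0 \<notin> q ` sphere 0 1"
    using nz \<phi>(2) sph by (force simp: q_def)
  have "(\<forall>t \<in> q ` sphere 0 1. t > 0) \<or> (\<forall>t \<in> q ` sphere 0 1. t < 0)"
  proof (rule ccontr)
    assume "\<not> ?thesis"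
    then obtain a b where "a \<in> q ` sphere 0 1" "b \<in> q ` sphere 0 1" "a \<le> 0" "0 \<le> b"
      by (auto simp: not_less)
    then have "0 \<in> q ` sphere 0 1" using conn unfolding connected_iff_interval by blast
    with \<open>0 \<notin> q ` sphere 0 1\<close> show False by blast
  qed
  then show ?thesis
    unfolding \<phi>(2) by (auto simp: q_def sph[symmetric])
qed

text \<open>By connectedness the quadratic form of \<open>W\<close> is definite.  In dimension three the determinant of a negative
  definite form is negative.\<close>

lemma form_determinant_sign:
  assumes M: "inner_product_matrix M" and W: "linear W"
    and nz: "\<And>v. v \<in> Lambda_plus M \<Longrightarrow> form_inner M v v = 1 \<Longrightarrow> form_inner M (W v) v \<noteq> 0"
    and v: "v \<in> Lambda_plus M" "form_inner M v v = 1"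
  shows "sgn (form_inner M (W v) v) = sgn (det_plus M W)"
proof -
  interpret W: linear W by (rule W)
  obtain \<phi> :: "real^3 \<Rightarrow> real^4^4" where \<phi>: "linear \<phi>" "Lambda_plus M = range \<phi>"
    "\<And>y z. form_inner M (\<phi> y) (\<phi> z) = y \<bullet> z"
    using self_dual_parametrisation[OF M] by blast
  interpret phi: linear \<phi> by (rule \<phi>(1))
  have "orthonormal_basis_plus M (\<lambda>i. \<phi> (axis i 1))"
    by (simp add: orthonormal_basis_plus_def \<phi> inner_axis_axis)
  define f where "f = (SOME f. orthonormal_basis_plus M f)"
  have f: "orthonormal_basis_plus M f"
    unfolding f_def by (rule someI[of "orthonormal_basis_plus M"]) fact
  define T :: "real^3^3" where "T = (\<chi> i j. form_inner M (f i) (W (f j)))"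
  have det: "det_plus M W = det T" by (simp add: det_plus_def Let_def T_def f_def)
  have sym: "form_inner M a b = form_inner M b a" for a b
    using M by (intro form_inner_commute) (simp_all add: inner_product_matrix_def inner_product_matrix_invertible)
  define c where "c y = (\<Sum>i\<in>UNIV. y$i *\<^sub>R f i)" for y :: "real^3"
  obtain e where e: "\<And>i. f i = \<phi> (e i)"
  proof -
    have "\<forall>i. \<exists>y. f i = \<phi> y" using f unfolding orthonormal_basis_plus_def \<phi>(2) by blast
    then show thesis using that by metis
  qed
  have c\<phi>: "c y = \<phi> (\<Sum>i\<in>UNIV. y$i *\<^sub>R e i)" for y
    by (simp add: c_def e phi.sum phi.scale)
  have cin: "c y \<in> Lambda_plus M" for y by (simp add: c\<phi> \<phi>(2))
  have cc: "form_inner M (c y) (c y) = y \<bullet> y" for y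
  proof -
    have "form_inner M (c y) (c y) = (\<Sum>i\<in>UNIV. \<Sum>j\<in>UNIV. y$i * (y$j * form_inner M (f i) (f j)))"
      by (simp add: c_def finner.sum_left finner.sum_right finner.scaleR_left finner.scaleR_right sum_distrib_left)
        (intro sum.cong refl arg_cong2[where f="(*)"] sym)
    also have "\<dots> = y \<bullet> y"
    proof -
      have on: "form_inner M (f i) (f j) = (if i = j then 1 else 0)" for i j
        using f by (simp add: orthonormal_basis_plus_def)
      show ?thesis by (simp add: on inner_vec_def if_distrib cong: if_cong)
    qed
    finally show ?thesis .
  qed
  have T: "y \<bullet> (T *v y) = form_inner M (c y) (W (c y))" for y
    by (simp add: c_def T_def W.sum W.scale finner.sum_left finner.sum_right finner.scaleR_left
        finner.scaleR_right inner_vec_def matrix_vector_mult_def sum_distrib_left mult_ac)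
      (rule trans[OF sum.swap], simp add: mult_ac)
  have T1: "y \<bullet> (T *v y) = (y \<bullet> y) * form_inner M (W u) u" "u \<in> Lambda_plus M" "form_inner M u u = 1"
    if "y \<noteq> 0" "u = (1 / norm y) *\<^sub>R c y" for y u
  proof -
    have "c y = norm y *\<^sub>R u" using that by simp
    moreover have "form_inner M (c y) (W (c y)) = form_inner M (W (c y)) (c y)" by (rule sym)
    ultimately show "y \<bullet> (T *v y) = (y \<bullet> y) * form_inner M (W u) u"
      by (simp add: T W.scale finner.scaleR_left finner.scaleR_right dot_square_norm power2_eq_square)
    show "u \<in> Lambda_plus M"
      unfolding that(2) c\<phi> \<phi>(2) by (simp flip: phi.scale)
    show "form_inner M u u = 1"
      using that(1) by (simp add: that(2) finner.scaleR_left finner.scaleR_right cc dot_square_norm power2_eq_square)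
  qed
  consider (pos) "\<forall>v\<in>Lambda_plus M. form_inner M v v = 1 \<longrightarrow> form_inner M (W v) v > 0"
    | (neg) "\<forall>v\<in>Lambda_plus M. form_inner M v v = 1 \<longrightarrow> form_inner M (W v) v < 0"
    using nonvanishing_form_sign[OF M W] nz by blast
  then show ?thesis
  proof cases
    case pos
    have "det T > 0"
      by (rule det_pos_if_positive_definite) (use T1 pos in force)
    then show ?thesis using pos v det by simp
  next
    case neg
    have "det (- T) > 0"
    proof (rule det_pos_if_positive_definite)
      fix y :: "real^3" assume y: "y \<noteq> 0"
      have "y \<bullet> ((- T) *v y) = - (y \<bullet> (T *v y))"
        by (simp add: inner_vec_def matrix_vector_mult_def sum_negf)
      moreover have "y \<bullet> (T *v y) < 0" using T1[OF y refl] neg y by (simp add: mult_pos_neg)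
      ultimately show "y \<bullet> ((- T) *v y) > 0" by simp
    qed
    moreover have "det (- T) = - det T" by (simp add: det_3)
    ultimately show ?thesis using neg v det by simp
  qed
qed

section \<open>Calculus of smooth maps\<close>

abbreviation has_velocity :: "(real \<Rightarrow> 'a::real_normed_vector) \<Rightarrow> 'a \<Rightarrow> bool" (infix "has'_velocity" 50)
  where "\<gamma> has_velocity v \<equiv> (\<gamma> has_vector_derivative v) (at 0)"

abbreviation "FD f x \<equiv> frechet_derivative f (at x)"

lemma frechet_derivative_eqI: "(f has_derivative f') (at x) \<Longrightarrow> FD f x = f'"
  using frechet_derivative_at by metis

lemma frechet_derivative_has: "f differentiable (at x) \<Longrightarrow> (f has_derivative FD f x) (at x)"
  by (simp add: frechet_derivative_works)

lemma has_vector_derivative_compose: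
  assumes "(c has_vector_derivative v) (at t)" "(f has_derivative D) (at (c t))"
  shows "((\<lambda>t. f (c t)) has_vector_derivative D v) (at t)"
proof -
  have "((\<lambda>t. f (c t)) has_derivative (\<lambda>r. D (r *\<^sub>R v))) (at t)"
    using has_derivative_compose[of c] assms unfolding has_vector_derivative_def by blast
  then show ?thesis
    using linear_scale[OF has_derivative_linear[OF assms(2)]] by (simp add: has_vector_derivative_def)
qed

lemma has_vector_derivative_transform_eventually:
  assumes "f has_velocity v" "\<forall>\<^sub>F t in nhds 0. f t = g t"
  shows "g has_velocity v"
proof -
  have "g 0 = f 0" using assms(2) eventually_nhds_x_imp_x by force
  moreover have "\<forall>\<^sub>F t in at 0. f t = g t"
    using assms(2) by (auto simp: eventually_at_filter elim: eventually_mono)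
  ultimately show ?thesis
    using assms(1) has_derivative_transform_eventually[of f _ 0 UNIV g]
    unfolding has_vector_derivative_def by simp
qed

lemma Ck_on_Suc_imp: "Ck_on (Suc k) f S \<Longrightarrow> Ck_on k f S"
proof (induction k arbitrary: f)
  case 0
  then show ?case
    by (auto intro!: differentiable_imp_continuous_on differentiable_at_imp_differentiable_on)
next
  case (Suc k)
  then show ?case by (auto simp del: Ck_on.simps(2) simp: Ck_on.simps(2)[of "Suc k"] Ck_on.simps(2)[of k])
qed

lemma Ck_on_cong:
  assumes "open S" "Ck_on k f S" "\<And>x. x \<in> S \<Longrightarrow> f x = g x"
  shows "Ck_on k g S"
  using assms(2,3)
proof (induction k arbitrary: f g)
  case 0
  then show ?case using continuous_on_cong by (metis Ck_on.simps(1))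
next
  case (Suc k)
  have d: "(g has_derivative FD f x) (at x)" if "x \<in> S" for x
    using has_derivative_transform_within_open[OF frechet_derivative_has assms(1) that Suc.prems(2)]
      Suc.prems(1) that by simp
  then have "FD g x = FD f x" if "x \<in> S" for x
    using frechet_derivative_eqI that by blast
  then have "Ck_on k (\<lambda>x. FD g x v) S" for v
    using Suc.IH[of "\<lambda>x. FD f x v" "\<lambda>x. FD g x v"] Suc.prems(1) by simp
  then show ?case using d unfolding Ck_on.simps by (blast intro: differentiableI)
qed

text \<open>Higher differentiability of a composite follows by induction once its derivative is again of a known form; several
  of the closure properties below are proved in this way.\<close>

lemma Ck_on_SucI:
  assumes "open S" "\<And>x. x \<in> S \<Longrightarrow> (f has_derivative f' x) (at x)" "\<And>v. Ck_on k (\<lambda>x. f' x v) S"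
  shows "Ck_on (Suc k) f S"
proof -
  have "Ck_on k (\<lambda>x. FD f x v) S" for v
    by (rule Ck_on_cong[OF assms(1,3)]) (simp add: frechet_derivative_eqI[OF assms(2)])
  then show ?thesis using assms(2) unfolding Ck_on.simps by (blast intro: differentiableI)
qed

lemma Ck_on_const: "Ck_on k (\<lambda>x. c) S"
  by (induction k arbitrary: c) auto

lemma Ck_on_bounded_linear:
  assumes "bounded_linear L" "open S" "Ck_on k f S"
  shows "Ck_on k (\<lambda>x. L (f x)) S"
  using assms(3)
proof (induction k arbitrary: f)
  case 0
  then show ?case using bounded_linear.continuous_on[OF assms(1)] by auto
next
  case (Suc k)
  show ?case
  proof (rule Ck_on_SucI[OF assms(2)])
    show "((\<lambda>x. L (f x)) has_derivative (\<lambda>v. L (FD f x v))) (at x)" if "x \<in> S" for x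
      using Suc.prems that by (intro bounded_linear.has_derivative[OF assms(1)] frechet_derivative_has) simp
  qed (use Suc in auto)
qed

lemma Ck_on_add:
  assumes "open S" "Ck_on k f S" "Ck_on k g S"
  shows "Ck_on k (\<lambda>x. f x + g x) S"
  using assms(2,3)
proof (induction k arbitrary: f g)
  case 0
  then show ?case by (auto intro: continuous_intros)
next
  case (Suc k)
  show ?case
  proof (rule Ck_on_SucI[OF assms(1)])
    show "((\<lambda>x. f x + g x) has_derivative (\<lambda>v. FD f x v + FD g x v)) (at x)"
      if "x \<in> S" for x
      using Suc.prems that by (intro has_derivative_add frechet_derivative_has) auto
  qed (use Suc in auto)
qed

lemma Ck_on_bilinear:
  assumes "bounded_bilinear B" "open S" "Ck_on k f S" "Ck_on k g S"
  shows "Ck_on k (\<lambda>x. B (f x) (g x)) S"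
  using assms(3,4)
proof (induction k arbitrary: f g)
  case 0
  then show ?case using bounded_bilinear.continuous_on[OF assms(1)] by auto
next
  case (Suc k)
  show ?case
  proof (rule Ck_on_SucI[OF assms(2)])
    show "((\<lambda>x. B (f x) (g x)) has_derivative
        (\<lambda>v. B (f x) (FD g x v) + B (FD f x v) (g x))) (at x)"
      if "x \<in> S" for x
      using Suc.prems that by (intro bounded_bilinear.FDERIV[OF assms(1)] frechet_derivative_has) auto
    show "Ck_on k (\<lambda>x. B (f x) (FD g x v) + B (FD f x v) (g x)) S" for v
      using Suc.prems Ck_on_Suc_imp[OF Suc.prems(1)] Ck_on_Suc_imp[OF Suc.prems(2)]
      by (intro Ck_on_add[OF assms(2)] Suc.IH) auto
  qed
qed

lemma Ck_on_sum:
  assumes "open S" "\<And>i. i \<in> I \<Longrightarrow> Ck_on k (f i) S"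
  shows "Ck_on k (\<lambda>x. \<Sum>i\<in>I. f i x) S"
  using assms(2) by (induction I rule: infinite_finite_induct) (auto intro!: Ck_on_const Ck_on_add[OF assms(1)])

lemma Ck_on_prod:
  fixes f :: "'i \<Rightarrow> 'a::real_normed_vector \<Rightarrow> real"
  assumes "open S" "\<And>i. i \<in> I \<Longrightarrow> Ck_on k (f i) S"
  shows "Ck_on k (\<lambda>x. \<Prod>i\<in>I. f i x) S"
  using assms(2) by (induction I rule: infinite_finite_induct)
    (auto intro!: Ck_on_const Ck_on_bilinear[OF bounded_bilinear_mult assms(1)])

lemma Ck_on_compose_linear:
  assumes "bounded_linear L" "open S" "open T" "L ` T \<subseteq> S" "Ck_on k f S"
  shows "Ck_on k (\<lambda>x. f (L x)) T"
  using assms(5)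
proof (induction k arbitrary: f)
  case 0
  have "continuous_on T L" by (rule linear_continuous_on[OF assms(1)])
  then show ?case using 0 continuous_on_compose2[of S f T L] assms(4) by auto
next
  case (Suc k)
  show ?case
  proof (rule Ck_on_SucI[OF assms(3)])
    show "((\<lambda>x. f (L x)) has_derivative (\<lambda>v. FD f (L x) (L v))) (at x)" if "x \<in> T" for x
    proof -
      have "L x \<in> S" using that assms(4) by blast
      then have "(f has_derivative FD f (L x)) (at (L x))"
        using Suc.prems by (intro frechet_derivative_has) simp
      from has_derivative_compose[OF bounded_linear_imp_has_derivative[OF assms(1)] this] show ?thesis .
    qed
  qed (use Suc in auto)
qed

lemma Ck_on_inverse:
  fixes f :: "'a::real_normed_vector \<Rightarrow> real"
  assumes "open S" "Ck_on k f S" "\<And>x. x \<in> S \<Longrightarrow> f x \<noteq> 0"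
  shows "Ck_on k (\<lambda>x. inverse (f x)) S"
  using assms(2)
proof (induction k)
  case 0
  then show ?case using assms(3) by (auto intro!: continuous_intros)
next
  case (Suc k)
  note mult = Ck_on_bilinear[OF bounded_bilinear_mult assms(1)]
  show ?case
  proof (rule Ck_on_SucI[OF assms(1)])
    show "((\<lambda>x. inverse (f x)) has_derivative
        (\<lambda>v. - 1 * (inverse (f x) * (FD f x v * inverse (f x))))) (at x)" if "x \<in> S" for x
      using Suc.prems that assms(3)[OF that]
      by (auto intro!: derivative_eq_intros frechet_derivative_has simp: mult_ac)
    show "Ck_on k (\<lambda>x. - 1 * (inverse (f x) * (FD f x v * inverse (f x)))) S" for v
      using Suc Ck_on_Suc_imp[OF Suc.prems] by (intro mult Ck_on_const) auto
  qed
qed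

lemma Ck_on_sqrt:
  fixes f :: "'a::real_normed_vector \<Rightarrow> real"
  assumes "open S" "Ck_on k f S" "\<And>x. x \<in> S \<Longrightarrow> f x > 0"
  shows "Ck_on k (\<lambda>x. sqrt (f x)) S"
  using assms(2)
proof (induction k)
  case 0
  then show ?case by (auto intro!: continuous_intros)
next
  case (Suc k)
  note mult = Ck_on_bilinear[OF bounded_bilinear_mult assms(1)]
  show ?case
  proof (rule Ck_on_SucI[OF assms(1)])
    show "((\<lambda>x. sqrt (f x)) has_derivative
        (\<lambda>v. (1/2) * (FD f x v * inverse (sqrt (f x))))) (at x)" if "x \<in> S" for x
      using Suc.prems that assms(3)[OF that]
      by (auto intro!: derivative_eq_intros frechet_derivative_has simp: field_simps)
    have "Ck_on k (\<lambda>x. inverse (sqrt (f x))) S"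
      using assms(3) Suc.IH Ck_on_Suc_imp[OF Suc.prems] by (intro Ck_on_inverse[OF assms(1)]) force+
    then show "Ck_on k (\<lambda>x. (1/2) * (FD f x v * inverse (sqrt (f x)))) S" for v
      using Suc.prems by (intro mult Ck_on_const) auto
  qed
qed

lemma bounded_linear_axis: "bounded_linear (axis i :: 'b::euclidean_space \<Rightarrow> 'b^'n)"
  by (rule linear_conv_bounded_linear[THEN iffD1], rule linearI) (auto simp: axis_def vec_eq_iff)

lemma Ck_on_vec:
  fixes f :: "'a::real_normed_vector \<Rightarrow> 'b::euclidean_space^'n"
  assumes "open S" "\<And>i. Ck_on k (\<lambda>x. f x $ i) S"
  shows "Ck_on k f S"
proof -
  have "f = (\<lambda>x. \<Sum>i\<in>UNIV. axis i (f x $ i))"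
    by (auto simp: fun_eq_iff vec_eq_iff axis_def if_distrib cong: if_cong)
  moreover have "Ck_on k (\<lambda>x. \<Sum>i\<in>UNIV. axis i (f x $ i)) S"
    by (intro Ck_on_sum[OF assms(1)] Ck_on_bounded_linear[OF bounded_linear_axis assms(1)] assms(2))
  ultimately show ?thesis by simp
qed

lemma Ck_on_nth: "open S \<Longrightarrow> Ck_on k f S \<Longrightarrow> Ck_on k (\<lambda>x. f x $ i) S"
  by (rule Ck_on_bounded_linear[OF bounded_linear_vec_nth])

lemma Ck_on_fst: "open S \<Longrightarrow> Ck_on k (fst :: 'a::real_normed_vector \<times> 'b::real_normed_vector \<Rightarrow> 'a) S"
  and Ck_on_snd: "open S \<Longrightarrow> Ck_on k (snd :: 'a \<times> 'b \<Rightarrow> 'b) S"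
proof -
  have "Ck_on k (\<lambda>x. x) S" if "open S" for S :: "('a \<times> 'b) set"
  proof (cases k)
    case (Suc n)
    then show ?thesis by (auto intro!: Ck_on_SucI[OF that, of _ "\<lambda>x v. v"] Ck_on_const simp del: Ck_on.simps)
  qed simp
  then show "open S \<Longrightarrow> Ck_on k (fst :: 'a \<times> 'b \<Rightarrow> 'a) S" "open S \<Longrightarrow> Ck_on k (snd :: 'a \<times> 'b \<Rightarrow> 'b) S"
    using Ck_on_bounded_linear[OF bounded_linear_fst, of S k "\<lambda>x. x"]
      Ck_on_bounded_linear[OF bounded_linear_snd, of S k "\<lambda>x. x"] by auto
qed

lemma Ck_on_Pair:
  assumes "open S" "Ck_on k f S" "Ck_on k g S"
  shows "Ck_on k (\<lambda>x. (f x, g x)) S"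
proof -
  have "Ck_on k (\<lambda>x. (f x, 0) + (0, g x)) S"
    using Ck_on_bounded_linear[OF bounded_linear_Pair[OF bounded_linear_ident bounded_linear_zero] assms(1,2)]
      Ck_on_bounded_linear[OF bounded_linear_Pair[OF bounded_linear_zero bounded_linear_ident] assms(1,3)]
    by (rule Ck_on_add[OF assms(1)])
  then show ?thesis by simp
qed

lemma Ck_on_det:
  fixes f :: "'a::real_normed_vector \<Rightarrow> real^'n^'n"
  assumes "open S" "\<And>i j. Ck_on k (\<lambda>x. f x $ i $ j) S"
  shows "Ck_on k (\<lambda>x. det (f x)) S"
  unfolding det_def
  by (intro Ck_on_sum[OF assms(1)] Ck_on_bilinear[OF bounded_bilinear_mult assms(1)] Ck_on_const
      Ck_on_prod[OF assms(1)] assms(2))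

text \<open>Cramer's rule makes the inverse a rational function of the entries, hence smooth.\<close>

lemma matrix_inv_cramer:
  fixes A :: "real^'n^'n"
  assumes "det A \<noteq> 0"
  shows "matrix_inv A $ i $ j = det (\<chi> a b. if b = i then axis j 1 $ a else A $ a $ b) * inverse (det A)"
proof -
  have "A ** matrix_inv A = mat 1" using assms by (simp add: matrix_inv_right invertible_det_nz)
  then have "A *v (column j (matrix_inv A)) = axis j 1"
    by (simp add: vec_eq_iff matrix_vector_mult_def column_def axis_def mat_def matrix_matrix_mult_def)
  then have "column j (matrix_inv A) = (\<chi> k. det (\<chi> a b. if b = k then axis j 1 $ a else A $ a $ b) / det A)"
    using cramer[OF assms] by blast
  then show ?thesis by (simp add: vec_eq_iff column_def field_simps)
qed

lemma Ck_on_matrix_inv: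
  fixes f :: "'a::real_normed_vector \<Rightarrow> real^'n^'n"
  assumes "open S" "Ck_on k f S" "\<And>x. x \<in> S \<Longrightarrow> invertible (f x)"
  shows "Ck_on k (\<lambda>x. matrix_inv (f x)) S"
proof (intro Ck_on_vec[OF assms(1)])
  fix i j
  have f: "Ck_on k (\<lambda>x. f x $ a $ b) S" for a b
    by (intro Ck_on_nth assms)
  have nz: "det (f x) \<noteq> 0" if "x \<in> S" for x using assms(3)[OF that] by (simp add: invertible_det_nz)
  have "Ck_on k (\<lambda>x. det (\<chi> a b. if b = i then axis j 1 $ a else f x $ a $ b) * inverse (det (f x))) S"
  proof (intro Ck_on_bilinear[OF bounded_bilinear_mult assms(1)] Ck_on_det[OF assms(1)]
      Ck_on_inverse[OF assms(1)] f)
    show "Ck_on k (\<lambda>x. (\<chi> a b. if b = i then axis j 1 $ a else f x $ a $ b) $ a $ b) S" for a b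
      by (cases "b = i") (simp_all add: Ck_on_const f)
  qed (use nz in auto)
  then show "Ck_on k (\<lambda>x. matrix_inv (f x) $ i $ j) S"
    by (rule Ck_on_cong[OF assms(1)]) (simp add: matrix_inv_cramer nz)
qed

section \<open>Symmetry of second derivatives\<close>

text \<open>Two applications of the mean value theorem, first in the direction \<open>u\<close> and then in the direction \<open>v\<close>.  The
  left-hand side is symmetric in \<open>u\<close> and \<open>v\<close>, which gives the symmetry of the second derivative in the limit
  \<open>h \<rightarrow> 0\<close>.\<close>

lemma second_difference:
  fixes f :: "'a::real_normed_vector \<Rightarrow> real"
  assumes "open S" and C: "Ck_on 2 f S" and e: "e > 0" "ball x e \<subseteq> S"
    and h: "h > 0" "h * (norm u + norm v) < e"
  obtains y where "dist y x \<le> h * (norm u + norm v)"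
    "f (x + h *\<^sub>R u + h *\<^sub>R v) - f (x + h *\<^sub>R u) - f (x + h *\<^sub>R v) + f x
       = h\<^sup>2 * FD (\<lambda>w. FD f w u) y v"
proof -
  have inS: "x + s *\<^sub>R u + t *\<^sub>R v \<in> S" if "0 \<le> s" "s \<le> h" "0 \<le> t" "t \<le> h" for s t
  proof -
    have "norm (s *\<^sub>R u + t *\<^sub>R v) \<le> s * norm u + t * norm v"
      using norm_triangle_ineq[of "s *\<^sub>R u" "t *\<^sub>R v"] that by simp
    also have "\<dots> \<le> h * norm u + h * norm v"
      using that by (intro add_mono mult_right_mono) auto
    finally have "norm (s *\<^sub>R u + t *\<^sub>R v) < e" using h by (simp add: distrib_left)
    then have "dist (x + s *\<^sub>R u + t *\<^sub>R v) x < e"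
      by (simp add: dist_norm add.assoc)
    then have "x + s *\<^sub>R u + t *\<^sub>R v \<in> ball x e"
      by (simp add: dist_commute)
    then show ?thesis using e by blast
  qed
  define D where "D w = FD f w" for w
  have D: "(f has_derivative D w) (at w)" if "w \<in> S" for w
    using C that unfolding D_def by (intro frechet_derivative_has) (simp add: numeral_2_eq_2)
  have DD: "((\<lambda>w. D w u) has_derivative FD (\<lambda>w. D w u) w) (at w)" if "w \<in> S" for w
    using C that unfolding D_def by (intro frechet_derivative_has) (simp add: numeral_2_eq_2)
  define p where "p s = f (x + s *\<^sub>R u + h *\<^sub>R v) - f (x + s *\<^sub>R u + 0 *\<^sub>R v)" for s
  have "\<exists>\<xi>. \<xi> > 0 \<and> \<xi> < h \<and> p h - p 0 = (h - 0) * (D (x + \<xi> *\<^sub>R u + h *\<^sub>R v) u - D (x + \<xi> *\<^sub>R u + 0 *\<^sub>R v) u)"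
  proof (rule MVT2[OF h(1)])
    fix s assume s: "0 \<le> s" "s \<le> h"
    have d: "((\<lambda>s. f (x + s *\<^sub>R u + t *\<^sub>R v)) has_real_derivative D (x + s *\<^sub>R u + t *\<^sub>R v) u) (at s)"
      if "0 \<le> t" "t \<le> h" for t
      unfolding has_real_derivative_iff_has_vector_derivative
      by (rule has_vector_derivative_compose[where c="\<lambda>s. x + s *\<^sub>R u + t *\<^sub>R v", OF _ D[OF inS[OF s that]]]) (auto intro!: derivative_eq_intros)
    show "(p has_real_derivative D (x + s *\<^sub>R u + h *\<^sub>R v) u - D (x + s *\<^sub>R u + 0 *\<^sub>R v) u) (at s)"
      unfolding p_def using h(1) by (intro DERIV_diff d) auto
  qed
  then obtain \<xi> where \<xi>: "0 < \<xi>" "\<xi> < h"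
    "p h - p 0 = h * (D (x + \<xi> *\<^sub>R u + h *\<^sub>R v) u - D (x + \<xi> *\<^sub>R u + 0 *\<^sub>R v) u)" by auto
  have "\<exists>\<eta>. \<eta> > 0 \<and> \<eta> < h \<and> D (x + \<xi> *\<^sub>R u + h *\<^sub>R v) u - D (x + \<xi> *\<^sub>R u + 0 *\<^sub>R v) u
       = (h - 0) * FD (\<lambda>w. D w u) (x + \<xi> *\<^sub>R u + \<eta> *\<^sub>R v) v"
  proof (rule MVT2[OF h(1)])
    fix t assume t: "0 \<le> t" "t \<le> h"
    let ?w = "x + \<xi> *\<^sub>R u + t *\<^sub>R v"
    have w: "?w \<in> S" using \<xi> t by (intro inS) auto
    show "((\<lambda>t. D (x + \<xi> *\<^sub>R u + t *\<^sub>R v) u) has_real_derivative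
        FD (\<lambda>w. D w u) ?w v) (at t)"
      unfolding has_real_derivative_iff_has_vector_derivative
      by (rule has_vector_derivative_compose[where c="\<lambda>t. x + \<xi> *\<^sub>R u + t *\<^sub>R v", OF _ DD[OF w]]) (auto intro!: derivative_eq_intros)
  qed
  then obtain \<eta> where \<eta>: "0 < \<eta>" "\<eta> < h" "D (x + \<xi> *\<^sub>R u + h *\<^sub>R v) u - D (x + \<xi> *\<^sub>R u + 0 *\<^sub>R v) u
       = h * FD (\<lambda>w. D w u) (x + \<xi> *\<^sub>R u + \<eta> *\<^sub>R v) v" by auto
  show thesis
  proof (rule that[of "x + \<xi> *\<^sub>R u + \<eta> *\<^sub>R v"])
    have "norm (\<xi> *\<^sub>R u + \<eta> *\<^sub>R v) \<le> \<xi> * norm u + \<eta> * norm v"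
      using norm_triangle_ineq[of "\<xi> *\<^sub>R u" "\<eta> *\<^sub>R v"] \<xi> \<eta> by simp
    also have "\<dots> \<le> h * norm u + h * norm v"
      using \<xi> \<eta> by (intro add_mono mult_right_mono) auto
    finally show "dist (x + \<xi> *\<^sub>R u + \<eta> *\<^sub>R v) x \<le> h * (norm u + norm v)"
      by (simp add: dist_norm add.assoc distrib_left)
    show "f (x + h *\<^sub>R u + h *\<^sub>R v) - f (x + h *\<^sub>R u) - f (x + h *\<^sub>R v) + f x
       = h\<^sup>2 * FD (\<lambda>w. FD f w u) (x + \<xi> *\<^sub>R u + \<eta> *\<^sub>R v) v"
      using \<xi>(3) \<eta>(3) by (simp add: p_def D_def power2_eq_square)
  qed
qed

lemma second_derivative_symmetric_real:
  fixes f :: "'a::real_normed_vector \<Rightarrow> real"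
  assumes "open S" "Ck_on 2 f S" "x \<in> S"
  shows "FD (\<lambda>w. FD f w u) x v
       = FD (\<lambda>w. FD f w v) x u"
proof (rule ccontr)
  define H where "H u v y = FD (\<lambda>w. FD f w u) y v" for u v y
  assume "\<not> ?thesis"
  then have ne: "dist (H u v x) (H v u x) > 0" by (simp add: H_def)
  have cont: "continuous (at x) (H u v)" for u v
  proof -
    have "continuous_on S (H u v)" using assms(2) by (simp add: H_def[abs_def] numeral_2_eq_2)
    then show ?thesis using assms(1,3) by (simp add: continuous_on_eq_continuous_at)
  qed
  define \<epsilon> where "\<epsilon> = dist (H u v x) (H v u x) / 2"
  have \<epsilon>: "\<epsilon> > 0" using ne by (simp add: \<epsilon>_def)
  obtain d1 where d1: "d1 > 0" "\<And>y. dist y x < d1 \<Longrightarrow> dist (H u v y) (H u v x) < \<epsilon>"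
    using cont[of u v] \<epsilon> unfolding continuous_at_eps_delta by blast
  obtain d2 where d2: "d2 > 0" "\<And>y. dist y x < d2 \<Longrightarrow> dist (H v u y) (H v u x) < \<epsilon>"
    using cont[of v u] \<epsilon> unfolding continuous_at_eps_delta by blast
  obtain e where e: "e > 0" "ball x e \<subseteq> S" using assms(1,3) open_contains_ball by metis
  define m where "m = min e (min d1 d2)"
  define h where "h = m / (2 * (norm u + norm v + 1))"
  have m: "m > 0" using e d1 d2 by (simp add: m_def)
  have n: "norm u + norm v + 1 > 0" using norm_ge_zero[of u] norm_ge_zero[of v] by linarith
  have h: "h > 0" using m n by (simp add: h_def)
  have "h * (norm u + norm v) \<le> h * (norm u + norm v + 1)" using h by simp
  also have "\<dots> = m / 2" using n by (simp add: h_def field_simps)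
  finally have small: "h * (norm u + norm v) < m" using m by simp
  obtain y where y: "dist y x \<le> h * (norm u + norm v)"
    "f (x + h *\<^sub>R u + h *\<^sub>R v) - f (x + h *\<^sub>R u) - f (x + h *\<^sub>R v) + f x = h\<^sup>2 * H u v y"
    using second_difference[OF assms(1,2) e h, of u v] small by (auto simp: m_def H_def)
  obtain y' where y': "dist y' x \<le> h * (norm v + norm u)"
    "f (x + h *\<^sub>R v + h *\<^sub>R u) - f (x + h *\<^sub>R v) - f (x + h *\<^sub>R u) + f x = h\<^sup>2 * H v u y'"
    using second_difference[OF assms(1,2) e h, of v u] small by (auto simp: m_def H_def add.commute)
  have "h\<^sup>2 * H u v y = h\<^sup>2 * H v u y'"
    unfolding y(2)[symmetric] y'(2)[symmetric] by (simp add: algebra_simps)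
  then have "H u v y = H v u y'" using h by simp
  moreover have "dist (H u v y) (H u v x) < \<epsilon>" using y(1) small by (intro d1) (simp add: m_def)
  moreover have "dist (H v u y') (H v u x) < \<epsilon>" using y'(1) small by (intro d2) (simp add: m_def add.commute)
  ultimately show False
    unfolding \<epsilon>_def by (metis dist_commute dist_triangle_half_r less_irrefl)
qed

lemma second_derivative_symmetric:
  fixes f :: "'a::real_normed_vector \<Rightarrow> 'b::euclidean_space"
  assumes S: "open S" "x \<in> S" and C: "Ck_on 2 f S"
  shows "FD (\<lambda>w. FD f w u) x v
       = FD (\<lambda>w. FD f w v) x u"
proof (rule euclidean_eqI)
  fix b :: 'b assume "b \<in> Basis"
  have C': "Ck_on 2 (\<lambda>w. f w \<bullet> b) S"
    by (intro Ck_on_bounded_linear[OF bounded_linear_inner_left S(1) C])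
  have d: "FD (\<lambda>w. f w \<bullet> b) w = (\<lambda>v. FD f w v \<bullet> b)" if "w \<in> S" for w
    using C that by (intro frechet_derivative_eqI bounded_linear.has_derivative[OF bounded_linear_inner_left]
        frechet_derivative_has) (simp add: numeral_2_eq_2)
  have "FD (\<lambda>w. FD (\<lambda>w. f w \<bullet> b) w u) x v
      = FD (\<lambda>w. FD f w u) x v \<bullet> b" for u v
  proof -
    have "((\<lambda>w. FD f w u \<bullet> b) has_derivative
      (\<lambda>v. FD (\<lambda>w. FD f w u) x v \<bullet> b)) (at x)"
      using C S by (intro bounded_linear.has_derivative[OF bounded_linear_inner_left]
        frechet_derivative_has) (simp add: numeral_2_eq_2)
    from has_derivative_transform_within_open[OF this S(1,2)]
    have "((\<lambda>w. FD (\<lambda>w. f w \<bullet> b) w u) has_derivative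
      (\<lambda>v. FD (\<lambda>w. FD f w u) x v \<bullet> b)) (at x)"
      by (simp add: d)
    then show ?thesis using frechet_derivative_eqI by fastforce
  qed
  then show "FD (\<lambda>w. FD f w u) x v \<bullet> b
       = FD (\<lambda>w. FD f w v) x u \<bullet> b"
    using second_derivative_symmetric_real[OF S(1) C' S(2), of u v] by simp
qed

section \<open>The Levi-Civita connection in a chart\<close>

text \<open>Covariant two-tensors are differentiated by \<open>\<nabla>\<^sub>x A = dA(x) - act (conn G u x) A\<close>.  At the same time \<open>act \<Gamma>\<close> is the
  derivative at \<open>t = 0\<close> of the pull-back along \<open>1 + t\<Gamma>\<close>.\<close>

definition act :: "real^4^4 \<Rightarrow> real^4^4 \<Rightarrow> real^4^4" where
  "act \<Gamma> A = transpose \<Gamma> ** A + A ** \<Gamma>"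

definition gam :: "(real^4 \<Rightarrow> real^4^4) \<Rightarrow> real^4 \<Rightarrow> 4 \<Rightarrow> real^4^4" where
  "gam G u l = (\<chi> k j. christoffel G u k l j)"

definition conn :: "(real^4 \<Rightarrow> real^4^4) \<Rightarrow> real^4 \<Rightarrow> real^4 \<Rightarrow> real^4^4" where
  "conn G u x = (\<Sum>l\<in>UNIV. x$l *\<^sub>R gam G u l)"

definition curv :: "(real^4 \<Rightarrow> real^4^4) \<Rightarrow> real^4 \<Rightarrow> 4 \<Rightarrow> 4 \<Rightarrow> real^4^4" where
  "curv G u i j = FD (\<lambda>w. gam G w j) u (axis i 1)
     - FD (\<lambda>w. gam G w i) u (axis j 1)
     + (gam G u i ** gam G u j - gam G u j ** gam G u i)"

definition lowered :: "(real^4 \<Rightarrow> real^4^4) \<Rightarrow> real^4 \<Rightarrow> tensor4" where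
  "lowered G u k l i j = (\<Sum>m\<in>UNIV. G u $k$m * riemann G u m l i j)"

lemma act_bilinear: "bounded_bilinear act"
proof (rule bilinear_conv_bounded_bilinear[THEN iffD1], unfold bilinear_def, intro conjI allI)
  show "linear (act X)" for X
    by (rule linearI) (simp_all add: act_def mmul.add_left mmul.add_right mmul.scaleR_left mmul.scaleR_right algebra_simps)
  show "linear (\<lambda>X. act X Y)" for Y
    by (rule linearI) (simp_all add: act_def transpose_add transpose_scalar mmul.add_left mmul.add_right
        mmul.scaleR_left mmul.scaleR_right algebra_simps)
qed

interpretation act: bounded_bilinear act by (rule act_bilinear)

lemma act_act: "act X (act Y A) - act Y (act X A) = - act (X ** Y - Y ** X) A"
  by (simp add: act_def matrix_transpose_mul transpose_diff mmul.add_left mmul.add_right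
      mmul.diff_left mmul.diff_right matrix_mul_assoc algebra_simps)

lemma transpose_act: "transpose (act X A) = act X (transpose A)"
  by (simp add: act_def transpose_add matrix_transpose_mul add.commute)

lemma act_two_forms: "A \<in> two_forms \<Longrightarrow> act X A \<in> two_forms"
  by (simp add: two_forms_def transpose_act act.minus_right)

lemma christoffel_action_eq: "christoffel_action G u x A = act (conn G u x) A"
proof -
  have "christoffel_action G u x A $ i $ j = act (conn G u x) A $ i $ j" for i j
  proof -
    have "act (conn G u x) A $ i $ j
       = (\<Sum>l\<in>UNIV. \<Sum>k\<in>UNIV. x$l * christoffel G u k l i * A$k$j)
       + (\<Sum>l\<in>UNIV. \<Sum>k\<in>UNIV. x$l * christoffel G u k l j * A$i$k)"
      by (subst (1 2) sum.swap)
        (simp add: act_def conn_def gam_def matrix_matrix_mult_def transpose_def sum_distrib_right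
          sum_distrib_left mult_ac)
    then show ?thesis
      by (simp add: christoffel_action_def distrib_left sum.distrib mult_ac)
  qed
  then show ?thesis by (simp add: vec_eq_iff)
qed

lemma linear_conn: "linear (conn G u)"
  by (rule linearI) (simp_all add: conn_def scaleR_add_left sum.distrib scaleR_sum_right)

locale local_metric =
  fixes U :: "(real^4) set" and G :: "real^4 \<Rightarrow> real^4^4"
  assumes open_U: "open U" and smooth_G: "smooth_map_on U G"
    and inner_G: "u \<in> U \<Longrightarrow> inner_product_matrix (G u)"
begin

lemma Ck_G: "Ck_on k G U"
  using smooth_G by (simp add: smooth_map_on_def)

lemma sym_G: "u \<in> U \<Longrightarrow> transpose (G u) = G u"
  using inner_G by (simp add: inner_product_matrix_def)

lemma invertible_G: "u \<in> U \<Longrightarrow> invertible (G u)"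
  using inner_G inner_product_matrix_invertible by blast

lemma Ck_dG: "Ck_on k (\<lambda>u. FD G u v) U"
  using Ck_G[of "Suc k"] by simp

lemma has_derivative_G: "u \<in> U \<Longrightarrow> (G has_derivative FD G u) (at u)"
  using Ck_G[of 1] by (intro frechet_derivative_has) simp

lemma dG_symmetric:
  assumes "u \<in> U"
  shows "transpose (FD G u v) = FD G u v"
proof -
  have "((\<lambda>w. transpose (G w)) has_derivative (\<lambda>v. transpose (FD G u v))) (at u)"
    by (intro bounded_linear.has_derivative[OF bounded_linear_transpose] has_derivative_G assms)
  from has_derivative_transform_within_open[OF this open_U assms sym_G]
  show ?thesis using has_derivative_unique[OF has_derivative_G[OF assms]] by metis
qed

lemma christoffel_symmetric: "u \<in> U \<Longrightarrow> christoffel G u k i j = christoffel G u k j i"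
proof -
  assume u: "u \<in> U"
  have "FD G u v $ i $ j = FD G u v $ j $ i" for v
    using arg_cong[OF dG_symmetric[OF u, of v], of "\<lambda>A. A$i$j"] by (simp add: transpose_def)
  then show ?thesis by (simp add: christoffel_def Let_def add.commute)
qed

lemma Ck_gam: "Ck_on k (\<lambda>u. gam G u l) U"
proof -
  note c = Ck_on_nth[OF open_U] and mult = Ck_on_bilinear[OF bounded_bilinear_mult open_U]
  have inv: "Ck_on k (\<lambda>u. matrix_inv (G u)) U"
    using invertible_G by (intro Ck_on_matrix_inv open_U Ck_G)
  show ?thesis
  proof (intro Ck_on_vec[OF open_U])
    fix i j
    have "Ck_on k (\<lambda>u. (1/2) * (\<Sum>m\<in>UNIV. matrix_inv (G u) $i$m *
       (FD G u (axis l 1) $j$m + FD G u (axis j 1) $l$m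
        + (- 1) * FD G u (axis m 1) $l$j))) U"
      by (intro mult Ck_on_const Ck_on_sum[OF open_U] Ck_on_add[OF open_U] c inv Ck_dG)
    then show "Ck_on k (\<lambda>u. gam G u l $ i $ j) U"
      by (simp add: gam_def christoffel_def Let_def)
  qed
qed

lemma has_derivative_gam:
  "u \<in> U \<Longrightarrow> ((\<lambda>w. gam G w l) has_derivative FD (\<lambda>w. gam G w l) u) (at u)"
  using Ck_gam[of 1] by (intro frechet_derivative_has) simp

text \<open>The Levi-Civita connection is metric: lowering the index of the Christoffel symbols and symmetrising leaves the
  derivative of the metric.\<close>

lemma metric_gam:
  assumes u: "u \<in> U"
  shows "FD G u (axis i 1) = act (gam G u i) (G u)"
proof -
  define dG where "dG a = FD G u (axis a 1)" for a
  have s: "dG a $ b $ c = dG a $ c $ b" for a b c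
    using arg_cong[OF dG_symmetric[OF u, of "axis a 1"], of "\<lambda>A. A$b$c"] by (simp add: transpose_def dG_def)
  have lower: "(G u ** gam G u i) $ a $ b = (1/2) * (dG i $ b $ a + dG b $ i $ a - dG a $ i $ b)" for a b
  proof -
    define t where "t = (\<chi> l b. (1/2) * (dG i $ b $ l + dG b $ i $ l - dG l $ i $ b))"
    have "gam G u i = matrix_inv (G u) ** t"
      by (simp add: vec_eq_iff gam_def christoffel_def Let_def matrix_matrix_mult_def t_def dG_def sum_distrib_left
          mult_ac)
    then have "G u ** gam G u i = t" by (simp add: matrix_mul_assoc matrix_inv_right invertible_G u)
    then show ?thesis by (simp add: t_def)
  qed
  have "act (gam G u i) (G u) $ a $ b = dG i $ a $ b" for a b
  proof -
    have "transpose (gam G u i) ** G u = transpose (G u ** gam G u i)"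
      by (simp add: matrix_transpose_mul sym_G u)
    then have "act (gam G u i) (G u) $ a $ b = (G u ** gam G u i) $ b $ a + (G u ** gam G u i) $ a $ b"
      by (simp add: act_def transpose_def)
    also have "\<dots> = dG i $ a $ b"
      unfolding lower using s[of i b a] s[of b i a] s[of a i b] by (simp add: field_simps)
    finally show ?thesis .
  qed
  then show ?thesis by (simp add: vec_eq_iff dG_def)
qed

lemma metric_conn:
  assumes u: "u \<in> U"
  shows "FD G u x = act (conn G u x) (G u)"
proof -
  interpret D: linear "FD G u"
    using has_derivative_G[OF u] by (rule has_derivative_linear)
  have "x = (\<Sum>l\<in>UNIV. x$l *\<^sub>R axis l 1)"
    by (simp add: vec_eq_iff axis_def if_distrib cong: if_cong)
  then have "FD G u x = (\<Sum>l\<in>UNIV. x$l *\<^sub>R FD G u (axis l 1))"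
    by (metis (no_types, lifting) D.sum D.scale sum.cong)
  then show ?thesis
    by (simp add: metric_gam[OF u] conn_def act.sum_left act.scaleR_left)
qed

lemma riemann_curv:
  assumes u: "u \<in> U"
  shows "riemann G u l k i j = curv G u i j $ l $ k"
proof -
  have "FD (\<lambda>w. christoffel G w l j k) u
      = (\<lambda>v. FD (\<lambda>w. gam G w j) u v $ l $ k)" for j
  proof (rule frechet_derivative_eqI)
    have "((\<lambda>w. gam G w j $ l $ k) has_derivative
        (\<lambda>v. FD (\<lambda>w. gam G w j) u v $ l $ k)) (at u)"
      by (intro bounded_linear.has_derivative[OF bounded_linear_vec_nth] has_derivative_gam u)
    then show "((\<lambda>w. christoffel G w l j k) has_derivative
        (\<lambda>v. FD (\<lambda>w. gam G w j) u v $ l $ k)) (at u)"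
      by (simp add: gam_def)
  qed
  then show ?thesis
    by (simp add: riemann_def curv_def matrix_matrix_mult_def sum_subtractf) (simp add: gam_def)
qed

lemma lowered_curv: "u \<in> U \<Longrightarrow> lowered G u k l i j = (G u ** curv G u i j) $ k $ l"
  by (simp add: lowered_def riemann_curv matrix_matrix_mult_def)

text \<open>The second derivatives of the metric commute.  Expressed through the connection by \<open>metric_gam\<close>, this says that the
  curvature annihilates the metric.\<close>

lemma act_curv:
  assumes u: "u \<in> U"
  shows "act (curv G u i j) (G u) = 0"
proof -
  define \<Gamma> where "\<Gamma> i = gam G u i" for i
  define d\<Gamma> where "d\<Gamma> j i = FD (\<lambda>w. gam G w i) u (axis j 1)" for i j
  have dd: "FD (\<lambda>w. FD G w (axis i 1)) u (axis j 1)
      = act (\<Gamma> i) (act (\<Gamma> j) (G u)) + act (d\<Gamma> j i) (G u)" for i j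
  proof -
    have "((\<lambda>w. act (gam G w i) (G w)) has_derivative
       (\<lambda>v. act (gam G u i) (FD G u v)
          + act (FD (\<lambda>w. gam G w i) u v) (G u))) (at u)"
      by (intro act.FDERIV has_derivative_gam has_derivative_G u)
    from has_derivative_transform_within_open[OF this open_U u metric_gam[symmetric]]
    have "FD (\<lambda>w. FD G w (axis i 1)) u
       = (\<lambda>v. act (gam G u i) (FD G u v)
          + act (FD (\<lambda>w. gam G w i) u v) (G u))"
      by (rule frechet_derivative_eqI)
    then show ?thesis by (simp add: metric_gam[OF u] \<Gamma>_def d\<Gamma>_def)
  qed
  have "act (\<Gamma> i) (act (\<Gamma> j) (G u)) + act (d\<Gamma> j i) (G u) = act (\<Gamma> j) (act (\<Gamma> i) (G u)) + act (d\<Gamma> i j) (G u)"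
    using second_derivative_symmetric[OF open_U u Ck_G, of "axis i 1" "axis j 1"] by (simp only: dd)
  then have "act (d\<Gamma> i j - d\<Gamma> j i) (G u) = act (\<Gamma> i) (act (\<Gamma> j) (G u)) - act (\<Gamma> j) (act (\<Gamma> i) (G u))"
    by (simp add: act.diff_left algebra_simps)
  then show ?thesis
    unfolding act_act curv_def by (simp add: act.add_left flip: \<Gamma>_def d\<Gamma>_def)
qed

lemma curv_antisymmetric: "curv G u j i = - curv G u i j"
  by (simp add: curv_def)

lemma lowered_curv_two_form:
  assumes "u \<in> U" shows "G u ** curv G u i j \<in> two_forms"
proof -
  have "transpose (curv G u i j) ** G u + G u ** curv G u i j = 0"
    using act_curv[OF assms, of i j] by (simp add: act_def)
  moreover have "transpose (G u ** curv G u i j) = transpose (curv G u i j) ** G u"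
    by (simp add: matrix_transpose_mul sym_G assms)
  ultimately show ?thesis by (simp add: two_forms_def eq_neg_iff_add_eq_0)
qed

lemma gam_symmetric: "u \<in> U \<Longrightarrow> gam G u i $ l $ j = gam G u j $ l $ i"
  by (simp add: gam_def christoffel_symmetric)

text \<open>The connection is torsion-free: exchanging the direction and the argument of the Christoffel symbols changes
  nothing, and the terms of the cyclic sum cancel in pairs.\<close>

lemma curv_bianchi:
  assumes u: "u \<in> U"
  shows "curv G u i j $ m $ l + curv G u j l $ m $ i + curv G u l i $ m $ j = 0"
proof -
  define d where "d a b = FD (\<lambda>w. gam G w b) u (axis a 1)" for a b
  have d: "d a b $ m $ c = d a c $ m $ b" for a b c
  proof -
    have 1: "((\<lambda>w. gam G w b $ m $ c) has_derivative
        (\<lambda>v. FD (\<lambda>w. gam G w b) u v $ m $ c)) (at u)" for b c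
      by (intro bounded_linear.has_derivative[OF bounded_linear_vec_nth] has_derivative_gam u)
    have "((\<lambda>w. gam G w c $ m $ b) has_derivative
        (\<lambda>v. FD (\<lambda>w. gam G w b) u v $ m $ c)) (at u)"
      by (rule has_derivative_transform_within_open[OF 1 open_U u gam_symmetric])
    from has_derivative_unique[OF this 1[of c b]] show ?thesis by (simp add: d_def fun_eq_iff)
  qed
  have g: "(gam G u a ** gam G u b) $ m $ c = (gam G u a ** gam G u c) $ m $ b" for a b c
    by (simp add: matrix_matrix_mult_def gam_symmetric[OF u, of b _ c])
  show ?thesis
    using d[of i j l] d[of j i l] d[of l i j] g[of i j l] g[of j i l] g[of l i j]
    by (simp add: curv_def flip: d_def)
qed

lemma curvature_tensor_lowered:
  assumes u: "u \<in> U" shows "curvature_tensor (lowered G u)"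
  unfolding curvature_tensor_def
proof (intro allI conjI)
  fix k l i j
  show "lowered G u k l j i = - lowered G u k l i j"
    by (simp add: lowered_curv u curv_antisymmetric[of u j i] mmul.minus_right)
  show "lowered G u l k i j = - lowered G u k l i j"
    using lowered_curv_two_form[OF u, of i j] unfolding two_forms_nth lowered_curv[OF u] by blast
  have "lowered G u k l i j + lowered G u k i j l + lowered G u k j l i
      = (\<Sum>m\<in>UNIV. G u $ k $ m * (curv G u i j $ m $ l + curv G u j l $ m $ i + curv G u l i $ m $ j))"
    by (simp add: lowered_curv u matrix_matrix_mult_def sum.distrib distrib_left)
  then show "lowered G u k l i j + lowered G u k i j l + lowered G u k j l i = 0"
    by (simp add: curv_bianchi u)
qed

lemma curvature_operator_eq: "curvature_operator G u = form_op (G u) (lowered G u)"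
  by (simp add: fun_eq_iff curvature_operator_def form_op_def lowered_def)

lemma ricci_eq:
  assumes u: "u \<in> U" shows "ricci G u = ricci_of (G u) (lowered G u)"
proof -
  have "(\<Sum>m\<in>UNIV. matrix_inv (G u) $ i $ m * lowered G u m k i j) = riemann G u i k i j" for i j k
  proof -
    have "(\<Sum>m\<in>UNIV. matrix_inv (G u) $ i $ m * lowered G u m k i j)
       = (matrix_inv (G u) ** (G u ** curv G u i j)) $ i $ k"
      by (simp only: lowered_curv[OF u] matrix_matrix_mult_def[of "matrix_inv (G u)"] vec_lambda_beta)
    also have "\<dots> = curv G u i j $ i $ k"
      by (simp add: matrix_mul_assoc matrix_inv_left invertible_G u)
    finally show ?thesis by (simp add: riemann_curv u)
  qed
  then show ?thesis by (simp add: ricci_def ricci_of_def)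
qed

lemma scal_eq: "u \<in> U \<Longrightarrow> scal G u = scal_of (G u) (lowered G u)"
  by (simp add: scal_def scal_of_def ricci_eq trace_def matrix_matrix_mult_def transpose_def)

lemma Ric0_eq: "u \<in> U \<Longrightarrow> Ric0 G u A = Ric0_of (G u) (lowered G u) A"
  by (simp add: Ric0_def ric0_def Ric0_of_def Let_def ricci_eq scal_eq)

lemma Wplus_eq: "u \<in> U \<Longrightarrow> Wplus_s12 G u A = Wplus_of (G u) (lowered G u) A"
  by (simp add: Wplus_s12_def weyl_plus_def weyl_operator_def Wplus_of_def curvature_operator_eq Ric0_eq scal_eq)

end

section \<open>Parallelism of the Hodge star and of the inner product\<close>

lemma Ck_on_raise:
  assumes "open S" "Ck_on k M S" "Ck_on k A S" "\<And>w. w \<in> S \<Longrightarrow> invertible (M w)"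
  shows "Ck_on k (\<lambda>w. raise (M w) (A w)) S"
  unfolding raise_def
  by (intro Ck_on_bilinear[OF bounded_bilinear_matrix_mult] Ck_on_matrix_inv assms)

lemma Ck_on_hodge:
  assumes "open S" "Ck_on k M S" "Ck_on k A S" "\<And>w. w \<in> S \<Longrightarrow> det (M w) > 0"
  shows "Ck_on k (\<lambda>w. hodge (M w) (A w)) S"
proof -
  have "invertible (M w)" if "w \<in> S" for w
    using assms(4)[OF that] by (simp add: invertible_det_nz)
  then show ?thesis
    unfolding hodge_star
    by (intro Ck_on_bilinear[OF bounded_bilinear_scaleR] Ck_on_sqrt Ck_on_det Ck_on_nth
        Ck_on_bounded_linear[OF bounded_linear_star] Ck_on_raise assms)
qed

lemma Ck_on_form_inner:
  assumes "open S" "Ck_on k M S" "Ck_on k A S" "Ck_on k B S" "\<And>w. w \<in> S \<Longrightarrow> invertible (M w)"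
  shows "Ck_on k (\<lambda>w. form_inner (M w) (A w) (B w)) S"
  unfolding form_inner_trace
  by (intro Ck_on_bilinear[OF bounded_bilinear_mult] Ck_on_const Ck_on_bounded_linear[OF bounded_linear_trace]
      Ck_on_bilinear[OF bounded_bilinear_matrix_mult] Ck_on_bounded_linear[OF bounded_linear_transpose]
      Ck_on_raise assms)

lemma hodge_linear: "linear (hodge M)"
proof -
  interpret s: bounded_linear star by (rule bounded_linear_star)
  interpret r: bounded_linear "raise M" by (rule bounded_linear_raise)
  show ?thesis
    by (rule linearI) (simp_all add: hodge_star r.add r.scaleR s.add s.scaleR algebra_simps)
qed

lemma pull_flow_derivative:
  "(\<lambda>t. pull (mat 1 + t *\<^sub>R \<Gamma>) A) has_velocity act \<Gamma> A"
proof -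
  have e: "pull (mat 1 + t *\<^sub>R \<Gamma>) A = A + t *\<^sub>R act \<Gamma> A + t\<^sup>2 *\<^sub>R (transpose \<Gamma> ** A ** \<Gamma>)" for t
    by (simp add: pull_def act_def transpose_add transpose_scalar mmul.add_left mmul.add_right
        mmul.scaleR_left mmul.scaleR_right matrix_mul_assoc power2_eq_square algebra_simps)
  show ?thesis
    unfolding e by (auto intro!: derivative_eq_intros)
qed

lemma flow_det_pos: "\<forall>\<^sub>F t in nhds (0::real). det (mat 1 + t *\<^sub>R \<Gamma> :: real^'n^'n) > 0"
proof -
  have "isCont (\<lambda>t. det (mat 1 + t *\<^sub>R \<Gamma> :: real^'n^'n)) 0"
    unfolding det_def by (intro continuous_intros)
  then have "((\<lambda>t. det (mat 1 + t *\<^sub>R \<Gamma> :: real^'n^'n)) \<longlongrightarrow> 1) (nhds 0)"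
    by (simp add: isCont_def tendsto_nhds_iff)
  then show ?thesis by (rule order_tendstoD) simp
qed

text \<open>Let \<open>F\<close> be an operation whose behaviour under the isomorphisms \<open>1 + t\<Gamma>\<close> is known.  A path of metrics with
  derivative \<open>act \<Gamma> M\<close> agrees to first order with the pull-backs of \<open>M\<close> along \<open>1 + t\<Gamma>\<close>.  So the derivative
  of \<open>F\<close> along it is the naturality term \<open>v\<close>, corrected by the term \<open>w\<close> for the difference between the velocity of
  the argument and that of its transport \<open>\<beta>\<close>.\<close>

lemma natural_derivative:
  fixes F :: "(real^4^4) \<times> 'a::real_normed_vector \<Rightarrow> 'b::real_normed_vector"
  assumes F: "F differentiable (at (M, a))"
    and flow: "\<beta> has_velocity \<beta>'" "\<beta> 0 = a"
      "(\<lambda>t. F (pull (mat 1 + t *\<^sub>R \<Gamma>) M, \<beta> t)) has_velocity v"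
    and lin: "(\<lambda>t. F (M, a + t *\<^sub>R (b - \<beta>'))) has_velocity w"
    and m: "m has_velocity act \<Gamma> M" "m 0 = M"
    and \<alpha>: "\<alpha> has_velocity b" "\<alpha> 0 = a"
  shows "(\<lambda>t. F (m t, \<alpha> t)) has_velocity v + w"
proof -
  obtain D where D: "(F has_derivative D) (at (M, a))" using F by (auto simp: differentiable_def)
  interpret D: linear D using D by (rule has_derivative_linear)
  have *: "(\<lambda>t. F (f t, g t)) has_velocity D (f', g')"
    if "f has_velocity f'" "g has_velocity g'" "f 0 = M" "g 0 = a" for f g f' g'
    using has_vector_derivative_compose[OF has_vector_derivative_Pair[OF that(1,2)], of F D] D that(3,4) by simp
  have "D (act \<Gamma> M, \<beta>') = v"
    by (rule vector_derivative_unique_at[OF *[OF pull_flow_derivative flow(1)] flow(3)]) (simp_all add: flow(2))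
  moreover have "D (0, b - \<beta>') = w"
  proof -
    have "(\<lambda>t. M) has_velocity 0" "(\<lambda>t. a + t *\<^sub>R (b - \<beta>')) has_velocity b - \<beta>'"
      by (auto intro!: derivative_eq_intros)
    from *[OF this] have "(\<lambda>t. F (M, a + t *\<^sub>R (b - \<beta>'))) has_velocity D (0, b - \<beta>')" by simp
    then show ?thesis by (rule vector_derivative_unique_at[OF _ lin])
  qed
  moreover have "D (act \<Gamma> M, b) = D (act \<Gamma> M, \<beta>') + D (0, b - \<beta>')"
    by (simp flip: D.add)
  ultimately show ?thesis using *[OF m(1) \<alpha>(1) m(2) \<alpha>(2)] by simp
qed

lemma open_det_pos: "open {p :: (real^4^4) \<times> 'a::real_normed_vector. det (fst p) > 0}"
  unfolding det_def by (intro open_Collect_less continuous_intros)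

text \<open>For small \<open>t\<close> the map \<open>1 + t\<Gamma>\<close> preserves the orientation, so that pulling back along it commutes with the
  Hodge star.  Thus the Hodge star is parallel along any path whose metric is differentiated as by a metric connection.\<close>

lemma hodge_parallel:
  assumes M: "inner_product_matrix M"
    and m: "m has_velocity act \<Gamma> M" "m 0 = M"
    and \<alpha>: "\<alpha> has_velocity b" "\<alpha> 0 = A"
  shows "(\<lambda>t. hodge (m t) (\<alpha> t)) has_velocity act \<Gamma> (hodge M A) + hodge M (b - act \<Gamma> A)"
proof -
  let ?S = "{p :: (real^4^4) \<times> (real^4^4). det (fst p) > 0}"
  let ?F = "\<lambda>p. hodge (fst p) (snd p)"
  have inv: "invertible M" "det M > 0"
    using M inner_product_matrix_invertible inner_product_matrix_det_pos by auto
  have "Ck_on (Suc 0) ?F ?S"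
    by (intro Ck_on_hodge open_det_pos Ck_on_fst Ck_on_snd) auto
  then have F: "?F differentiable (at (M, A))" using inv by simp
  have flow: "(\<lambda>t. ?F (pull (mat 1 + t *\<^sub>R \<Gamma>) M, pull (mat 1 + t *\<^sub>R \<Gamma>) A)) has_velocity act \<Gamma> (hodge M A)"
  proof (rule has_vector_derivative_transform_eventually[OF pull_flow_derivative])
    show "\<forall>\<^sub>F t in nhds 0. pull (mat 1 + t *\<^sub>R \<Gamma>) (hodge M A) = ?F (pull (mat 1 + t *\<^sub>R \<Gamma>) M, pull (mat 1 + t *\<^sub>R \<Gamma>) A)"
      using flow_det_pos[of \<Gamma>]
    proof (rule eventually_mono)
      fix t assume d: "det (mat 1 + t *\<^sub>R \<Gamma>) > 0"
      then have "invertible (mat 1 + t *\<^sub>R \<Gamma>)" by (simp add: invertible_det_nz)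
      then show "pull (mat 1 + t *\<^sub>R \<Gamma>) (hodge M A)
          = ?F (pull (mat 1 + t *\<^sub>R \<Gamma>) M, pull (mat 1 + t *\<^sub>R \<Gamma>) A)"
        using d inv by (simp add: hodge_pull)
    qed
  qed
  have lin: "(\<lambda>t. ?F (M, A + t *\<^sub>R (b - act \<Gamma> A))) has_velocity hodge M (b - act \<Gamma> A)"
    by (auto simp: linear_add[OF hodge_linear] linear_scale[OF hodge_linear] intro!: derivative_eq_intros)
  show ?thesis
    using natural_derivative[OF F pull_flow_derivative _ flow lin m \<alpha>] by simp
qed

lemma form_inner_parallel:
  assumes M: "inner_product_matrix M"
    and m: "m has_velocity act \<Gamma> M" "m 0 = M"
    and \<alpha>: "\<alpha> has_velocity a" "\<alpha> 0 = A"
    and \<beta>: "\<beta> has_velocity b" "\<beta> 0 = B"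
  shows "(\<lambda>t. form_inner (m t) (\<alpha> t) (\<beta> t)) has_velocity
      form_inner M (a - act \<Gamma> A) B + form_inner M A (b - act \<Gamma> B)"
proof -
  let ?S = "{p :: (real^4^4) \<times> (real^4^4) \<times> (real^4^4). det (fst p) > 0}"
  let ?F = "\<lambda>p. form_inner (fst p) (fst (snd p)) (snd (snd p))"
  have inv: "invertible M" "det M > 0"
    using M inner_product_matrix_invertible inner_product_matrix_det_pos by auto
  have "Ck_on (Suc 0) ?F ?S"
    by (intro Ck_on_form_inner open_det_pos Ck_on_fst Ck_on_snd Ck_on_bounded_linear[OF bounded_linear_fst]
        Ck_on_bounded_linear[OF bounded_linear_snd]) (auto simp: invertible_det_nz)
  then have F: "?F differentiable (at (M, (A, B)))" using inv by simp
  let ?p = "\<lambda>t X. pull (mat 1 + t *\<^sub>R \<Gamma>) X"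
  have flow: "(\<lambda>t. ?F (?p t M, (?p t A, ?p t B))) has_velocity 0"
  proof (rule has_vector_derivative_transform_eventually[OF has_vector_derivative_const])
    show "\<forall>\<^sub>F t in nhds 0. form_inner M A B = ?F (?p t M, (?p t A, ?p t B))"
      using flow_det_pos[of \<Gamma>]
    proof (rule eventually_mono)
      fix t assume "det (mat 1 + t *\<^sub>R \<Gamma>) > 0"
      then have "invertible (mat 1 + t *\<^sub>R \<Gamma>)" by (simp add: invertible_det_nz)
      then show "form_inner M A B = ?F (?p t M, (?p t A, ?p t B))"
        using inv by (simp add: form_inner_pull)
    qed
  qed
  let ?a = "a - act \<Gamma> A" and ?b = "b - act \<Gamma> B"
  have "(\<lambda>t. form_inner M (A + t *\<^sub>R ?a) (B + t *\<^sub>R ?b)) has_velocity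
      form_inner M (A + 0 *\<^sub>R ?a) ?b + form_inner M ?a (B + 0 *\<^sub>R ?b)"
    by (rule bounded_bilinear.has_vector_derivative[OF bounded_bilinear_form_inner]) (auto intro!: derivative_eq_intros)
  then have lin: "(\<lambda>t. ?F (M, (A, B) + t *\<^sub>R ((a, b) - (act \<Gamma> A, act \<Gamma> B)))) has_velocity
      form_inner M ?a B + form_inner M A ?b"
    by (simp add: add.commute)
  have "(\<lambda>t. ?F (m t, (\<alpha> t, \<beta> t))) has_velocity 0 + (form_inner M ?a B + form_inner M A ?b)"
    by (rule natural_derivative[OF F has_vector_derivative_Pair[OF pull_flow_derivative pull_flow_derivative] _ flow lin m
      has_vector_derivative_Pair[OF \<alpha>(1) \<beta>(1)]]) (simp_all add: \<alpha> \<beta>)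
  then show ?thesis by simp
qed

section \<open>Tangent vectors of the twistor space in a chart\<close>

lemma Lambda_plus_scale: "A \<in> Lambda_plus M \<Longrightarrow> c *\<^sub>R A \<in> Lambda_plus M"
  using linear_scale[OF hodge_linear] by (auto simp: Lambda_plus_def two_forms_def transpose_scalar)

lemma Lambda_plus_diff: "A \<in> Lambda_plus M \<Longrightarrow> B \<in> Lambda_plus M \<Longrightarrow> A - B \<in> Lambda_plus M"
  using linear_diff[OF hodge_linear] by (auto simp: Lambda_plus_def two_forms_def transpose_diff)

lemma sd_part_in_Lambda_plus:
  assumes M: "inner_product_matrix M" and A: "A \<in> two_forms"
  shows "sd_part M A \<in> Lambda_plus M"
proof -
  obtain P where P: "pull P M = mat 1" "det P > 0" using orthonormal_frame_exists[OF M] by blast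
  note inv = invertible_if_pull_id[OF P(1)]
  have "pull P A \<in> two_forms" by (rule pull_two_forms[OF A])
  then have "pull P (sd_part M A) \<in> Lambda_plus (mat 1)"
    by (simp add: sd_part_pull[OF P] Lambda_plus_def sd_part_two_forms star_sd_part)
  then show ?thesis using pull_Lambda_plus[of P M] inv P by simp
qed

lemma sd_part_Lambda_plus: "A \<in> Lambda_plus M \<Longrightarrow> sd_part M A = A"
  by (simp add: Lambda_plus_def sd_part_def flip: scaleR_2)

lemma form_norm_eq_1: "form_norm M A = 1 \<longleftrightarrow> form_inner M A A = 1"
  by (simp add: form_norm_def)

definition vertical_projection :: "real^4^4 \<Rightarrow> real^4^4 \<Rightarrow> real^4^4 \<Rightarrow> real^4^4" where
  "vertical_projection M A B = sd_part M B - form_inner M (sd_part M B) A *\<^sub>R A"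

lemma vertical_projection_in:
  assumes "inner_product_matrix M" "A \<in> Lambda_plus M" "form_inner M A A = 1" "B \<in> two_forms"
  shows "vertical_projection M A B \<in> vertical_plane M A"
  using assms by (simp add: vertical_plane_def vertical_projection_def Lambda_plus_diff Lambda_plus_scale
      sd_part_in_Lambda_plus finner.diff_left finner.scaleR_left)

lemma vertical_projection_id: "B \<in> vertical_plane M A \<Longrightarrow> vertical_projection M A B = B"
  by (simp add: vertical_plane_def vertical_projection_def sd_part_Lambda_plus)

context local_metric
begin

abbreviation "TS \<equiv> local_twistor U G"

lemma local_twistor_iff:
  "z \<in> TS \<longleftrightarrow>
     fst z \<in> U \<and> snd z \<in> Lambda_plus (G (fst z)) \<and> form_inner (G (fst z)) (snd z) (snd z) = 1"
  by (auto simp: local_twistor_def form_norm_eq_1 split: prod.splits)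

lemma metric_along_curve:
  assumes "c has_velocity x" "c 0 \<in> U"
  shows "(\<lambda>t. G (c t)) has_velocity act (conn G (c 0) x) (G (c 0))"
  using has_vector_derivative_compose[OF assms(1) has_derivative_G[OF assms(2)]]
  by (simp add: metric_conn assms(2))

lemma vertical_part_eq: "vertical_part G z \<xi> = snd \<xi> - act (conn G (fst z) (fst \<xi>)) (snd z)"
  by (simp add: vertical_part_def christoffel_action_eq)

lemma fst_snd_derivative:
  assumes "(\<gamma> has_vector_derivative \<xi>) (at t)"
  shows "((\<lambda>t. fst (\<gamma> t)) has_vector_derivative fst \<xi>) (at t)" "((\<lambda>t. snd (\<gamma> t)) has_vector_derivative snd \<xi>) (at t)"
  using bounded_linear.has_vector_derivative[OF bounded_linear_fst assms]
    bounded_linear.has_vector_derivative[OF bounded_linear_snd assms] by auto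

text \<open>Differentiating the equations of the twistor space covariantly, which is possible because the Hodge star and
  the inner product are parallel, leaves the equations of \<open>V\<close> for the vertical part.\<close>

lemma velocity_vertical_part:
  assumes z: "z \<in> TS" and \<xi>: "\<xi> \<in> velocities TS z"
  shows "vertical_part G z \<xi> \<in> vertical_plane (G (fst z)) (snd z)"
proof -
  define u A where "u = fst z" and "A = snd z"
  define \<Gamma> where "\<Gamma> = conn G u (fst \<xi>)"
  define v where "v = snd \<xi> - act \<Gamma> A"
  have u: "u \<in> U" and A: "A \<in> Lambda_plus (G u)" "form_inner (G u) A A = 1"
    using z by (auto simp: local_twistor_iff u_def A_def)
  note M = inner_G[OF u]
  obtain \<gamma> where \<gamma>: "\<gamma> 0 = z" "\<forall>\<^sub>F t in nhds 0. \<gamma> t \<in> TS" "\<gamma> has_velocity \<xi>"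
    using \<xi> unfolding velocities_def by blast
  note d = fst_snd_derivative[OF \<gamma>(3)]
  have m: "(\<lambda>t. G (fst (\<gamma> t))) has_velocity act \<Gamma> (G u)"
    using metric_along_curve[OF d(1)] u by (simp add: \<gamma>(1) u_def \<Gamma>_def)
  have 0: "fst (\<gamma> 0) = u" "snd (\<gamma> 0) = A" by (simp_all add: \<gamma>(1) u_def A_def)
  have "(\<lambda>t. hodge (G (fst (\<gamma> t))) (snd (\<gamma> t))) has_velocity act \<Gamma> (hodge (G u) A) + hodge (G u) v"
    using hodge_parallel[OF M m _ d(2)] 0 by (simp add: v_def)
  moreover have "\<forall>\<^sub>F t in nhds 0. hodge (G (fst (\<gamma> t))) (snd (\<gamma> t)) = snd (\<gamma> t)"
    using \<gamma>(2) by (rule eventually_mono) (simp add: local_twistor_iff Lambda_plus_def)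
  ultimately have "act \<Gamma> (hodge (G u) A) + hodge (G u) v = snd \<xi>"
    using vector_derivative_unique_at[OF has_vector_derivative_transform_eventually d(2)] by blast
  moreover have "hodge (G u) A = A" using A by (simp add: Lambda_plus_def)
  ultimately have h: "hodge (G u) v = v" by (simp add: v_def algebra_simps)
  have "(\<lambda>t. - transpose (snd (\<gamma> t))) has_velocity - transpose (snd \<xi>)"
    by (intro has_vector_derivative_minus bounded_linear.has_vector_derivative[OF bounded_linear_transpose] d)
  moreover have "\<forall>\<^sub>F t in nhds 0. - transpose (snd (\<gamma> t)) = snd (\<gamma> t)"
    using \<gamma>(2) by (rule eventually_mono) (simp add: local_twistor_iff Lambda_plus_def two_forms_def)
  ultimately have "- transpose (snd \<xi>) = snd \<xi>"
    using vector_derivative_unique_at[OF has_vector_derivative_transform_eventually d(2)] by blast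
  then have "transpose (snd \<xi>) = - snd \<xi>" by (metis minus_minus)
  moreover have "A \<in> two_forms" using A by (simp add: Lambda_plus_def)
  ultimately have t: "v \<in> two_forms"
    using act_two_forms[of A \<Gamma>] by (simp add: v_def two_forms_def transpose_diff)
  have "(\<lambda>t. form_inner (G (fst (\<gamma> t))) (snd (\<gamma> t)) (snd (\<gamma> t))) has_velocity
      form_inner (G u) v A + form_inner (G u) A v"
    using form_inner_parallel[OF M m _ d(2) _ d(2)] 0 by (simp add: v_def)
  moreover have "\<forall>\<^sub>F t in nhds 0. form_inner (G (fst (\<gamma> t))) (snd (\<gamma> t)) (snd (\<gamma> t)) = 1"
    using \<gamma>(2) by (rule eventually_mono) (simp add: local_twistor_iff)
  ultimately have "form_inner (G u) v A + form_inner (G u) A v = 0"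
    using vector_derivative_unique_at[OF has_vector_derivative_transform_eventually has_vector_derivative_const] by blast
  moreover have "form_inner (G u) A v = form_inner (G u) v A"
    by (rule form_inner_commute[OF sym_G[OF u] invertible_G[OF u]])
  ultimately have "form_inner (G u) v A = 0" by simp
  with h t show ?thesis
    by (simp add: vertical_plane_def Lambda_plus_def vertical_part_eq v_def \<Gamma>_def u_def A_def)
qed

text \<open>A curve with this velocity is found by moving along a straight line in the space of all two-forms and then
  retracting to the unit sphere of \<open>\<Lambda>\<^sup>+\<close> over each base point.  The retraction keeps the velocity, because that already
  satisfies the linearised equations.\<close>

lemma velocityI:
  assumes z: "z \<in> TS" and B: "B \<in> vertical_plane (G (fst z)) (snd z)"
  shows "(x, act (conn G (fst z) x) (snd z) + B) \<in> velocities TS z"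
proof -
  define u A where "u = fst z" and "A = snd z"
  define \<Gamma> where "\<Gamma> = conn G u x"
  define b where "b = act \<Gamma> A + B"
  have u: "u \<in> U" and A: "A \<in> Lambda_plus (G u)" "form_inner (G u) A A = 1"
    using z by (auto simp: local_twistor_iff u_def A_def)
  have B': "B \<in> Lambda_plus (G u)" "form_inner (G u) B A = 0"
    using B by (simp_all add: vertical_plane_def u_def A_def)
  note M = inner_G[OF u]
  define c where "c t = u + t *\<^sub>R x" for t
  \<comment> \<open>The straight line, projected to self-dual forms and then normalised.\<close>
  define a where "a t = sd_part (G (c t)) (A + t *\<^sub>R b)" for t
  define n where "n t = form_inner (G (c t)) (a t) (a t)" for t
  define \<gamma> where "\<gamma> t = (c t, (1 / sqrt (n t)) *\<^sub>R a t)" for t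
  have c0: "c 0 = u" by (simp add: c_def)
  have a0: "a 0 = A" by (simp add: a_def c0 sd_part_Lambda_plus A)
  have n0: "n 0 = 1" by (simp add: n_def c0 a0 A)
  have dc: "c has_velocity x"
    unfolding c_def by (auto intro!: derivative_eq_intros)
  have m: "(\<lambda>t. G (c t)) has_velocity act \<Gamma> (G u)"
    using metric_along_curve[OF dc] u by (simp add: c0 \<Gamma>_def)
  have dA: "(\<lambda>t. A + t *\<^sub>R b) has_velocity b"
    by (auto intro!: derivative_eq_intros)
  have "(\<lambda>t. hodge (G (c t)) (A + t *\<^sub>R b)) has_velocity
      act \<Gamma> (hodge (G u) A) + hodge (G u) (b - act \<Gamma> A)"
    using hodge_parallel[OF M m _ dA] c0 by simp
  then have "(\<lambda>t. hodge (G (c t)) (A + t *\<^sub>R b)) has_velocity b"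
    using A B' by (simp add: Lambda_plus_def b_def)
  from bounded_linear.has_vector_derivative[OF bounded_linear_scaleR_right[of "1/2"] has_vector_derivative_add[OF dA this]]
  have da: "a has_velocity b"
    by (simp add: a_def[abs_def] sd_part_def flip: scaleR_2)
  have "n has_velocity form_inner (G u) (b - act \<Gamma> A) A + form_inner (G u) A (b - act \<Gamma> A)"
    unfolding n_def using form_inner_parallel[OF M m _ da _ da] c0 a0 by simp
  moreover have "form_inner (G u) A B = form_inner (G u) B A"
    by (rule form_inner_commute[OF sym_G[OF u] invertible_G[OF u]])
  ultimately have dn: "(n has_real_derivative 0) (at 0)"
    using B' by (simp add: b_def has_real_derivative_iff_has_vector_derivative)
  \<comment> \<open>Normalising has no effect to first order, because \<open>b\<close> is orthogonal to \<open>A\<close> up to the connection term.\<close>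
  have "((\<lambda>t. 1 / sqrt (n t)) has_real_derivative 0) (at 0)"
    using dn by (auto intro!: derivative_eq_intros simp: n0)
  then have "(\<lambda>t. (1 / sqrt (n t)) *\<^sub>R a t) has_velocity (1 / sqrt (n 0)) *\<^sub>R b + 0 *\<^sub>R a 0"
    by (intro has_vector_derivative_scaleR da)
  then have d\<gamma>: "\<gamma> has_velocity (x, b)"
    unfolding \<gamma>_def by (intro has_vector_derivative_Pair dc) (simp add: n0)
  have b2: "A + t *\<^sub>R b \<in> two_forms" for t
    using A B' act_two_forms[of A \<Gamma>]
    by (auto simp: b_def two_forms_def Lambda_plus_def transpose_add transpose_scalar algebra_simps)
  have "\<forall>\<^sub>F t in nhds 0. c t \<in> U"
    using has_vector_derivative_continuous[OF dc] open_U u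
    by (intro topological_tendstoD[of c u]) (auto simp: continuous_at c0 tendsto_nhds_iff)
  moreover have "\<forall>\<^sub>F t in nhds 0. n t > 0"
    using DERIV_isCont[OF dn] by (intro order_tendstoD(1)[of n 1]) (auto simp: continuous_at n0 tendsto_nhds_iff)
  ultimately have "\<forall>\<^sub>F t in nhds 0. \<gamma> t \<in> TS"
  proof eventually_elim
    fix t assume t: "c t \<in> U" "n t > 0"
    have "form_inner (G (c t)) (a t) (a t) * (1 / sqrt (n t) * (1 / sqrt (n t))) = 1"
      using t(2) by (simp flip: n_def)
    then show "\<gamma> t \<in> TS"
      using t sd_part_in_Lambda_plus[OF inner_G[OF t(1)] b2, of t]
      by (simp add: local_twistor_iff \<gamma>_def Lambda_plus_scale finner.scaleR_left finner.scaleR_right flip: a_def n_def)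
  qed
  moreover have "\<gamma> 0 = z" by (simp add: \<gamma>_def c0 a0 n0 u_def A_def)
  ultimately show ?thesis
    using d\<gamma> unfolding velocities_def b_def \<Gamma>_def u_def A_def by blast
qed

section \<open>Vector fields and sections with prescribed values\<close>

abbreviation "cyl \<equiv> U \<times> (UNIV :: (real^4^4) set)"

lemma open_cyl: "open cyl" by (intro open_Times open_U open_UNIV)

lemma Ck_G_fst: "Ck_on k (\<lambda>w. G (fst w)) cyl"
  by (rule Ck_on_compose_linear[OF bounded_linear_fst open_U open_cyl _ Ck_G]) auto

lemma Ck_vertical_projection:
  "Ck_on k (\<lambda>w. vertical_projection (G (fst w)) (snd w) B) cyl"
proof -
  have h: "Ck_on k (\<lambda>w. hodge (G (fst w)) B) cyl"
    using inner_G inner_product_matrix_det_pos by (intro Ck_on_hodge open_cyl Ck_G_fst Ck_on_const) auto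
  have sd: "Ck_on k (\<lambda>w. sd_part (G (fst w)) B) cyl"
    unfolding sd_part_def
    by (intro Ck_on_bilinear[OF bounded_bilinear_scaleR] Ck_on_add open_cyl Ck_on_const h)
  have "Ck_on k (\<lambda>w. sd_part (G (fst w)) B + (- 1) *\<^sub>R (form_inner (G (fst w)) (sd_part (G (fst w)) B) (snd w) *\<^sub>R snd w)) cyl"
    using invertible_G
    by (intro Ck_on_add Ck_on_bilinear[OF bounded_bilinear_scaleR] open_cyl Ck_on_const Ck_on_form_inner Ck_G_fst
      sd Ck_on_snd) auto
  then show ?thesis by (simp add: vertical_projection_def)
qed

lemma Ck_conn: "Ck_on k (\<lambda>w. conn G (fst w) x) cyl"
  unfolding conn_def
proof (intro Ck_on_sum[OF open_cyl] Ck_on_bounded_linear[OF bounded_linear_scaleR_right open_cyl])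
  fix l
  show "Ck_on k (\<lambda>w. gam G (fst w) l) cyl"
    by (rule Ck_on_compose_linear[OF bounded_linear_fst open_U open_cyl _ Ck_gam]) auto
qed

lemma local_V_section_projection:
  assumes "B \<in> two_forms"
  shows "local_V_section U G cyl (\<lambda>w. vertical_projection (G (fst w)) (snd w) B)"
  unfolding local_V_section_def smooth_map_on_def
  using Ck_vertical_projection assms inner_G
  by (auto simp: vertical_space_plane local_twistor_iff intro!: vertical_projection_in)

text \<open>The horizontal lift of a constant vector plus the projection of a constant form: a field on the whole
  chart that takes any prescribed tangent vector as its value at a given point.\<close>

lemma local_vector_field_extension:
  assumes B: "B \<in> two_forms"
  shows "local_vector_field U G cyl
     (\<lambda>w. (x, act (conn G (fst w) x) (snd w) + vertical_projection (G (fst w)) (snd w) B))"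
    (is "local_vector_field U G cyl ?X")
  unfolding local_vector_field_def smooth_map_on_def
proof (intro conjI allI ballI)
  show "Ck_on k ?X cyl" for k
    by (intro Ck_on_Pair Ck_on_const Ck_on_add Ck_on_bilinear[OF act_bilinear] open_cyl Ck_conn Ck_on_snd
        Ck_vertical_projection)
  fix w assume "w \<in> cyl \<inter> TS"
  then show "?X w \<in> velocities TS w"
    using inner_G by (intro velocityI vertical_projection_in B) (auto simp: local_twistor_iff)
qed

end

section \<open>The curvature of the vertical bundle\<close>

text \<open>Expanding the argument of the derivative in a basis reduces this to the product rule; it holds for maps that
  are only defined near the point.\<close>

lemma derivative_along_field:
  fixes f :: "'a::euclidean_space \<Rightarrow> 'b::real_normed_vector"
  assumes S: "open S" "z \<in> S" and C: "Ck_on 2 f S" and Y: "(Y has_derivative DY) (at z)"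
  shows "((\<lambda>w. FD f w (Y w)) has_derivative
    (\<lambda>\<zeta>. FD (\<lambda>w. FD f w (Y z)) z \<zeta> + FD f z (DY \<zeta>))) (at z)"
proof -
  have lin: "linear (FD f w)" if "w \<in> S" for w
    using C that by (intro linear_frechet_derivative) (simp add: numeral_2_eq_2)
  have basis: "FD f w v = (\<Sum>b\<in>Basis. (v \<bullet> b) *\<^sub>R FD f w b)" if "w \<in> S" for v w
  proof -
    have "FD f w (\<Sum>b\<in>Basis. (v \<bullet> b) *\<^sub>R b) = (\<Sum>b\<in>Basis. (v \<bullet> b) *\<^sub>R FD f w b)"
      by (simp add: linear_sum[OF lin[OF that]] linear_scale[OF lin[OF that]])
    then show ?thesis by (simp add: euclidean_representation)
  qed
  have db: "((\<lambda>w. FD f w b) has_derivative FD (\<lambda>w. FD f w b) z) (at z)" for b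
    using C S by (intro frechet_derivative_has) (simp add: numeral_2_eq_2)
  have const: "FD (\<lambda>w. FD f w v) z \<zeta>
      = (\<Sum>b\<in>Basis. (v \<bullet> b) *\<^sub>R FD (\<lambda>w. FD f w b) z \<zeta>)" for v \<zeta>
  proof -
    have "((\<lambda>w. \<Sum>b\<in>Basis. (v \<bullet> b) *\<^sub>R FD f w b) has_derivative
      (\<lambda>\<zeta>. \<Sum>b\<in>Basis. (v \<bullet> b) *\<^sub>R FD (\<lambda>w. FD f w b) z \<zeta>)) (at z)"
      by (intro has_derivative_sum has_derivative_scaleR_right db)
    from has_derivative_transform_within_open[OF this S basis[symmetric]]
    show ?thesis using frechet_derivative_eqI by fastforce
  qed
  have "((\<lambda>w. \<Sum>b\<in>Basis. (Y w \<bullet> b) *\<^sub>R FD f w b) has_derivative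
      (\<lambda>\<zeta>. \<Sum>b\<in>Basis. (Y z \<bullet> b) *\<^sub>R FD (\<lambda>w. FD f w b) z \<zeta>
          + (DY \<zeta> \<bullet> b) *\<^sub>R FD f z b)) (at z)"
    by (intro has_derivative_sum has_derivative_scaleR db has_derivative_inner_left Y)
  from has_derivative_transform_within_open[OF this S basis[symmetric]]
  show ?thesis
    by (simp add: sum.distrib const[symmetric] basis[OF S(2), symmetric])
qed

context local_metric
begin

definition dconn :: "real^4 \<Rightarrow> real^4 \<Rightarrow> real^4 \<Rightarrow> real^4^4" where
  "dconn u v y = (\<Sum>l\<in>UNIV. y$l *\<^sub>R FD (\<lambda>w. gam G w l) u v)"

text \<open>The curvature of the Levi-Civita connection on the vectors \<open>x\<close>, \<open>y\<close>, in the form in which it arises from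
  commuting covariant derivatives along vector fields.\<close>

definition curv_vec :: "real^4 \<Rightarrow> real^4 \<Rightarrow> real^4 \<Rightarrow> real^4^4" where
  "curv_vec u x y = dconn u x y - dconn u y x + (conn G u x ** conn G u y - conn G u y ** conn G u x)"

lemma curv_vec_eq:
  assumes u: "u \<in> U"
  shows "curv_vec u x y = (\<Sum>i\<in>UNIV. \<Sum>j\<in>UNIV. (x$i * y$j) *\<^sub>R curv G u i j)"
proof -
  define d where "d i l = FD (\<lambda>w. gam G w l) u (axis i 1)" for i l
  have dl: "FD (\<lambda>w. gam G w l) u v = (\<Sum>i\<in>UNIV. v$i *\<^sub>R d i l)" for l v
  proof -
    interpret D: linear "FD (\<lambda>w. gam G w l) u"
      using has_derivative_gam[OF u] by (rule has_derivative_linear)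
    have "v = (\<Sum>i\<in>UNIV. v$i *\<^sub>R axis i 1)"
      by (simp add: vec_eq_iff axis_def if_distrib cong: if_cong)
    then have "FD (\<lambda>w. gam G w l) u v
        = FD (\<lambda>w. gam G w l) u (\<Sum>i\<in>UNIV. v$i *\<^sub>R axis i 1)" by simp
    then show ?thesis by (simp only: D.sum D.scale d_def)
  qed
  have 1: "dconn u x y = (\<Sum>i\<in>UNIV. \<Sum>j\<in>UNIV. (x$i * y$j) *\<^sub>R d i j)" for x y
    unfolding dconn_def dl by (subst sum.swap) (simp add: scaleR_sum_right mult.commute)
  have 2: "conn G u x ** conn G u y = (\<Sum>i\<in>UNIV. \<Sum>j\<in>UNIV. (x$i * y$j) *\<^sub>R (gam G u i ** gam G u j))" for x y
    by (simp add: conn_def mmul.sum_left mmul.sum_right mmul.scaleR_left mmul.scaleR_right scaleR_sum_right)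
      (rule trans[OF sum.swap], simp add: mult.commute)
  have 3: "(\<Sum>i\<in>UNIV. \<Sum>j\<in>UNIV. (y$i * x$j) *\<^sub>R f i j) = (\<Sum>i\<in>UNIV. \<Sum>j\<in>UNIV. (x$i * y$j) *\<^sub>R f j i)"
    for f :: "4 \<Rightarrow> 4 \<Rightarrow> real^4^4"
    by (subst sum.swap) (simp add: mult.commute)
  show ?thesis
    unfolding curv_vec_def 1 2 3[of _ ] curv_def d_def[symmetric]
    by (simp add: sum_subtractf sum.distrib algebra_simps)
qed

lemma curv_vec_two_form: "u \<in> U \<Longrightarrow> G u ** curv_vec u x y \<in> two_forms"
  using lowered_curv_two_form[of u]
  by (simp add: curv_vec_eq two_forms_def mmul.sum_right mmul.scaleR_right
      linear_sum[OF bounded_linear.linear[OF bounded_linear_transpose]] transpose_scalar sum_negf)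

text \<open>The curvature operator contracts its argument with the endomorphism slots of the Riemann tensor and keeps the
  two direction slots; here the latter hold \<open>x\<close> and \<open>y\<close>.\<close>

lemma form_inner_curv_vec:
  assumes u: "u \<in> U"
  shows "form_inner (G u) (G u ** curv_vec u x y) A = x \<bullet> (form_op (G u) (lowered G u) A *v y)"
proof -
  have e: "form_inner (G u) (G u ** curv G u i j) A = form_op (G u) (lowered G u) A $ i $ j" for i j
    by (simp add: form_inner_def form_op_def lowered_curv u)
  have "form_inner (G u) (G u ** curv_vec u x y) A
      = (\<Sum>i\<in>UNIV. \<Sum>j\<in>UNIV. (x$i * y$j) * form_inner (G u) (G u ** curv G u i j) A)"
    by (simp add: curv_vec_eq u mmul.sum_right mmul.scaleR_right finner.sum_left finner.scaleR_left)
  then show ?thesis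
    by (simp add: e inner_vec_def matrix_vector_mult_def sum_distrib_left mult_ac)
qed

lemma has_derivative_conn_field:
  assumes u: "fst z \<in> U" and Y: "(Y has_derivative DY) (at z)"
  shows "((\<lambda>w. conn G (fst w) (fst (Y w))) has_derivative
     (\<lambda>\<zeta>. dconn (fst z) (fst \<zeta>) (fst (Y z)) + conn G (fst z) (fst (DY \<zeta>)))) (at z)"
proof -
  have g: "((\<lambda>w. gam G (fst w) l) has_derivative
      (\<lambda>\<zeta>. FD (\<lambda>w. gam G w l) (fst z) (fst \<zeta>))) (at z)" for l
    by (rule has_derivative_compose[where f=fst and x=z, OF _ has_derivative_gam[OF u]])
      (auto intro!: derivative_eq_intros)
  have "((\<lambda>w. \<Sum>l\<in>UNIV. (fst (Y w) $ l) *\<^sub>R gam G (fst w) l) has_derivative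
     (\<lambda>\<zeta>. \<Sum>l\<in>UNIV. fst (Y z) $ l *\<^sub>R FD (\<lambda>w. gam G w l) (fst z) (fst \<zeta>)
        + fst (DY \<zeta>) $ l *\<^sub>R gam G (fst z) l)) (at z)"
    by (intro has_derivative_sum has_derivative_scaleR g
        bounded_linear.has_derivative[OF bounded_linear_vec_nth] has_derivative_fst Y)
  then show ?thesis by (simp add: conn_def dconn_def sum.distrib)
qed

end

locale twistor_fields = local_metric U G for U G +
  fixes N X Y s z
  assumes N: "open N" "z \<in> N" "N \<subseteq> U \<times> UNIV" and z: "z \<in> TS"
    and X: "local_vector_field U G N X" and Y: "local_vector_field U G N Y"
    and s: "local_V_section U G N s"
begin

abbreviation "u \<equiv> fst z"
abbreviation "A \<equiv> snd z"
abbreviation "ip \<equiv> form_inner (G u)"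

lemma u: "u \<in> U" and A: "A \<in> Lambda_plus (G u)" "ip A A = 1"
  using z by (auto simp: local_twistor_iff)

text \<open>The Levi-Civita derivative of the section, before the projection to \<open>V\<close>.\<close>

definition lc :: "(tw \<Rightarrow> tw) \<Rightarrow> tw \<Rightarrow> real^4^4" where
  "lc Z w = FD s w (Z w) - act (conn G (fst w) (fst (Z w))) (s w)"

lemma V_connection_lc:
  "V_connection G Z s w = lc Z w - form_inner (G (fst w)) (lc Z w) (snd w) *\<^sub>R snd w"
  by (simp add: V_connection_def lc_def Let_def christoffel_action_eq)

definition proj :: "real^4^4 \<Rightarrow> real^4^4" where
  "proj B = B - ip B A *\<^sub>R A"

lemma proj_linear: "linear proj"
  by (rule linearI) (simp_all add: proj_def finner.add_left finner.scaleR_left algebra_simps)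

lemma proj_A: "proj A = 0"
  by (simp add: proj_def A)

lemma proj_vertical: "B \<in> vertical_plane (G u) A \<Longrightarrow> proj B = B"
  by (simp add: proj_def vertical_plane_def)

lemma Ck_s: "Ck_on k s N" and has_derivative_s: "(s has_derivative FD s z) (at z)"
proof -
  show C: "Ck_on k s N" for k using s by (simp add: local_V_section_def smooth_map_on_def)
  show "(s has_derivative FD s z) (at z)"
    using C[of "Suc 0"] N by (intro frechet_derivative_has) simp
qed

lemma has_derivative_field:
  assumes "local_vector_field U G N Z"
  shows "(Z has_derivative FD Z z) (at z)"
proof -
  have "Ck_on (Suc 0) Z N" using assms unfolding local_vector_field_def smooth_map_on_def by blast
  then show ?thesis using N by (intro frechet_derivative_has) simp
qed

lemma s_vertical: "s z \<in> vertical_plane (G u) A"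
  using s N z by (auto simp: local_V_section_def vertical_space_plane)

lemma field_velocity:
  assumes "local_vector_field U G N Z" shows "Z z \<in> velocities TS z"
  using assms N z by (auto simp: local_vector_field_def)

lemma field_vertical:
  assumes "local_vector_field U G N Z" shows "vertical_part G z (Z z) \<in> vertical_plane (G u) A"
  by (rule velocity_vertical_part[OF z field_velocity[OF assms]])

text \<open>The section is orthogonal to the tautological form \<open>A\<close>, whose covariant derivative is the vertical part.  This
  is the second fundamental form of the sphere.\<close>

lemma lc_normal:
  assumes Z: "local_vector_field U G N Z"
  shows "ip (lc Z z) A = - ip (s z) (vertical_part G z (Z z))"
proof -
  obtain \<gamma> where \<gamma>: "\<gamma> 0 = z" "\<forall>\<^sub>F t in nhds 0. \<gamma> t \<in> TS" "\<gamma> has_velocity Z z"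
    using field_velocity[OF Z] unfolding velocities_def by blast
  note d = fst_snd_derivative[OF \<gamma>(3)]
  have m: "(\<lambda>t. G (fst (\<gamma> t))) has_velocity act (conn G u (fst (Z z))) (G u)"
    using metric_along_curve[OF d(1)] u by (simp add: \<gamma>(1))
  have ds: "(\<lambda>t. s (\<gamma> t)) has_velocity FD s z (Z z)"
    using has_vector_derivative_compose[OF \<gamma>(3), of s] has_derivative_s \<gamma>(1) by simp
  have "(\<lambda>t. form_inner (G (fst (\<gamma> t))) (s (\<gamma> t)) (snd (\<gamma> t))) has_velocity
      ip (lc Z z) A + ip (s z) (vertical_part G z (Z z))"
    using form_inner_parallel[OF inner_G[OF u] m _ ds _ d(2)] \<gamma>(1) by (simp add: lc_def vertical_part_eq)
  moreover have "\<forall>\<^sub>F t in nhds 0. form_inner (G (fst (\<gamma> t))) (s (\<gamma> t)) (snd (\<gamma> t)) = 0"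
  proof -
    have "\<forall>\<^sub>F t in nhds 0. \<gamma> t \<in> N"
      using has_vector_derivative_continuous[OF \<gamma>(3)] N
      by (intro topological_tendstoD[of \<gamma> z]) (auto simp: continuous_at \<gamma>(1) tendsto_nhds_iff)
    with \<gamma>(2) show ?thesis
      by eventually_elim (use s in \<open>auto simp: local_V_section_def vertical_space_def\<close>)
  qed
  ultimately have "ip (lc Z z) A + ip (s z) (vertical_part G z (Z z)) = 0"
    using vector_derivative_unique_at[OF has_vector_derivative_transform_eventually has_vector_derivative_const] by blast
  then show ?thesis by simp
qed

lemma has_derivative_lc:
  assumes Z: "local_vector_field U G N Z"
  shows "(lc Z has_derivative (\<lambda>\<zeta>.
      (FD (\<lambda>w. FD s w (Z z)) z \<zeta>
         + FD s z (FD Z z \<zeta>))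
      - (act (conn G u (fst (Z z))) (FD s z \<zeta>)
         + act (dconn u (fst \<zeta>) (fst (Z z)) + conn G u (fst (FD Z z \<zeta>))) (s z)))) (at z)"
  unfolding lc_def[abs_def]
  by (intro has_derivative_diff derivative_along_field[OF N(1,2) Ck_s] has_derivative_field[OF Z]
      act.FDERIV has_derivative_conn_field u has_derivative_s)

text \<open>The projection contributes a multiple of \<open>A\<close>, which is killed by the outer projection, and the derivative of
  \<open>A\<close> itself, which is vertical.  Only the latter remains, as the second fundamental form term.\<close>

lemma V_connection_V_connection:
  assumes Z: "local_vector_field U G N Z" and W: "local_vector_field U G N W"
    and D: "(lc Z has_derivative D) (at z)"
  shows "V_connection G W (V_connection G Z s) z =
     proj (D (W z) - act (conn G u (fst (W z))) (lc Z z))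
     - ip (lc Z z) A *\<^sub>R vertical_part G z (W z)"
proof -
  define h where "h w = form_inner (G (fst w)) (lc Z w) (snd w)" for w
  have "((\<lambda>w. G (fst w)) has_derivative (\<lambda>\<zeta>. FD G u (fst \<zeta>))) (at z)"
    by (rule has_derivative_compose[where f=fst and x=z, OF _ has_derivative_G[OF u]]) (auto intro!: derivative_eq_intros)
  moreover have "Ck_on (Suc 0) (\<lambda>w. matrix_inv (G (fst w))) cyl"
    using invertible_G by (intro Ck_on_matrix_inv open_cyl Ck_G_fst) auto
  then have "((\<lambda>w. matrix_inv (G (fst w))) has_derivative FD (\<lambda>w. matrix_inv (G (fst w))) z) (at z)"
    unfolding Ck_on.simps using N(2,3) by (intro frechet_derivative_has) blast
  ultimately have "h differentiable (at z)"
    unfolding h_def form_inner_trace raise_def differentiable_def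
    by (intro exI) (rule has_derivative_mult_right bounded_linear.has_derivative[OF bounded_linear_trace] mmul.FDERIV
        bounded_linear.has_derivative[OF bounded_linear_transpose] D has_derivative_snd has_derivative_ident | assumption)+
  then obtain Dh where Dh: "(h has_derivative Dh) (at z)" by (auto simp: differentiable_def)
  have "((\<lambda>w. lc Z w - h w *\<^sub>R snd w) has_derivative (\<lambda>\<zeta>. D \<zeta> - (h z *\<^sub>R snd \<zeta> + Dh \<zeta> *\<^sub>R A))) (at z)"
    by (intro has_derivative_diff D has_derivative_scaleR Dh has_derivative_snd has_derivative_ident)
  then have "((V_connection G Z s) has_derivative (\<lambda>\<zeta>. D \<zeta> - (h z *\<^sub>R snd \<zeta> + Dh \<zeta> *\<^sub>R A))) (at z)"
    by (simp add: V_connection_lc[abs_def] h_def)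
  then have fd: "FD (V_connection G Z s) z = (\<lambda>\<zeta>. D \<zeta> - (h z *\<^sub>R snd \<zeta> + Dh \<zeta> *\<^sub>R A))"
    by (rule frechet_derivative_eqI)
  have "V_connection G W (V_connection G Z s) z
      = proj (D (W z) - (h z *\<^sub>R snd (W z) + Dh (W z) *\<^sub>R A)
          - act (conn G u (fst (W z))) (lc Z z - h z *\<^sub>R A))"
    by (simp add: V_connection_def[of _ W] Let_def christoffel_action_eq fd V_connection_lc h_def proj_def)
  also have "\<dots> = proj ((D (W z) - act (conn G u (fst (W z))) (lc Z z)) - h z *\<^sub>R vertical_part G z (W z)
          - Dh (W z) *\<^sub>R A)"
    by (simp add: vertical_part_eq act.diff_right act.scaleR_right algebra_simps)
  also have "\<dots> = proj (D (W z) - act (conn G u (fst (W z))) (lc Z z)) - h z *\<^sub>R vertical_part G z (W z)"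
    by (simp add: linear_diff[OF proj_linear] linear_scale[OF proj_linear] proj_A
        proj_vertical[OF field_vertical[OF W]])
  finally show ?thesis by (simp add: h_def)
qed

text \<open>The Gauss equation.  Second derivatives of the section cancel by symmetry and first derivatives against the
  bracket, so that the value depends on the fields and the section at \<open>z\<close> only.\<close>

lemma V_curvature_eq:
  "V_curvature G X Y s z =
     (- (sqrt 2 * ip (G u ** curv_vec u (fst (X z)) (fst (Y z))) A
        + ip (fibre_rotation (G u) A (vertical_part G z (X z))) (vertical_part G z (Y z))))
       *\<^sub>R fibre_rotation (G u) A (s z)"
proof -
  define x y where "x = fst (X z)" and "y = fst (Y z)"
  define v w where "v = vertical_part G z (X z)" and "w = vertical_part G z (Y z)"
  define H where "H a b = FD (\<lambda>w. FD s w a) z b" for a b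
  define ds where "ds = FD s z"
  define DX DY where "DX = FD X z" and "DY = FD Y z"
  let ?\<Gamma> = "conn G u"
  let ?xy = "(H (Y z) (X z) + ds (DY (X z))) - (act (?\<Gamma> y) (ds (X z)) + act (dconn u x y + ?\<Gamma> (fst (DY (X z)))) (s z))
        - act (?\<Gamma> x) (ds (Y z) - act (?\<Gamma> y) (s z))"
    and ?yx = "(H (X z) (Y z) + ds (DX (Y z))) - (act (?\<Gamma> x) (ds (Y z)) + act (dconn u y x + ?\<Gamma> (fst (DX (Y z)))) (s z))
        - act (?\<Gamma> y) (ds (X z) - act (?\<Gamma> x) (s z))"
    and ?br = "ds (DY (X z)) - ds (DX (Y z)) - act (?\<Gamma> (fst (DY (X z))) - ?\<Gamma> (fst (DX (Y z)))) (s z)"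
  have Hs: "H a b = H b a" for a b
    unfolding H_def by (rule second_derivative_symmetric[OF N(1,2) Ck_s])
  have lin: "linear ds" unfolding ds_def by (rule has_derivative_linear[OF has_derivative_s])
  have XY: "V_connection G X (V_connection G Y s) z =
      proj ?xy + ip (s z) w *\<^sub>R v"
    unfolding V_connection_V_connection[OF Y X has_derivative_lc[OF Y]] lc_normal[OF Y]
    by (simp add: lc_def x_def y_def v_def w_def H_def ds_def DY_def)
  have YX: "V_connection G Y (V_connection G X s) z =
      proj ?yx + ip (s z) v *\<^sub>R w"
    unfolding V_connection_V_connection[OF X Y has_derivative_lc[OF X]] lc_normal[OF X]
    by (simp add: lc_def x_def y_def v_def w_def H_def ds_def DX_def)
  have br: "V_connection G (lie_bracket X Y) s z
      = proj ?br"
    by (simp add: V_connection_lc proj_def lc_def lie_bracket_def linear_diff[OF linear_conn]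
        flip: ds_def DX_def DY_def linear_diff[OF lin])
  have pd: "proj a + b - (proj c + d) - proj e = proj (a - c - e) + b - d" for a b c d e
    by (simp add: linear_diff[OF proj_linear])
  have R: "act (?\<Gamma> x) (act (?\<Gamma> y) (s z)) - act (?\<Gamma> y) (act (?\<Gamma> x) (s z))
      = - act (?\<Gamma> x ** ?\<Gamma> y - ?\<Gamma> y ** ?\<Gamma> x) (s z)" by (rule act_act)
  have E: "?xy
      - ?yx
      - ?br
      = - act (curv_vec u x y) (s z)"
    unfolding curv_vec_def act.add_left act.diff_left act.diff_right Hs[of "X z" "Y z"]
    using R by (simp add: act.diff_left algebra_simps)
  have "V_curvature G X Y s z = proj (- act (curv_vec u x y) (s z))
      + (ip (s z) w *\<^sub>R v - ip (s z) v *\<^sub>R w)"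
    unfolding V_curvature_def XY YX br pd E by (rule add_diff_eq[symmetric])
  also have "proj (- act (curv_vec u x y) (s z))
      = (- sqrt 2 * ip (G u ** curv_vec u x y) A) *\<^sub>R fibre_rotation (G u) A (s z)"
    using isometry_action_vertical[OF inner_G[OF u] A s_vertical curv_vec_two_form[OF u, of x y]]
    by (simp add: proj_def act_def)
  also have "ip (s z) w *\<^sub>R v - ip (s z) v *\<^sub>R w
      = (- ip (fibre_rotation (G u) A v) w) *\<^sub>R fibre_rotation (G u) A (s z)"
    unfolding v_def w_def
    by (rule vertical_plane_area(1)[OF inner_G[OF u] A s_vertical field_vertical[OF X] field_vertical[OF Y]])
  finally show ?thesis
    by (simp add: x_def y_def v_def w_def algebra_simps)
qed

end

section \<open>The induced form and taming in a chart\<close>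

lemma linear_form_op: "linear (form_op M R)"
proof -
  interpret r: bounded_linear "raise M" by (rule bounded_linear_raise)
  show ?thesis
    by (rule linearI) (simp_all add: form_op_def vec_eq_iff r.add r.scaleR algebra_simps sum.distrib sum_distrib_left)
qed

lemma linear_Ric0_of: "linear (Ric0_of M R)"
  by (rule linearI) (simp_all add: Ric0_of_def Let_def mmul.add_left mmul.add_right mmul.scaleR_left
      mmul.scaleR_right algebra_simps)

lemma linear_Wplus_of: "linear (Wplus_of M R)"
proof (rule linearI)
  note l = linear_add[OF linear_form_op] linear_scale[OF linear_form_op] linear_add[OF linear_Ric0_of]
    linear_scale[OF linear_Ric0_of] linear_add[OF hodge_linear] linear_scale[OF hodge_linear]
    linear_diff[OF hodge_linear]
  show "Wplus_of M R (A + B) = Wplus_of M R A + Wplus_of M R B" for A B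
    by (simp add: Wplus_of_def sd_part_def l algebra_simps)
  show "Wplus_of M R (c *\<^sub>R A) = c *\<^sub>R Wplus_of M R A" for c A
    by (simp add: Wplus_of_def sd_part_def l algebra_simps)
qed

lemma vertical_plane_scale: "B \<in> vertical_plane M A \<Longrightarrow> c *\<^sub>R B \<in> vertical_plane M A"
  by (simp add: vertical_plane_def Lambda_plus_scale finner.scaleR_left)

lemma vertical_plane_two_forms: "B \<in> vertical_plane M A \<Longrightarrow> B \<in> two_forms"
  by (simp add: vertical_plane_def Lambda_plus_def)

context local_metric
begin

text \<open>The curvature formula shows that the number exists.  It is unique because every pair of tangent vectors
  extends to vector fields and some section of \<open>V\<close> does not vanish at the point.\<close>

lemma local_induced_form_eq:
  assumes z: "z \<in> TS" and \<xi>: "\<xi> \<in> velocities TS z"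
    and \<eta>: "\<eta> \<in> velocities TS z" and \<epsilon>: "\<epsilon> * \<epsilon> = (1::real)"
  shows "local_induced_form \<epsilon> U G z \<xi> \<eta> = \<epsilon> / (2 * pi) *
    (sqrt 2 * form_inner (G (fst z)) (G (fst z) ** curv_vec (fst z) (fst \<xi>) (fst \<eta>)) (snd z)
        + form_inner (G (fst z)) (fibre_rotation (G (fst z)) (snd z) (vertical_part G z \<xi>)) (vertical_part G z \<eta>))"
    (is "_ = ?c")
  unfolding local_induced_form_def
proof (rule the_equality)
  let ?test = "\<lambda>N X Y s. open N \<and> z \<in> N \<and> N \<subseteq> U \<times> UNIV \<and>
      local_vector_field U G N X \<and> local_vector_field U G N Y \<and> local_V_section U G N s \<and> X z = \<xi> \<and> Y z = \<eta>"
  define u A where "u = fst z" and "A = snd z"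
  have u: "u \<in> U" and A: "A \<in> Lambda_plus (G u)" "form_inner (G u) A A = 1"
    using z by (auto simp: local_twistor_iff u_def A_def)
  define K where "K = sqrt 2 * form_inner (G (fst z)) (G (fst z) ** curv_vec (fst z) (fst \<xi>) (fst \<eta>)) (snd z)
        + form_inner (G (fst z)) (fibre_rotation (G (fst z)) (snd z) (vertical_part G z \<xi>)) (vertical_part G z \<eta>)"
  have K: "V_curvature G X Y s z = (- K) *\<^sub>R fibre_rotation (G (fst z)) (snd z) (s z)"
    if "?test N X Y s" for N X Y s
  proof -
    interpret twistor_fields U G N X Y s z
      using that z by unfold_locales auto
    show ?thesis using V_curvature_eq that by (simp add: K_def)
  qed
  have c: "?c = \<epsilon> / (2 * pi) * K" by (simp add: K_def)
  show "\<forall>N X Y s. ?test N X Y s \<longrightarrow>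
        V_curvature G X Y s z =
          (- 2 * pi * ?c) *\<^sub>R (\<epsilon> *\<^sub>R fibre_rotation (G (fst z)) (snd z) (s z))"
  proof (intro allI impI)
    fix N X Y s
    assume a: "?test N X Y s"
    have "- 2 * pi * ?c * \<epsilon> = - (\<epsilon> * \<epsilon>) * K" unfolding c by simp
    then have "- 2 * pi * ?c * \<epsilon> = - K" using \<epsilon> by simp
    then show "V_curvature G X Y s z =
          (- 2 * pi * ?c) *\<^sub>R (\<epsilon> *\<^sub>R fibre_rotation (G (fst z)) (snd z) (s z))"
      unfolding K[OF a] scaleR_scaleR by (simp only:)
  qed
  fix c'
  assume c': "\<forall>N X Y s. ?test N X Y s \<longrightarrow>
        V_curvature G X Y s z =
          (- 2 * pi * c') *\<^sub>R (\<epsilon> *\<^sub>R fibre_rotation (G (fst z)) (snd z) (s z))"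
  \<comment> \<open>The fields and the section that test uniqueness.\<close>
  define F where "F \<zeta> = (\<lambda>w. (fst \<zeta>, act (conn G (fst w) (fst \<zeta>)) (snd w)
      + vertical_projection (G (fst w)) (snd w) (vertical_part G z \<zeta>)))" for \<zeta>
  have F: "local_vector_field U G cyl (F \<zeta>)" "F \<zeta> z = \<zeta>" if "\<zeta> \<in> velocities TS z" for \<zeta>
  proof -
    have v: "vertical_part G z \<zeta> \<in> vertical_plane (G (fst z)) (snd z)" by (rule velocity_vertical_part[OF z that])
    show "local_vector_field U G cyl (F \<zeta>)"
      unfolding F_def by (rule local_vector_field_extension[OF vertical_plane_two_forms[OF v]])
    show "F \<zeta> z = \<zeta>"
      by (simp add: F_def vertical_projection_id[OF v]) (simp add: vertical_part_eq)
  qed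
  obtain B where B: "B \<in> vertical_plane (G u) A" "B \<noteq> 0"
    by (rule vertical_plane_nontrivial[OF inner_G[OF u] A])
  define s where "s = (\<lambda>w. vertical_projection (G (fst w)) (snd w) B)"
  have s: "local_V_section U G cyl s" "s z = B"
    using local_V_section_projection[OF vertical_plane_two_forms[OF B(1)]] vertical_projection_id[OF B(1)]
    by (auto simp: s_def u_def A_def)
  have a: "?test cyl (F \<xi>) (F \<eta>) s"
    using open_cyl u F \<xi> \<eta> s by (auto simp: u_def mem_Times_iff)
  let ?J = "fibre_rotation (G u) A B"
  have "(- K) *\<^sub>R fibre_rotation (G (fst z)) (snd z) (s z)
      = (- 2 * pi * c') *\<^sub>R (\<epsilon> *\<^sub>R fibre_rotation (G (fst z)) (snd z) (s z))"
    by (rule trans[OF K[OF a, symmetric] c'[rule_format, OF a]])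
  then have "(- K) *\<^sub>R ?J = (- 2 * pi * c' * \<epsilon>) *\<^sub>R ?J"
    by (simp only: s(2) u_def A_def scaleR_scaleR)
  moreover have "?J \<noteq> 0"
  proof
    assume "?J = 0"
    then have "form_inner (G u) B B = 0"
      using vertical_plane_area(3)[OF inner_G[OF u] A B(1) B(1) B(1)] by (simp add: finner.zero_left)
    then show False using vertical_plane_area(4)[OF inner_G[OF u] A B(1) B(1) B(1)] B(2) by simp
  qed
  ultimately have "- K = - 2 * pi * c' * \<epsilon>" by (simp only: scaleR_cancel_right) simp
  then have "K = 2 * pi * c' * \<epsilon>" by simp
  then have "\<epsilon> * K = 2 * pi * c' * (\<epsilon> * \<epsilon>)" by simp
  then show "c' = ?c" unfolding c using \<epsilon> by (simp add: field_simps)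
qed

lemma twistor_J_eq:
  "twistor_J \<epsilon> G z \<xi> = (endo_of_form (G (fst z)) (snd z) *v fst \<xi>,
     act (conn G (fst z) (endo_of_form (G (fst z)) (snd z) *v fst \<xi>)) (snd z)
       + \<epsilon> *\<^sub>R fibre_rotation (G (fst z)) (snd z) (vertical_part G z \<xi>))"
  by (simp add: twistor_J_def horizontal_lift_def christoffel_action_eq)

text \<open>For the second argument \<open>J\<^sub>\<epsilon> \<xi>\<close> the area term is \<open>|v|\<^sup>2\<close> and the curvature term is positive unless \<open>x = 0\<close>; the
  vectors \<open>x\<close> and \<open>v\<close> do not both vanish.\<close>

lemma induced_form_positive:
  assumes z: "z \<in> TS" and \<xi>: "\<xi> \<in> velocities TS z" "\<xi> \<noteq> 0"
    and \<epsilon>: "\<epsilon> * \<epsilon> = (1::real)"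
    and ineq: "\<epsilon> * form_inner (G (fst z)) (Wplus_s12 G (fst z) (snd z)) (snd z)
        > form_norm (G (fst z)) (Ric0 G (fst z) (snd z))"
  shows "local_induced_form \<epsilon> U G z \<xi> (twistor_J \<epsilon> G z \<xi>) > 0"
proof -
  define u A x v where "u = fst z" and "A = snd z" and "x = fst \<xi>" and "v = vertical_part G z \<xi>"
  have u: "u \<in> U" and A: "A \<in> Lambda_plus (G u)" "form_inner (G u) A A = 1"
    using z by (auto simp: local_twistor_iff u_def A_def)
  note M = inner_G[OF u]
  have v: "v \<in> vertical_plane (G u) A"
    using velocity_vertical_part[OF z \<xi>(1)] by (simp add: v_def u_def A_def)
  let ?J = "fibre_rotation (G u) A v" and ?E = "endo_of_form (G u) A *v x"
  note area = vertical_plane_area[OF M A v v v]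
  have Jv: "\<epsilon> *\<^sub>R ?J \<in> vertical_plane (G u) A" by (intro vertical_plane_scale area(2))
  have eq: "twistor_J \<epsilon> G z \<xi> = (?E, act (conn G u ?E) A + \<epsilon> *\<^sub>R ?J)"
    by (simp add: twistor_J_eq u_def A_def x_def v_def)
  have \<eta>: "twistor_J \<epsilon> G z \<xi> \<in> velocities TS z"
    unfolding eq using velocityI[OF z] Jv by (simp add: u_def A_def)
  define w r q where "w = form_inner (G u) (Wplus_s12 G u A) A" and "r = form_norm (G u) (Ric0 G u A)"
    and "q = x \<bullet> (G u *v x)"
  define k where "k = sqrt 2 * (x \<bullet> (form_op (G u) (lowered G u) A *v ?E))"
  have "local_induced_form \<epsilon> U G z \<xi> (twistor_J \<epsilon> G z \<xi>)
      = \<epsilon> / (2 * pi) * (k + form_inner (G u) ?J (\<epsilon> *\<^sub>R ?J))"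
    unfolding local_induced_form_eq[OF z \<xi>(1) \<eta> \<epsilon>]
    by (simp add: eq vertical_part_eq[of z "(_, _)"] k_def form_inner_curv_vec[OF u] flip: u_def A_def x_def v_def)
  also have "\<dots> = (\<epsilon> * k + (\<epsilon> * \<epsilon>) * form_inner (G u) v v) / (2 * pi)"
    by (simp add: finner.scaleR_right area(3) algebra_simps add_divide_distrib)
  finally have form: "local_induced_form \<epsilon> U G z \<xi> (twistor_J \<epsilon> G z \<xi>) = (\<epsilon> * k + form_inner (G u) v v) / (2 * pi)"
    by (simp add: \<epsilon>)
  have kw: "\<bar>k - q * w\<bar> \<le> q * r"
    using horizontal_contribution[OF M A curvature_tensor_lowered[OF u], of x]
    by (simp add: k_def q_def w_def r_def Wplus_eq[OF u] Ric0_eq[OF u])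
  have "\<bar>\<epsilon>\<bar> = 1" using \<epsilon> by (metis abs_mult abs_one abs_square_eq_1 power2_eq_square)
  then have "\<bar>\<epsilon> * k - q * (\<epsilon> * w)\<bar> \<le> q * r"
    using kw abs_mult[of \<epsilon> "k - q * w"] by (simp add: algebra_simps)
  then have k: "\<epsilon> * k \<ge> q * (\<epsilon> * w - r)" by (simp add: algebra_simps abs_le_iff)
  have pos: "\<epsilon> * w - r > 0" using ineq by (simp add: w_def r_def u_def A_def)
  have qpos: "q > 0" if "x \<noteq> 0" using M that by (simp add: q_def inner_product_matrix_def)
  have q: "q \<ge> 0" using qpos by (cases "x = 0") (auto simp: q_def less_imp_le)
  have "\<epsilon> * k + form_inner (G u) v v > 0"
  proof (cases "x = 0")
    case False
    then have "q * (\<epsilon> * w - r) > 0" using qpos pos by simp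
    then show ?thesis using k area(5) by linarith
  next
    case True
    have "v \<noteq> 0"
    proof
      assume "v = 0"
      then have "snd \<xi> = 0" using True by (simp add: v_def vertical_part_eq x_def linear_0[OF linear_conn] act.zero_left)
      with True \<xi>(2) show False by (simp add: x_def prod_eq_iff)
    qed
    then have "form_inner (G u) v v > 0" using area(4,5) by simp
    moreover have "q * (\<epsilon> * w - r) \<ge> 0" using q pos by simp
    ultimately show ?thesis using k by linarith
  qed
  then show ?thesis by (simp add: form)
qed

end

section \<open>From charts to the manifold\<close>

context oriented_riemannian_4manifold
begin

lemma local_metric_chart:
  assumes c: "c \<in> atlas" shows "local_metric (snd c ` fst c) (g c)"
proof
  show "open (snd c ` fst c)" using chart_open[OF c] by blast
  show "smooth_map_on (snd c ` fst c) (g c)" by (rule metric_smooth[OF c])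
  show "inner_product_matrix (g c u)" if "u \<in> snd c ` fst c" for u
    using that metric_inner_product[OF c] by (elim imageE) simp
qed

lemma inv_chart: "c \<in> atlas \<Longrightarrow> x \<in> fst c \<Longrightarrow> inv_into (fst c) (snd c) (snd c x) = x"
  using homeomorphism_apply1[OF chart_homeomorphism] by blast

lemma open_chart_overlap:
  assumes "c \<in> atlas" "c' \<in> atlas" shows "open (snd c ` (fst c \<inter> fst c'))"
proof -
  have "openin (top_of_set (fst c)) (fst c \<inter> fst c')"
    using chart_open[OF assms(2)] by (simp add: openin_open_Int)
  then have "openin (top_of_set (snd c ` fst c)) (snd c ` (fst c \<inter> fst c'))"
    by (rule homeomorphism_imp_open_map[OF chart_homeomorphism[OF assms(1)]])
  then show ?thesis using chart_open[OF assms(1)] openin_open_trans by blast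
qed

lemma twistor_coords_in:
  assumes z: "z \<in> twistor_space atlas g" and c: "c \<in> charts_at atlas (fst z)"
  shows "twistor_coords c z \<in> local_twistor (snd c ` fst c) (g c)"
proof -
  have "\<forall>c \<in> charts_at atlas (fst z). snd z c \<in> Lambda_plus (g c (snd c (fst z))) \<and>
      form_norm (g c (snd c (fst z))) (snd z c) = 1"
    using z unfolding twistor_space_def mem_Collect_eq case_prod_beta by blast
  from bspec[OF this c] show ?thesis
    using c by (simp add: twistor_coords_def local_twistor_def charts_at_def)
qed

lemma tangent_velocity:
  assumes \<xi>: "\<xi> \<in> twistor_tangent_space atlas g z" and c: "c \<in> charts_at atlas (fst z)"
  shows "\<xi> c \<in> velocities (local_twistor (snd c ` fst c) (g c)) (twistor_coords c z)"
proof -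
  obtain \<gamma> where \<gamma>: "\<gamma> 0 = z" "\<forall>\<^sub>F t in nhds 0. \<gamma> t \<in> twistor_space atlas g" "isCont (\<lambda>t. fst (\<gamma> t)) (0::real)"
      and *: "\<forall>c. if c \<in> charts_at atlas (fst z)
          then ((\<lambda>t. twistor_coords c (\<gamma> t)) has_vector_derivative \<xi> c) (at 0) else \<xi> c = 0"
    using \<xi> unfolding twistor_tangent_space_def by blast
  have d: "(\<lambda>t. twistor_coords c (\<gamma> t)) has_velocity \<xi> c"
    using spec[OF *, of c] c by simp
  have "\<forall>\<^sub>F t in nhds 0. fst (\<gamma> t) \<in> fst c"
    using \<gamma>(1,3) c chart_open[of c]
    by (intro topological_tendstoD[of _ "fst z"]) (auto simp: charts_at_def isCont_def tendsto_nhds_iff)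
  with \<gamma>(2) have "\<forall>\<^sub>F t in nhds 0. twistor_coords c (\<gamma> t) \<in> local_twistor (snd c ` fst c) (g c)"
  proof eventually_elim
    fix t assume "fst (\<gamma> t) \<in> fst c" "\<gamma> t \<in> twistor_space atlas g"
    then show "twistor_coords c (\<gamma> t) \<in> local_twistor (snd c ` fst c) (g c)"
      using c by (intro twistor_coords_in) (simp_all add: charts_at_def)
  qed
  then show ?thesis
    using \<gamma>(1) d unfolding velocities_def
    by (intro CollectI exI[of _ "\<lambda>t. twistor_coords c (\<gamma> t)"]) simp
qed

text \<open>Taming is asked for in every chart around the point, whereas a nonzero tangent vector is only known to have
  some nonzero coordinate expression.  The transition maps of the twistor space are differentiable, so a
  curve with zero velocity in one chart has zero velocity in all.\<close>

lemma tangent_zero_if_chart_zero: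
  assumes \<xi>: "\<xi> \<in> twistor_tangent_space atlas g z" and c: "c \<in> charts_at atlas (fst z)" and 0: "\<xi> c = 0"
  shows "\<xi> = (\<lambda>_. 0)"
proof
  fix c'
  obtain \<gamma> where \<gamma>: "\<gamma> 0 = z" "\<forall>\<^sub>F t in nhds 0. \<gamma> t \<in> twistor_space atlas g" "isCont (\<lambda>t. fst (\<gamma> t)) (0::real)"
      "\<And>c. if c \<in> charts_at atlas (fst z)
          then ((\<lambda>t. twistor_coords c (\<gamma> t)) has_vector_derivative \<xi> c) (at 0) else \<xi> c = 0"
    using \<xi> unfolding twistor_tangent_space_def by blast
  show "\<xi> c' = 0"
  proof (cases "c' \<in> charts_at atlas (fst z)")
    case False
    then show ?thesis using \<gamma>(4)[of c'] by simp
  next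
    case True
    define u u' A A' where "u t = snd c (fst (\<gamma> t))" and "u' t = snd c' (fst (\<gamma> t))"
      and "A t = snd (\<gamma> t) c" and "A' t = snd (\<gamma> t) c'" for t
    note defs = u_def u'_def A_def A'_def
    have d: "(\<lambda>t. u t) has_velocity 0"
        "(\<lambda>t. A t) has_velocity 0"
      using \<gamma>(4)[of c] c 0 bounded_linear.has_vector_derivative[OF bounded_linear_fst, of "\<lambda>t. twistor_coords c (\<gamma> t)" 0]
        bounded_linear.has_vector_derivative[OF bounded_linear_snd, of "\<lambda>t. twistor_coords c (\<gamma> t)" 0]
      by (auto simp: twistor_coords_def defs)
    have d': "(\<lambda>t. u' t) has_velocity fst (\<xi> c')"
        "(\<lambda>t. A' t) has_velocity snd (\<xi> c')"
      using \<gamma>(4)[of c'] True bounded_linear.has_vector_derivative[OF bounded_linear_fst, of "\<lambda>t. twistor_coords c' (\<gamma> t)" _ "at 0"]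
        bounded_linear.has_vector_derivative[OF bounded_linear_snd, of "\<lambda>t. twistor_coords c' (\<gamma> t)" _ "at 0"]
      by (auto simp: twistor_coords_def defs)
    have at: "c \<in> atlas" "c' \<in> atlas" "fst z \<in> fst c" "fst z \<in> fst c'" using c True by (auto simp: charts_at_def)
    have "open (fst c \<inter> fst c')" using chart_open at by blast
    then have ev: "\<forall>\<^sub>F t in nhds 0. fst (\<gamma> t) \<in> fst c \<inter> fst c'"
      using \<gamma>(1,3) at
      by (intro topological_tendstoD[of _ "fst z"]) (auto simp: isCont_def tendsto_nhds_iff)
    have C: "Ck_on k (transition a b) (snd a ` (fst a \<inter> fst b))" if "a \<in> atlas" "b \<in> atlas" for k a b
      using transition_smooth[OF that] by (simp add: smooth_map_on_def)
    have "\<forall>x\<in>fst c \<inter> fst c'. transition c c' differentiable at (snd c x)"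
      using C[OF at(1,2), of "Suc 0"] by simp
    then have diff: "transition c c' differentiable at (u 0)" using at by (simp add: u_def \<gamma>(1))
    have dt: "(\<lambda>t. transition c c' (u t)) has_velocity
        FD (transition c c') (u 0) 0"
      using frechet_derivative_has[OF diff]
      by (intro has_vector_derivative_compose[OF d(1)]) simp
    have dt0: "FD (transition c c') (u 0) 0 = 0"
      by (intro linear_0 linear_frechet_derivative diff)
    have "\<forall>\<^sub>F t in nhds 0. transition c c' (u t) = u' t"
      using ev by eventually_elim (auto simp: transition_def inv_chart at u_def u'_def)
    from has_vector_derivative_transform_eventually[OF dt[unfolded dt0] this]
    have "(\<lambda>t. u' t) has_velocity 0" .
    then have 1: "fst (\<xi> c') = 0"
      by (rule vector_derivative_unique_at[OF d'(1)])
    \<comment> \<open>The components in \<open>c'\<close> are obtained from those in \<open>c\<close> with the Jacobian of the reverse transition.\<close>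
    define K where "K w = matrix (FD (transition c' c) w)" for w
    define S where "S = snd c' ` (fst c' \<inter> fst c)"
    have S: "open S" "u' 0 \<in> S" using open_chart_overlap[OF at(2,1)] at by (auto simp: S_def u'_def \<gamma>(1))
    have "Ck_on (Suc 0) K S"
    proof (intro Ck_on_vec[OF S(1)])
      fix i j
      have "Ck_on (Suc 0) (\<lambda>w. FD (transition c' c) w (axis j 1)) S"
        using C[OF at(2,1), of "Suc (Suc 0)"] by (simp add: S_def)
      then have "Ck_on (Suc 0) (\<lambda>w. FD (transition c' c) w (axis j 1) $ i) S"
        by (rule Ck_on_nth[OF S(1)])
      then show "Ck_on (Suc 0) (\<lambda>w. K w $ i $ j) S" by (simp add: K_def matrix_def)
    qed
    then have "(K has_derivative FD K (u' 0)) (at (u' 0))"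
      using S by (intro frechet_derivative_has) simp
    then have "(\<lambda>t. K (u' t)) has_velocity
        FD K (u' 0) (fst (\<xi> c'))"
      by (rule has_vector_derivative_compose[OF d'(1)])
    moreover have "FD K (u' 0) 0 = 0"
      using \<open>Ck_on (Suc 0) K S\<close> S by (intro linear_0 linear_frechet_derivative) simp
    ultimately have dK: "(\<lambda>t. K (u' t)) has_velocity 0"
      by (simp add: 1)
    have dKt: "(\<lambda>t. transpose (K (u' t))) has_velocity 0"
      using bounded_linear.has_vector_derivative[OF bounded_linear_transpose dK]
      by (simp add: linear_0[OF bounded_linear.linear[OF bounded_linear_transpose]])
    have "(\<lambda>t. transpose (K (u' t)) ** A t ** K (u' t)) has_velocity 0"
      using bounded_bilinear.has_vector_derivative[OF bounded_bilinear_matrix_mult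
          bounded_bilinear.has_vector_derivative[OF bounded_bilinear_matrix_mult dKt d(2)] dK]
      by (simp add: mmul.zero_left mmul.zero_right)
    moreover have "\<forall>\<^sub>F t in nhds 0. transpose (K (u' t)) ** A t ** K (u' t) = A' t"
      using ev \<gamma>(2)
    proof eventually_elim
      fix t assume t: "fst (\<gamma> t) \<in> fst c \<inter> fst c'" "\<gamma> t \<in> twistor_space atlas g"
      have "\<forall>c \<in> charts_at atlas (fst (\<gamma> t)). \<forall>c' \<in> charts_at atlas (fst (\<gamma> t)).
          same_2tensor (fst (\<gamma> t)) c (snd (\<gamma> t) c) c' (snd (\<gamma> t) c')"
        using t(2) unfolding twistor_space_def mem_Collect_eq case_prod_beta by blast
      moreover have "c \<in> charts_at atlas (fst (\<gamma> t))" "c' \<in> charts_at atlas (fst (\<gamma> t))"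
        using t(1) at by (simp_all add: charts_at_def)
      ultimately have "same_2tensor (fst (\<gamma> t)) c' (A' t) c (A t)"
        by (simp add: defs)
      then show "transpose (K (u' t)) ** A t ** K (u' t) = A' t"
        by (simp add: same_2tensor_def jac_def K_def defs)
    qed
    ultimately have "(\<lambda>t. A' t) has_velocity 0"
      by (rule has_vector_derivative_transform_eventually)
    then have "snd (\<xi> c') = 0"
      by (rule vector_derivative_unique_at[OF d'(2)])
    with 1 show ?thesis by (simp add: prod_eq_iff)
  qed
qed

text \<open>Both cases at once: the sign \<open>\<epsilon>\<close> of the determinant is the orientation of the fibres for which the form tames.\<close>

lemma tames_twistor_J:
  assumes \<epsilon>: "\<epsilon> * \<epsilon> = (1::real)" and ineq: "curvature_inequality atlas g"
    and det: "\<And>x c. c \<in> charts_at atlas x \<Longrightarrow> \<epsilon> * det_Wplus_s12 g c x > 0"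
  shows "tames atlas g (\<lambda>c. local_induced_form \<epsilon> (snd c ` fst c) (g c)) (\<lambda>c. twistor_J \<epsilon> (g c))"
  unfolding tames_def
proof (intro ballI impI)
  fix z \<xi> c
  assume z: "z \<in> twistor_space atlas g" and \<xi>: "\<xi> \<in> twistor_tangent_space atlas g z" "\<xi> \<noteq> (\<lambda>_. 0)"
    and c: "c \<in> charts_at atlas (fst z)"
  have at: "c \<in> atlas" using c by (simp add: charts_at_def)
  interpret local_metric "snd c ` fst c" "g c" by (rule local_metric_chart[OF at])
  define u A where "u = fst (twistor_coords c z)" and "A = snd (twistor_coords c z)"
  define M where "M = g c u"
  have tw: "twistor_coords c z \<in> local_twistor (snd c ` fst c) (g c)" by (rule twistor_coords_in[OF z c])
  have u: "u \<in> snd c ` fst c" "u = snd c (fst z)" and A: "A \<in> Lambda_plus M" "form_inner M A A = 1"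
    using tw by (auto simp: local_twistor_iff u_def A_def M_def twistor_coords_def)
  have M: "inner_product_matrix M" unfolding M_def by (rule inner_G[OF u(1)])
  let ?W = "Wplus_s12 (g c) u"
  have W: "linear ?W"
  proof -
    have "?W = Wplus_of (g c u) (lowered (g c) u)" by (rule ext) (rule Wplus_eq[OF u(1)])
    then show ?thesis by (simp add: linear_Wplus_of)
  qed
  have I: "\<bar>form_inner M (?W v) v\<bar> > form_norm M (Ric0 (g c) u v)" if "v \<in> Lambda_plus M" "form_inner M v v = 1" for v
    using ineq c that by (auto simp: curvature_inequality_def Let_def M_def u(2) form_norm_eq_1)
  have nz: "form_inner M (?W v) v \<noteq> 0" if "v \<in> Lambda_plus M" "form_inner M v v = 1" for v
    using I[OF that] form_inner_nonneg[OF M, of "Ric0 (g c) u v"] by (auto simp: form_norm_def dest: real_sqrt_ge_zero)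
  have "sgn (form_inner M (?W A) A) = sgn (det_Wplus_s12 g c (fst z))"
    using form_determinant_sign[OF M W nz A] by (simp add: det_Wplus_s12_def M_def u(2))
  then have "sgn (\<epsilon> * form_inner M (?W A) A) = 1"
    using det[OF c] by (simp add: sgn_mult) (metis sgn_mult sgn_pos)
  then have "\<epsilon> * form_inner M (?W A) A > 0" by (simp add: sgn_1_pos)
  moreover have "\<bar>\<epsilon>\<bar> = 1" using \<epsilon> by (metis abs_mult abs_one abs_square_eq_1 power2_eq_square)
  ultimately have "\<epsilon> * form_inner M (?W A) A = \<bar>form_inner M (?W A) A\<bar>"
    by (metis abs_mult abs_of_pos mult_1)
  then have "\<epsilon> * form_inner M (?W A) A > form_norm M (Ric0 (g c) u A)" using I[OF A] by simp
  then show "local_induced_form \<epsilon> (snd c ` fst c) (g c) (twistor_coords c z) (\<xi> c)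
      (twistor_J \<epsilon> (g c) (twistor_coords c z) (\<xi> c)) > 0"
    using tangent_zero_if_chart_zero[OF \<xi>(1) c] \<xi>(2)
    by (intro induced_form_positive tw tangent_velocity[OF \<xi>(1) c] \<epsilon>) (auto simp: M_def u_def A_def)
qed

end

theorem theorem4p4:
  fixes atlas :: "('a::{t2_space, second_countable_topology}) chart set"
    and g :: "'a chart \<Rightarrow> real^4 \<Rightarrow> real^4^4"
  assumes "oriented_riemannian_4manifold atlas g"
    and "curvature_inequality atlas g"
  shows "((\<forall>x. \<forall>c \<in> charts_at atlas x. det_Wplus_s12 g c x > 0) \<longrightarrow>
            tames atlas g (omega_plus g) (J_plus g)) \<and>
         ((\<forall>x. \<forall>c \<in> charts_at atlas x. det_Wplus_s12 g c x < 0) \<longrightarrow>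
            tames atlas g (omega_minus g) (J_minus g))"
proof -
  interpret oriented_riemannian_4manifold atlas g by fact
  have "omega_plus g = (\<lambda>c. local_induced_form 1 (snd c ` fst c) (g c))"
    "omega_minus g = (\<lambda>c. local_induced_form (- 1) (snd c ` fst c) (g c))"
    "J_plus g = (\<lambda>c. twistor_J 1 (g c))" "J_minus g = (\<lambda>c. twistor_J (- 1) (g c))"
    by (simp_all add: fun_eq_iff omega_plus_def omega_minus_def J_plus_def J_minus_def)
  then show ?thesis
    using tames_twistor_J[of 1] tames_twistor_J[of "- 1"] assms(2) by simp
qed

end
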